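(* Let $\mathcal{F}$ be a family of languages, let $H$ be a group with an $\mathcal{F}$-combing $L$ over a generating set $X$, and let $A$ be a finitely generated abelian group. Let $G$ be a central extension of $A$ by $H$, defined by a section $s:H\to G$ and a cocycle $\sigma:H\times H\to A$. Suppose that $\mathcal{F}$ is closed under GSM mappings and under concatenation with a regular set. Suppose also that $\sigma$ is $L$-regular. Then $G$ has an asynchronous $\mathcal{F}$-combing $L''$. If $L$ is a bicombing, then so is $L''$. If $L$ is synchronous (respectively boundedly asynchronous), then so is $L''$, provided that $L$ is a near geodesic language.
   Context: Generating sets are finite and inverse closed. For a group $G$ with identity $e$ and generating set $X$, $X^*$ is the set of all words over $X$; $w=_G v$ means that $w,v$ represent the same element of $G$; $l(w)$ is the length of $w$ as a string, and $l_G(w)$ is the length of the shortest word $v$ over $X$ with $v=_G w$. $\Gamma_{G,X}$ is the Cayley graph (an edge labelled $x$ from $g$ to $gx$), and $d_{G,X}$ is the graph distance on vertices, extended to the path metric on the 1-skeleton. A word $w$ is identified with the path from $e$ labelled by $w$: for $0\le t<l(w)$, $w(t)$ is the point at distance $t$ along the path, and $w(t)=w(l(w))$ for $t\ge l(w)$. Words $v,w$ synchronously $K$-fellow travel if $d_{G,X}(v(t),w(t))\le K$ for all $t$. They asynchronously $K$-fellow travel if there is a strictly increasing differentiable $h:\mathbf{R}\to\mathbf{R}$ mapping $[0,l(v)]$ onto $[0,l(w)]$ with $d_{G,X}(v(t),w(h(t)))\le K$ for all $t>0$; they do so with bound $M$ if moreover $1/M\le h'(t)\le M$ for all $t\le l(v)$.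 A language for $G$ over $X$ is a subset $L\subseteq X^*$ containing at least one representative of each element of $G$; it is near geodesic if for some constant $\varepsilon$, $l(w)-l_G(w)<\varepsilon$ for all $w\in L$. $L$ is a synchronous (resp. asynchronous) combing if there is a constant $K$ such that all pairs $v,w\in L$ with $w=_G vx$ for some $x\in X\cup\{e\}$ synchronously (resp. asynchronously) $K$-fellow travel. It is a synchronous (resp. asynchronous) bicombing if moreover, for all $v,w\in L$ and $x\in X$ with $w=_G xv$, the words $xv$ and $w$ synchronously (resp. asynchronously) $K$-fellow travel. An asynchronous combing or bicombing is boundedly asynchronous if there is a constant $M$ such that all the relevant pairs asynchronously fellow travel with bound $M$. A combing (resp. bicombing) is a language of any of these six types (resp. of any of the three bicombing types). A group has a combing of a given kind if it has one over some finite generating set. A family of languages $\mathcal{F}$ is any non-empty set of languages over finite alphabets. An $\mathcal{F}$-combing is a combing which is a language in $\mathcal{F}$. A generalised sequential machine (GSM) is a possibly non-deterministic finite state automaton with an output string: each transition appends a (possibly trivial) word to the output string, and when an input word is accepted the current output string is output; the associated GSM mapping sends a language to the set of all outputs produced from accepted words of the language. Closed under concatenation with a regular set: $L\in\mathcal{F}$ and $R$ regular imply $LR=\{uv:u\in L,v\in R\}\in\mathcal{F}$. An extension $G$ of the abelian group $A$ by $H$ (so $A\triangleleft G$, $G/A\cong H$) is specified by the action of $H$ on $A$ together with a section $s:H\to G$ with $s(e)=e$ and a cocycle $\sigma:H\times H\to A$ with $s(h)s(h')=_G s(hh')\sigma(h,h')$; elements of $G$ are written as products $s(h)a$. The extension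 is central if $H$ acts trivially on $A$. The cocycle $\sigma$ is $L$-regular if (a) the sets $\sigma(X,H)$ and $\sigma(H,X)$ are finite, and (b) for each $x\in X$ and $a\in A$, the set $\{v\in L:\sigma(v,x)=a\}$ is regular (where $\sigma(v,x)$ is evaluated on the elements of $H$ represented by $v$ and $x$). *)

theory Defs
  imports "HOL-Analysis.Derivative" "HOL-Algebra.Generated_Groups"
begin

section \<open>Words, word length and the Cayley graph\<close>

definition generating_set :: "('g, 'm) monoid_scheme \<Rightarrow> 'g set \<Rightarrow> bool" where
  "generating_set G X \<longleftrightarrow>
     finite X \<and> X \<subseteq> carrier G \<and> (\<forall>x\<in>X. inv\<^bsub>G\<^esub> x \<in> X) \<and> generate G X = carrier G"

definition word_eval :: "('g, 'm) monoid_scheme \<Rightarrow> 'g list \<Rightarrow> 'g" where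
  "word_eval G w = foldr (\<otimes>\<^bsub>G\<^esub>) w \<one>\<^bsub>G\<^esub>"

definition geodesic_length :: "('g, 'm) monoid_scheme \<Rightarrow> 'g set \<Rightarrow> 'g list \<Rightarrow> nat" where
  "geodesic_length G X w =
     (LEAST n. \<exists>v\<in>lists X. word_eval G v = word_eval G w \<and> length v = n)"

text \<open>Edge paths from \<open>g\<close> to \<open>g'\<close> in the Cayley graph are the words \<open>v\<close> with \<open>g v = g'\<close>.\<close>

definition vertex_dist :: "('g, 'm) monoid_scheme \<Rightarrow> 'g set \<Rightarrow> 'g \<Rightarrow> 'g \<Rightarrow> nat" where
  "vertex_dist G X g g' =
     (LEAST n. \<exists>v\<in>lists X. g \<otimes>\<^bsub>G\<^esub> word_eval G v = g' \<and> length v = n)"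

text \<open>\<open>OnEdge g x r\<close> is the point at distance \<open>r \<in> [0,1]\<close> from \<open>g\<close> on the edge labelled \<open>x\<close>
  from \<open>g\<close> to \<open>g x\<close>. A vertex has several representations; they are at distance 0 from each
  other in \<open>cayley_dist\<close>. There is one edge for every pair \<open>(g, x)\<close>, so the edge labelled
  \<open>inv x\<close> from \<open>g x\<close> to \<open>g\<close> is parallel to the edge labelled \<open>x\<close> from \<open>g\<close> to \<open>g x\<close>.
  Identifying the two would change distances by at most 1.\<close>

datatype 'g cayley_point = Vertex 'g | OnEdge 'g 'g real

fun exits :: "('g, 'm) monoid_scheme \<Rightarrow> 'g cayley_point \<Rightarrow> ('g \<times> real) set" where
  "exits G (Vertex g) = {(g, 0)}"
| "exits G (OnEdge g x r) = {(g, r), (g \<otimes>\<^bsub>G\<^esub> x, 1 - r)}"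

fun within_edge :: "'g cayley_point \<Rightarrow> 'g cayley_point \<Rightarrow> real set" where
  "within_edge (OnEdge g x r) (OnEdge g' x' r') = (if g = g' \<and> x = x' then {\<bar>r - r'\<bar>} else {})"
| "within_edge _ _ = {}"

text \<open>The path metric on the 1-skeleton: a shortest path either stays inside one edge, or leaves
  the edge of \<open>p\<close> through one of its end points, runs along a shortest edge path, and enters the
  edge of \<open>q\<close> through one of its end points.\<close>

definition cayley_dist ::
  "('g, 'm) monoid_scheme \<Rightarrow> 'g set \<Rightarrow> 'g cayley_point \<Rightarrow> 'g cayley_point \<Rightarrow> real" where
  "cayley_dist G X p q =
     Min ((\<lambda>((g, c), (g', c')). c + real (vertex_dist G X g g') + c') ` (exits G p \<times> exits G q)
          \<union> within_edge p q)"

text \<open>Only used for \<open>t \<ge> 0\<close>.\<close>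

definition word_path :: "('g, 'm) monoid_scheme \<Rightarrow> 'g list \<Rightarrow> real \<Rightarrow> 'g cayley_point" where
  "word_path G w t =
     (if t < real (length w)
      then OnEdge (word_eval G (take (nat \<lfloor>t\<rfloor>) w)) (w ! nat \<lfloor>t\<rfloor>) (frac t)
      else Vertex (word_eval G w))"


section \<open>Fellow travelling\<close>

definition sync_fellow_travel ::
  "('g, 'm) monoid_scheme \<Rightarrow> 'g set \<Rightarrow> real \<Rightarrow> 'g list \<Rightarrow> 'g list \<Rightarrow> bool" where
  "sync_fellow_travel G X K v w \<longleftrightarrow>
     (\<forall>t\<ge>0. cayley_dist G X (word_path G v t) (word_path G w t) \<le> K)"

definition async_fellow_travel_via ::
  "('g, 'm) monoid_scheme \<Rightarrow> 'g set \<Rightarrow> real \<Rightarrow> 'g list \<Rightarrow> 'g list \<Rightarrow> (real \<Rightarrow> real) \<Rightarrow> bool" where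
  "async_fellow_travel_via G X K v w h \<longleftrightarrow>
     strict_mono h \<and> (\<forall>t. h differentiable (at t)) \<and>
     h ` {0..real (length v)} = {0..real (length w)} \<and>
     (\<forall>t>0. cayley_dist G X (word_path G v t) (word_path G w (h t)) \<le> K)"

definition async_fellow_travel ::
  "('g, 'm) monoid_scheme \<Rightarrow> 'g set \<Rightarrow> real \<Rightarrow> 'g list \<Rightarrow> 'g list \<Rightarrow> bool" where
  "async_fellow_travel G X K v w \<longleftrightarrow> (\<exists>h. async_fellow_travel_via G X K v w h)"

definition bounded_async_fellow_travel ::
  "('g, 'm) monoid_scheme \<Rightarrow> 'g set \<Rightarrow> real \<Rightarrow> real \<Rightarrow> 'g list \<Rightarrow> 'g list \<Rightarrow> bool" where
  "bounded_async_fellow_travel G X K M v w \<longleftrightarrow>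
     (\<exists>h. async_fellow_travel_via G X K v w h \<and>
          (\<forall>t\<le>real (length v). 1 / M \<le> deriv h t \<and> deriv h t \<le> M))"


section \<open>Combings and bicombings\<close>

definition language_for :: "('g, 'm) monoid_scheme \<Rightarrow> 'g set \<Rightarrow> 'g list set \<Rightarrow> bool" where
  "language_for G X L \<longleftrightarrow>
     generating_set G X \<and> L \<subseteq> lists X \<and> (\<forall>g\<in>carrier G. \<exists>w\<in>L. word_eval G w = g)"

definition near_geodesic :: "('g, 'm) monoid_scheme \<Rightarrow> 'g set \<Rightarrow> 'g list set \<Rightarrow> bool" where
  "near_geodesic G X L \<longleftrightarrow>
     (\<exists>\<epsilon>::real. \<forall>w\<in>L. real (length w) - real (geodesic_length G X w) < \<epsilon>)"

definition combing_wrt ::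
  "('g, 'm) monoid_scheme \<Rightarrow> 'g set \<Rightarrow> ('g list \<Rightarrow> 'g list \<Rightarrow> bool) \<Rightarrow> 'g list set \<Rightarrow> bool" where
  "combing_wrt G X ft L \<longleftrightarrow> language_for G X L \<and>
     (\<forall>v\<in>L. \<forall>w\<in>L. \<forall>x\<in>X \<union> {\<one>\<^bsub>G\<^esub>}. word_eval G w = word_eval G v \<otimes>\<^bsub>G\<^esub> x \<longrightarrow> ft v w)"

definition bicombing_wrt ::
  "('g, 'm) monoid_scheme \<Rightarrow> 'g set \<Rightarrow> ('g list \<Rightarrow> 'g list \<Rightarrow> bool) \<Rightarrow> 'g list set \<Rightarrow> bool" where
  "bicombing_wrt G X ft L \<longleftrightarrow> combing_wrt G X ft L \<and>
     (\<forall>v\<in>L. \<forall>w\<in>L. \<forall>x\<in>X. word_eval G w = x \<otimes>\<^bsub>G\<^esub> word_eval G v \<longrightarrow> ft (x # v) w)"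

definition sync_combing :: "('g, 'm) monoid_scheme \<Rightarrow> 'g set \<Rightarrow> 'g list set \<Rightarrow> bool" where
  "sync_combing G X L \<longleftrightarrow> (\<exists>K. combing_wrt G X (sync_fellow_travel G X K) L)"

definition async_combing :: "('g, 'm) monoid_scheme \<Rightarrow> 'g set \<Rightarrow> 'g list set \<Rightarrow> bool" where
  "async_combing G X L \<longleftrightarrow> (\<exists>K. combing_wrt G X (async_fellow_travel G X K) L)"

definition bounded_async_combing :: "('g, 'm) monoid_scheme \<Rightarrow> 'g set \<Rightarrow> 'g list set \<Rightarrow> bool" where
  "bounded_async_combing G X L \<longleftrightarrow>
     (\<exists>K M. combing_wrt G X (bounded_async_fellow_travel G X K M) L)"

definition sync_bicombing :: "('g, 'm) monoid_scheme \<Rightarrow> 'g set \<Rightarrow> 'g list set \<Rightarrow> bool" where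
  "sync_bicombing G X L \<longleftrightarrow> (\<exists>K. bicombing_wrt G X (sync_fellow_travel G X K) L)"

definition async_bicombing :: "('g, 'm) monoid_scheme \<Rightarrow> 'g set \<Rightarrow> 'g list set \<Rightarrow> bool" where
  "async_bicombing G X L \<longleftrightarrow> (\<exists>K. bicombing_wrt G X (async_fellow_travel G X K) L)"

definition bounded_async_bicombing :: "('g, 'm) monoid_scheme \<Rightarrow> 'g set \<Rightarrow> 'g list set \<Rightarrow> bool" where
  "bounded_async_bicombing G X L \<longleftrightarrow>
     (\<exists>K M. bicombing_wrt G X (bounded_async_fellow_travel G X K M) L)"

definition bicombing :: "('g, 'm) monoid_scheme \<Rightarrow> 'g set \<Rightarrow> 'g list set \<Rightarrow> bool" where
  "bicombing G X L \<longleftrightarrow>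
     sync_bicombing G X L \<or> async_bicombing G X L \<or> bounded_async_bicombing G X L"

definition combing :: "('g, 'm) monoid_scheme \<Rightarrow> 'g set \<Rightarrow> 'g list set \<Rightarrow> bool" where
  "combing G X L \<longleftrightarrow>
     sync_combing G X L \<or> async_combing G X L \<or> bounded_async_combing G X L \<or> bicombing G X L"


section \<open>Regular languages, generalised sequential machines, families of languages\<close>

text \<open>A machine is a finite automaton, possibly non-deterministic. Every transition
  \<open>(p, x, u, q)\<close> reads one input letter \<open>x\<close> and appends the word \<open>u\<close> to the output. States are
  drawn from \<open>nat\<close>, which loses no generality since the set of states is finite.\<close>

record ('a, 'b) gsm =
  states :: "nat set"
  start :: nat
  final :: "nat set"
  trans :: "(nat \<times> 'a \<times> 'b list \<times> nat) set"

definition is_gsm :: "('a, 'b) gsm \<Rightarrow> bool" where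
  "is_gsm M \<longleftrightarrow> finite (states M) \<and> start M \<in> states M \<and> final M \<subseteq> states M \<and>
     finite (trans M) \<and> (\<forall>(p, x, u, q)\<in>trans M. p \<in> states M \<and> q \<in> states M)"

inductive gsm_run :: "('a, 'b) gsm \<Rightarrow> nat \<Rightarrow> 'a list \<Rightarrow> 'b list \<Rightarrow> nat \<Rightarrow> bool"
  for M where
  "gsm_run M p [] [] p"
| "(p, x, u, q) \<in> trans M \<Longrightarrow> gsm_run M q w y r \<Longrightarrow> gsm_run M p (x # w) (u @ y) r"

definition gsm_map :: "('a, 'b) gsm \<Rightarrow> 'a list set \<Rightarrow> 'b list set" where
  "gsm_map M L = {y. \<exists>w\<in>L. \<exists>q\<in>final M. gsm_run M (start M) w y q}"

record 'a automaton =
  astates :: "nat set"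
  astart :: nat
  afinal :: "nat set"
  atrans :: "(nat \<times> 'a \<times> nat) set"

definition is_automaton :: "'a automaton \<Rightarrow> bool" where
  "is_automaton M \<longleftrightarrow> finite (astates M) \<and> astart M \<in> astates M \<and> afinal M \<subseteq> astates M \<and>
     finite (atrans M) \<and> (\<forall>(p, x, q)\<in>atrans M. p \<in> astates M \<and> q \<in> astates M)"

inductive automaton_run :: "'a automaton \<Rightarrow> nat \<Rightarrow> 'a list \<Rightarrow> nat \<Rightarrow> bool"
  for M where
  "automaton_run M p [] p"
| "(p, x, q) \<in> atrans M \<Longrightarrow> automaton_run M q w r \<Longrightarrow> automaton_run M p (x # w) r"

definition regular :: "'a list set \<Rightarrow> bool" where
  "regular R \<longleftrightarrow>
     (\<exists>M. is_automaton M \<and> R = {w. \<exists>q\<in>afinal M. automaton_run M (astart M) w q})"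

text \<open>A family contains languages over different finite alphabets, among them the generating
  sets of different groups, so its letters are drawn from one fixed infinite supply \<open>nat\<close>.\<close>

definition language_family :: "nat list set set \<Rightarrow> bool" where
  "language_family \<F> \<longleftrightarrow> \<F> \<noteq> {} \<and> (\<forall>L\<in>\<F>. \<exists>\<Sigma>. finite \<Sigma> \<and> L \<subseteq> lists \<Sigma>)"

definition closed_under_gsm :: "nat list set set \<Rightarrow> bool" where
  "closed_under_gsm \<F> \<longleftrightarrow> (\<forall>M L. is_gsm M \<longrightarrow> L \<in> \<F> \<longrightarrow> gsm_map M L \<in> \<F>)"

definition closed_under_concat_regular :: "nat list set set \<Rightarrow> bool" where
  "closed_under_concat_regular \<F> \<longleftrightarrow>
     (\<forall>L R. L \<in> \<F> \<longrightarrow> regular R \<longrightarrow> {u @ v | u v. u \<in> L \<and> v \<in> R} \<in> \<F>)"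

text \<open>A language over an arbitrary finite alphabet \<open>X\<close> belongs to the family if it does so after
  an injective renaming of the letters. When the family is closed under GSM mappings, the choice
  of the renaming is irrelevant.\<close>

definition in_family :: "nat list set set \<Rightarrow> 'x set \<Rightarrow> 'x list set \<Rightarrow> bool" where
  "in_family \<F> X L \<longleftrightarrow> L \<subseteq> lists X \<and> (\<exists>c. inj_on c X \<and> map c ` L \<in> \<F>)"


section \<open>Extensions and regular cocycles\<close>

definition fin_gen_abelian_subgroup :: "('g, 'm) monoid_scheme \<Rightarrow> 'g set \<Rightarrow> bool" where
  "fin_gen_abelian_subgroup G A \<longleftrightarrow> subgroup A G \<and> comm_group (G\<lparr>carrier := A\<rparr>) \<and>
     (\<exists>S. finite S \<and> S \<subseteq> A \<and> generate G S = A)"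

text \<open>\<open>\<phi>\<close> is the identification of \<open>G/A\<close> with \<open>H\<close>; being a section means that the coset of
  \<open>s h\<close> corresponds to \<open>h\<close>.\<close>

definition extension_by_cocycle ::
  "('g, 'm) monoid_scheme \<Rightarrow> 'g set \<Rightarrow> ('h, 'n) monoid_scheme \<Rightarrow> ('g set \<Rightarrow> 'h)
     \<Rightarrow> ('h \<Rightarrow> 'g) \<Rightarrow> ('h \<Rightarrow> 'h \<Rightarrow> 'g) \<Rightarrow> bool" where
  "extension_by_cocycle G A H \<phi> s \<sigma> \<longleftrightarrow>
     group G \<and> group H \<and> A \<lhd> G \<and> \<phi> \<in> iso (G Mod A) H \<and>
     (\<forall>h\<in>carrier H. s h \<in> carrier G \<and> \<phi> (A #>\<^bsub>G\<^esub> s h) = h) \<and>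
     s \<one>\<^bsub>H\<^esub> = \<one>\<^bsub>G\<^esub> \<and>
     (\<forall>h\<in>carrier H. \<forall>h'\<in>carrier H. \<sigma> h h' \<in> A \<and>
        s h \<otimes>\<^bsub>G\<^esub> s h' = s (h \<otimes>\<^bsub>H\<^esub> h') \<otimes>\<^bsub>G\<^esub> \<sigma> h h')"

text \<open>\<open>H\<close> acts on \<open>A\<close> through conjugation by representatives in \<open>G\<close>.\<close>

definition trivial_action ::
  "('g, 'm) monoid_scheme \<Rightarrow> 'g set \<Rightarrow> ('h, 'n) monoid_scheme \<Rightarrow> ('h \<Rightarrow> 'g) \<Rightarrow> bool" where
  "trivial_action G A H s \<longleftrightarrow>
     (\<forall>h\<in>carrier H. \<forall>a\<in>A. s h \<otimes>\<^bsub>G\<^esub> a \<otimes>\<^bsub>G\<^esub> inv\<^bsub>G\<^esub> (s h) = a)"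

definition regular_cocycle ::
  "('h, 'n) monoid_scheme \<Rightarrow> 'h set \<Rightarrow> 'h list set \<Rightarrow> 'a set \<Rightarrow> ('h \<Rightarrow> 'h \<Rightarrow> 'a) \<Rightarrow> bool" where
  "regular_cocycle H X L A \<sigma> \<longleftrightarrow>
     finite {\<sigma> x h | x h. x \<in> X \<and> h \<in> carrier H} \<and>
     finite {\<sigma> h x | h x. h \<in> carrier H \<and> x \<in> X} \<and>
     (\<forall>x\<in>X. \<forall>a\<in>A. regular {v \<in> L. \<sigma> (word_eval H v) x = a})"

end

theory Submission
  imports Defs "HOL-Library.Extended_Nat"
begin

text \<open>
Write a generator of \<open>H\<close> as \<open>x\<close> and let \<open>v\<close> be the prefix of a word of \<open>L\<close> that precedes it. Since \<open>A\<close>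
is central, the cocycle relation gives \<open>s(v) \<cdot> (s(x) \<sigma>(v,x)\<inverse>) = s(vx)\<close>. So the word \<open>lift w\<close>, which
has the letter \<open>s(x) \<sigma>(v,x)\<inverse>\<close> wherever \<open>w\<close> has \<open>x\<close>, has the same length as \<open>w\<close>, is written over a
finite alphabet because \<open>\<sigma>(H,X)\<close> is finite, and passes through exactly the points \<open>s(v)\<close>. The section
\<open>s\<close> does not increase distances if these letters are generators, so fellow travelling of words of \<open>L\<close>
carries over to their lifts. Appending to the lifts the words of a regular language \<open>B\<close> of normal
forms for \<open>A\<close> represents every element \<open>s(h)a\<close> of \<open>G\<close>. That is the language of the theorem; its lemmas
are \<open>extension_language_for\<close> and \<open>extension_combing\<close>.

Two words of it that differ by a generator come from two words of \<open>L\<close> that differ by a generator or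
represent the same element, and from two normal forms whose quotient lies in a finite set of products of
cocycle values and kernel parts of generators. It is enough that such normal forms fellow travel and have nearly equal lengths, which
\<open>kernel_language_exists\<close> provides by induction on the number of generators of \<open>A\<close>.
Every normal form is non-empty, because a reparametrisation of time can map
\<open>[0,0]\<close> only onto \<open>[0,0]\<close>: a combing in the asynchronous sense cannot contain the empty word
beside a non-empty word that ends at a distance at most 1.

Membership in the family is the point where regularity of the cocycle enters. The hypothesis concerns
\<open>\<sigma>(v,x)\<close> for \<open>v\<close> in \<open>L\<close>, whereas a machine that outputs the lift has to know it for all prefixes of
words of \<open>L\<close>. Now \<open>L\<close> is regular, being a finite union of the given regular sets, so a prefix can be
completed to a word of \<open>L\<close> by one of finitely many words \<open>u\<close>; and a finite automaton that reads \<open>vu\<close>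
can guess a fellow traveller in \<open>L\<close> that represents \<open>v\<close>, keeping track of the offset between the two
(\<open>finite_quots_right_mult\<close>, \<open>finite_quots_prefixes\<close>). So the lift is a sequential function with a finite
memory, hence a GSM mapping (\<open>lift_gsm\<close>).

All kinds of fellow travelling are reduced to one discrete notion, a \<open>staircase\<close>: a monotone lattice path
through pairs of prefixes of the two words, each pair having its offset in a finite set \<open>F\<close> and lengths
differing by at most \<open>D\<close>. Asynchronous fellow travelling is the case \<open>D = \<infinity>\<close>
(\<open>async_imp_staircase\<close>, \<open>staircase_imp_async\<close>), while a finite \<open>D\<close> yields synchronous and boundedly
asynchronous fellow travelling. If \<open>L\<close> is near geodesic, then lengths of nearby prefixes nearly agree,
so \<open>D\<close> is finite for a combing of any type (\<open>near_geodesic_staircase\<close>). The case distinctions of the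
theorem thus become one statement about staircases, uniform in \<open>D\<close>.
\<close>

section \<open>Regular languages through left quotients\<close>

definition quot :: "'a list \<Rightarrow> 'a list set \<Rightarrow> 'a list set" where
  "quot v R = {z. v @ z \<in> R}"

text \<open>By Myhill and Nerode, this together with a finite alphabet characterises regularity. It replaces
automata below because closure properties become statements about what determines a quotient.\<close>

definition finite_quots :: "'a list set \<Rightarrow> bool" where
  "finite_quots R \<longleftrightarrow> finite (range (\<lambda>v. quot v R))"

lemma in_quot_iff [simp]: "z \<in> quot v R \<longleftrightarrow> v @ z \<in> R"
  by (simp add: quot_def)

lemma quot_append: "quot (u @ v) R = quot v (quot u R)"
  by (auto simp: quot_def)

lemma finite_range_factor:
  assumes "finite (range \<kappa>)" and "\<And>v v'. \<kappa> v = \<kappa> v' \<Longrightarrow> g v = g v'"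
  shows "finite (range g)"
proof -
  have "g v = g (SOME v'. \<kappa> v' = \<kappa> v)" for v
    by (rule assms(2)) (metis (mono_tags) someI)
  then have "range g \<subseteq> (\<lambda>k. g (SOME v'. \<kappa> v' = k)) ` range \<kappa>"
    by auto
  then show ?thesis
    using assms(1) finite_surj by blast
qed

text \<open>A finite-valued invariant of the word read so far that decides which continuations are accepted
plays the role of the states of an automaton.\<close>

lemma finite_quotsI:
  assumes "finite (range \<kappa>)"
    and "\<And>v v' z. \<kappa> v = \<kappa> v' \<Longrightarrow> v @ z \<in> R \<Longrightarrow> v' @ z \<in> R"
  shows "finite_quots R"
  unfolding finite_quots_def
proof (rule finite_range_factor[OF assms(1)])
  fix v v' assume "\<kappa> v = \<kappa> v'"
  then show "quot v R = quot v' R"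
    using assms(2)[of v v'] assms(2)[of v' v] by auto
qed

lemma automaton_run_Nil_iff: "automaton_run M p [] r \<longleftrightarrow> r = p"
  by (auto elim: automaton_run.cases intro: automaton_run.intros)

lemma automaton_run_Cons_iff:
  "automaton_run M p (x # w) r \<longleftrightarrow> (\<exists>q. (p, x, q) \<in> atrans M \<and> automaton_run M q w r)"
  by (auto elim: automaton_run.cases intro: automaton_run.intros)

lemma automaton_run_append:
  "automaton_run M p (u @ v) r \<longleftrightarrow> (\<exists>q. automaton_run M p u q \<and> automaton_run M q v r)"
  by (induction u arbitrary: p) (auto simp: automaton_run_Nil_iff automaton_run_Cons_iff)

lemma automaton_run_states:
  assumes "is_automaton M" "automaton_run M p w q" "p \<in> astates M"
  shows "q \<in> astates M" "set w \<subseteq> (\<lambda>(p, x, q). x) ` atrans M"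
proof -
  have "q \<in> astates M \<and> set w \<subseteq> (\<lambda>(p, x, q). x) ` atrans M"
    using assms(2,3)
  proof (induction rule: automaton_run.induct)
    case (2 p x q w r)
    have "q \<in> astates M" using assms(1) 2(1) by (auto simp: is_automaton_def)
    then show ?case using 2 by force
  qed simp
  then show "q \<in> astates M" "set w \<subseteq> (\<lambda>(p, x, q). x) ` atrans M" by auto
qed

lemma regular_imp_finite_quots:
  assumes "regular R"
  shows "finite_quots R" and "\<exists>\<Sigma>. finite \<Sigma> \<and> R \<subseteq> lists \<Sigma>"
proof -
  obtain M where M: "is_automaton M" "R = {w. \<exists>q\<in>afinal M. automaton_run M (astart M) w q}"
    using assms unfolding regular_def by blast
  let ?\<kappa> = "\<lambda>v. {q. automaton_run M (astart M) v q}"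
  have "range ?\<kappa> \<subseteq> Pow (astates M)"
    using automaton_run_states(1)[OF M(1)] M(1) by (auto simp: is_automaton_def)
  moreover have "finite (astates M)"
    using M(1) by (simp add: is_automaton_def)
  ultimately have "finite (range ?\<kappa>)"
    by (meson finite_Pow_iff finite_subset)
  then show "finite_quots R"
  proof (rule finite_quotsI)
    fix v v' z assume eq: "?\<kappa> v = ?\<kappa> v'" and "v @ z \<in> R"
    then show "v' @ z \<in> R"
      unfolding M(2) automaton_run_append mem_Collect_eq set_eq_iff by blast
  qed
  have "finite ((\<lambda>(p, x, q). x) ` atrans M)"
    using M(1) by (simp add: is_automaton_def)
  moreover have "R \<subseteq> lists ((\<lambda>(p, x, q). x) ` atrans M)"
    using automaton_run_states(2)[OF M(1)] M by (fastforce simp: is_automaton_def)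
  ultimately show "\<exists>\<Sigma>. finite \<Sigma> \<and> R \<subseteq> lists \<Sigma>" by blast
qed

lemma finite_quots_imp_regular:
  assumes "finite_quots R" "finite \<Sigma>" "R \<subseteq> lists \<Sigma>"
  shows "regular R"
proof -
  let ?Q = "range (\<lambda>v. quot v R)"
  obtain e :: "'a list set \<Rightarrow> nat" where e: "inj_on e ?Q"
    using assms(1) finite_imp_inj_to_nat_seg[of ?Q] unfolding finite_quots_def by blast
  define M where "M = \<lparr>astates = e ` ?Q, astart = e (quot [] R),
     afinal = e ` {q\<in>?Q. [] \<in> q},
     atrans = {(e q, x, e (quot [x] q)) | q x. q \<in> ?Q \<and> x \<in> \<Sigma>}\<rparr>"
  have qx: "quot [x] q \<in> ?Q" if "q \<in> ?Q" for q x
    using that by (auto simp: quot_append[symmetric])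
  have fin: "finite ?Q" using assms(1) by (simp add: finite_quots_def)
  have "atrans M = (\<lambda>(q, x). (e q, x, e (quot [x] q))) ` (?Q \<times> \<Sigma>)"
    by (auto simp: M_def)
  then have "finite (atrans M)" using fin assms(2) by simp
  then have "is_automaton M"
    using fin qx by (auto simp: is_automaton_def M_def)
  have step: "(e q, x, p) \<in> atrans M \<longleftrightarrow> x \<in> \<Sigma> \<and> p = e (quot [x] q)" if "q \<in> ?Q" for q x p
  proof
    assume "(e q, x, p) \<in> atrans M"
    then obtain q' where "q' \<in> ?Q" "e q = e q'" "x \<in> \<Sigma>" "p = e (quot [x] q')"
      by (auto simp: M_def)
    then show "x \<in> \<Sigma> \<and> p = e (quot [x] q)" using inj_onD[OF e _ that] by metis
  qed (use that in \<open>auto simp: M_def\<close>)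
  have run: "automaton_run M (e q) w r \<longleftrightarrow> w \<in> lists \<Sigma> \<and> r = e (quot w q)"
    if "q \<in> ?Q" for q w r
    using that
  proof (induction w arbitrary: q)
    case Nil
    show ?case by (simp add: automaton_run_Nil_iff quot_def)
  next
    case (Cons x w)
    have "quot w (quot [x] q) = quot (x # w) q" by (simp add: quot_def)
    then show ?case
      using Cons.IH[OF qx[OF Cons.prems]] step[OF Cons.prems]
      by (auto simp: automaton_run_Cons_iff)
  qed
  have "(\<exists>q\<in>afinal M. automaton_run M (astart M) w q) \<longleftrightarrow> w \<in> R" for w
  proof -
    have "astart M = e (quot [] R)" by (simp add: M_def)
    then have "automaton_run M (astart M) w q \<longleftrightarrow> w \<in> lists \<Sigma> \<and> q = e (quot w R)" for q
      using run[of "quot [] R" w q] rangeI[of "\<lambda>v. quot v R" "[]"] quot_append[of "[]" w R] by simp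
    moreover have "e (quot w R) \<in> afinal M \<longleftrightarrow> w \<in> R"
    proof
      assume "e (quot w R) \<in> afinal M"
      then obtain q where "q \<in> ?Q" "[] \<in> q" "e (quot w R) = e q" unfolding M_def by auto
      then have "[] \<in> quot w R" using inj_onD[OF e] by blast
      then show "w \<in> R" by simp
    next
      assume "w \<in> R"
      then have "[] \<in> quot w R" by simp
      then show "e (quot w R) \<in> afinal M" unfolding M_def by auto
    qed
    ultimately show ?thesis using assms(3) by auto
  qed
  then have "R = {w. \<exists>q\<in>afinal M. automaton_run M (astart M) w q}" by blast
  with \<open>is_automaton M\<close> show ?thesis unfolding regular_def by blast
qed

lemma finite_quots_finite:
  assumes "finite R"
  shows "finite_quots R"
proof -
  have "quot v R \<subseteq> (\<Union>w\<in>R. (\<lambda>i. drop i w) ` {..length w})" for v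
  proof
    fix z assume "z \<in> quot v R"
    then have "v @ z \<in> R" "z = drop (length v) (v @ z)" "length v \<le> length (v @ z)" by simp_all
    then show "z \<in> (\<Union>w\<in>R. (\<lambda>i. drop i w) ` {..length w})" by blast
  qed
  then have "range (\<lambda>v. quot v R) \<subseteq> Pow (\<Union>w\<in>R. (\<lambda>i. drop i w) ` {..length w})"
    by blast
  then show ?thesis
    unfolding finite_quots_def by (rule finite_subset) (use assms in simp)
qed

lemma finite_quots_lists: "finite_quots (lists \<Sigma>)"
  by (rule finite_quotsI[where \<kappa> = "\<lambda>v. set v \<subseteq> \<Sigma>"]) (auto simp: in_lists_conv_set)

lemma finite_quots_UN:
  assumes "finite I" "\<And>i. i \<in> I \<Longrightarrow> finite_quots (R i)"
  shows "finite_quots (\<Union>i\<in>I. R i)"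
proof (rule finite_quotsI[where \<kappa> = "\<lambda>v. (\<lambda>i. (i, quot v (R i))) ` I"])
  have "range (\<lambda>v. (\<lambda>i. (i, quot v (R i))) ` I) \<subseteq> Pow (\<Union>i\<in>I. {i} \<times> range (\<lambda>v. quot v (R i)))"
    by auto
  then show "finite (range (\<lambda>v. (\<lambda>i. (i, quot v (R i))) ` I))"
    using assms by (elim finite_subset) (simp add: finite_quots_def)
next
  fix v v' z
  assume eq: "(\<lambda>i. (i, quot v (R i))) ` I = (\<lambda>i. (i, quot v' (R i))) ` I"
    and "v @ z \<in> (\<Union>i\<in>I. R i)"
  then obtain i where i: "i \<in> I" "v @ z \<in> R i" by auto
  then have "(i, quot v (R i)) \<in> (\<lambda>i. (i, quot v' (R i))) ` I" using eq by blast
  then have "quot v (R i) = quot v' (R i)" by auto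
  then show "v' @ z \<in> (\<Union>i\<in>I. R i)" using i by (auto simp: set_eq_iff)
qed

lemma finite_quots_Un:
  assumes "finite_quots R" "finite_quots S"
  shows "finite_quots (R \<union> S)"
proof -
  have "finite_quots (\<Union>b\<in>UNIV. if b then R else S)"
    by (rule finite_quots_UN) (use assms in auto)
  then show ?thesis by (simp add: UNIV_bool Un_commute)
qed

lemma finite_quots_Int:
  assumes "finite_quots R" "finite_quots S"
  shows "finite_quots (R \<inter> S)"
proof (rule finite_quotsI[where \<kappa> = "\<lambda>v. (quot v R, quot v S)"])
  have "range (\<lambda>v. (quot v R, quot v S)) \<subseteq> range (\<lambda>v. quot v R) \<times> range (\<lambda>v. quot v S)"
    by auto
  then show "finite (range (\<lambda>v. (quot v R, quot v S)))"
    using assms by (elim finite_subset) (simp add: finite_quots_def)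
qed (auto simp: set_eq_iff)

lemma finite_quots_right_quotient:
  assumes "finite_quots R"
  shows "finite_quots {v. v @ u \<in> R}"
proof (rule finite_quotsI[where \<kappa> = "\<lambda>v. quot v R"])
  fix v v' z assume "quot v R = quot v' R" "v @ z \<in> {v. v @ u \<in> R}"
  then have "z @ u \<in> quot v' R" by auto
  then show "v' @ z \<in> {v. v @ u \<in> R}" by simp
qed (use assms in \<open>simp add: finite_quots_def\<close>)

text \<open>After reading \<open>v\<close>, the remaining word is accepted either through a continuation of \<open>v\<close> within \<open>R\<close>, or
because \<open>v\<close> splits into a word of \<open>R\<close> and the beginning of a word of \<open>S\<close>.\<close>

lemma finite_quots_concat:
  assumes "finite_quots R" "finite_quots S"
  shows "finite_quots {u @ v | u v. u \<in> R \<and> v \<in> S}"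
proof (rule finite_quotsI[where \<kappa> = "\<lambda>v. (quot v R, {quot z S | u z. v = u @ z \<and> u \<in> R})"])
  have "range (\<lambda>v. (quot v R, {quot z S | u z. v = u @ z \<and> u \<in> R}))
    \<subseteq> range (\<lambda>v. quot v R) \<times> Pow (range (\<lambda>v. quot v S))"
    by auto
  then show "finite (range (\<lambda>v. (quot v R, {quot z S | u z. v = u @ z \<and> u \<in> R})))"
    using assms by (elim finite_subset) (simp add: finite_quots_def)
next
  fix v v' z
  assume eq: "(quot v R, {quot z S | u z. v = u @ z \<and> u \<in> R}) =
      (quot v' R, {quot z S | u z. v' = u @ z \<and> u \<in> R})"
    and "v @ z \<in> {u @ v | u v. u \<in> R \<and> v \<in> S}"
  then obtain a b where ab: "v @ z = a @ b" "a \<in> R" "b \<in> S" by auto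
  then consider t where "a = v @ t" "z = t @ b" | t where "v = a @ t" "b = t @ z"
    by (auto simp: append_eq_append_conv2)
  then show "v' @ z \<in> {u @ v | u v. u \<in> R \<and> v \<in> S}"
  proof cases
    case 1
    then have "v' @ t \<in> R" using eq ab by (auto simp: set_eq_iff)
    then show ?thesis using 1 ab by (intro CollectI exI[of _ "v' @ t"] exI[of _ b]) simp
  next
    case 2
    then have "quot t S \<in> {quot z S | u z. v = u @ z \<and> u \<in> R}"
      using ab by auto
    then have "quot t S \<in> {quot z S | u z. v' = u @ z \<and> u \<in> R}"
      using eq by (metis (no_types, lifting) Pair_inject)
    then obtain a' t' where a': "quot t S = quot t' S" "v' = a' @ t'" "a' \<in> R" by auto
    have "z \<in> quot t S" using 2 ab by simp
    then have "t' @ z \<in> S" using a' by simp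
    then show ?thesis using a' by auto
  qed
qed

lemma regular_map_image:
  assumes "regular R"
  shows "regular (map c ` R)"
proof -
  obtain M where M: "is_automaton M" "R = {w. \<exists>q\<in>afinal M. automaton_run M (astart M) w q}"
    using assms unfolding regular_def by blast
  define N where "N = \<lparr>astates = astates M, astart = astart M, afinal = afinal M,
     atrans = (\<lambda>(p, x, q). (p, c x, q)) ` atrans M\<rparr>"
  have "automaton_run N p (map c w) q" if "automaton_run M p w q" for p w q
    using that by induction (force simp: N_def intro: automaton_run.intros)+
  moreover have "\<exists>w. y = map c w \<and> automaton_run M p w q" if "automaton_run N p y q" for p y q
    using that
  proof induction
    case (1 p)
    then show ?case by (auto intro: automaton_run.intros)
  next
    case (2 p x q w r)
    then obtain x' w' where "(p, x', q) \<in> atrans M" "x = c x'" "w = map c w'" "automaton_run M q w' r"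
      by (auto simp: N_def)
    then show ?case
      by (intro exI[of _ "x' # w'"]) (auto intro: automaton_run.intros)
  qed
  ultimately have "map c ` R = {w. \<exists>q\<in>afinal N. automaton_run N (astart N) w q}"
    unfolding M(2) by (fastforce simp: N_def)
  moreover have "is_automaton N"
    using M(1) by (auto simp: is_automaton_def N_def)
  ultimately show ?thesis unfolding regular_def by blast
qed

section \<open>Letter-to-letter sequential maps\<close>

fun seq_map_from :: "('a list \<Rightarrow> 'a \<Rightarrow> 'b) \<Rightarrow> 'a list \<Rightarrow> 'a list \<Rightarrow> 'b list" where
  "seq_map_from out v [] = []"
| "seq_map_from out v (x # w) = out v x # seq_map_from out (v @ [x]) w"

text \<open>The output letter may depend on the whole prefix \<open>v\<close> read so far. This is not a finite-state device in
itself; it becomes one in \<open>seq_map_gsm\<close> when the dependence factors through a finite invariant.\<close>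

definition seq_map :: "('a list \<Rightarrow> 'a \<Rightarrow> 'b) \<Rightarrow> 'a list \<Rightarrow> 'b list" where
  "seq_map out = seq_map_from out []"

definition prefixes_of :: "'a list set \<Rightarrow> 'a list set" where
  "prefixes_of L = {v. \<exists>u. v @ u \<in> L}"

lemma length_seq_map_from [simp]: "length (seq_map_from out v w) = length w"
  by (induction w arbitrary: v) auto

lemma length_seq_map [simp]: "length (seq_map out w) = length w"
  by (simp add: seq_map_def)

lemma take_seq_map: "take i (seq_map out w) = seq_map out (take i w)"
proof -
  have "take i (seq_map_from out v w) = seq_map_from out v (take i w)" for v
    by (induction w arbitrary: v i) (auto simp: take_Cons split: nat.split)
  then show ?thesis by (simp add: seq_map_def)
qed

lemma seq_map_snoc: "seq_map out (w @ [x]) = seq_map out w @ [out w x]"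
proof -
  have "seq_map_from out v (w @ [x]) = seq_map_from out v w @ [out (v @ w) x]" for v
    by (induction w arbitrary: v) auto
  then show ?thesis by (simp add: seq_map_def)
qed

lemma gsm_run_Nil_iff: "gsm_run M p [] y r \<longleftrightarrow> y = [] \<and> r = p"
  by (auto elim: gsm_run.cases intro: gsm_run.intros)

lemma gsm_run_Cons_iff:
  "gsm_run M p (x # w) y r \<longleftrightarrow>
     (\<exists>u q y'. (p, x, u, q) \<in> trans M \<and> y = u @ y' \<and> gsm_run M q w y' r)"
proof
  assume "gsm_run M p (x # w) y r"
  then show "\<exists>u q y'. (p, x, u, q) \<in> trans M \<and> y = u @ y' \<and> gsm_run M q w y' r"
    by cases blast
qed (auto intro: gsm_run.intros)

text \<open>The transitions are read off from all prefixes of words of \<open>L\<close>, and those from prefixes with equal \<open>\<kappa>\<close>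
agree by assumption. All states are final, because the machine is run only on words of \<open>L\<close>. The renamings \<open>c\<close> and \<open>c'\<close> bring the
letters into the alphabet from which the languages of a family are formed.\<close>

lemma seq_map_gsm:
  fixes \<kappa> :: "'a list \<Rightarrow> 'k" and out :: "'a list \<Rightarrow> 'a \<Rightarrow> 'b"
    and c :: "'a \<Rightarrow> 'c" and c' :: "'b \<Rightarrow> 'd"
  assumes X: "finite X" "inj_on c X" "L \<subseteq> lists X" and \<kappa>: "finite (range \<kappa>)" and Y: "finite Y"
    and out_in: "\<And>v x. v @ [x] \<in> prefixes_of L \<Longrightarrow> out v x \<in> Y"
    and cong: "\<And>v v' x. \<lbrakk>v @ [x] \<in> prefixes_of L; v' @ [x] \<in> prefixes_of L; \<kappa> v = \<kappa> v'\<rbrakk>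
        \<Longrightarrow> out v x = out v' x \<and> \<kappa> (v @ [x]) = \<kappa> (v' @ [x])"
  shows "\<exists>M. is_gsm M \<and> gsm_map M (map c ` L) = map c' ` seq_map out ` L"
proof -
  obtain e :: "'k \<Rightarrow> nat" where e: "inj_on e (range \<kappa>)"
    using finite_imp_inj_to_nat_seg[OF \<kappa>] by blast
  define T where "T = {(e (\<kappa> v), c x, [c' (out v x)], e (\<kappa> (v @ [x]))) | v x. v @ [x] \<in> prefixes_of L}"
  define M where "M = \<lparr>states = e ` range \<kappa>, start = e (\<kappa> []), final = e ` range \<kappa>, trans = T\<rparr>"
  have prefX: "x \<in> X" if "v @ [x] \<in> prefixes_of L" for v x
    using that X(3) by (auto simp: prefixes_of_def)
  have "T \<subseteq> e ` range \<kappa> \<times> c ` X \<times> (\<lambda>y. [c' y]) ` Y \<times> e ` range \<kappa>"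
    using out_in prefX by (auto simp: T_def)
  then have "finite T"
    by (rule finite_subset) (use \<kappa> X Y in auto)
  then have "is_gsm M"
    using \<kappa> by (auto simp: is_gsm_def M_def T_def)
  moreover have run: "gsm_run M (e (\<kappa> v)) (map c w) y q \<longleftrightarrow>
      y = map c' (seq_map_from out v w) \<and> q = e (\<kappa> (v @ w))"
    if "v @ w \<in> L" for v w y q
    using that
  proof (induction w arbitrary: v y)
    case Nil
    show ?case by (auto simp: gsm_run_Nil_iff)
  next
    case (Cons x w)
    have pref: "v @ [x] \<in> prefixes_of L"
      using Cons.prems by (auto simp: prefixes_of_def intro: exI[of _ w])
    have step: "(e (\<kappa> v), c x, u, p) \<in> T \<longleftrightarrow> u = [c' (out v x)] \<and> p = e (\<kappa> (v @ [x]))" for u p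
    proof
      assume "(e (\<kappa> v), c x, u, p) \<in> T"
      then obtain v' x' where 1: "e (\<kappa> v) = e (\<kappa> v')" "c x = c x'" "u = [c' (out v' x')]"
        "p = e (\<kappa> (v' @ [x']))" "v' @ [x'] \<in> prefixes_of L"
        unfolding T_def by auto
      have "x' = x" using inj_onD[OF X(2) 1(2)] prefX[OF pref] prefX[OF 1(5)] by simp
      moreover have "\<kappa> v = \<kappa> v'" using inj_onD[OF e 1(1)] by auto
      ultimately show "u = [c' (out v x)] \<and> p = e (\<kappa> (v @ [x]))"
        using 1 cong[of v x v'] pref by simp
    qed (use pref in \<open>auto simp: T_def\<close>)
    have "gsm_run M (e (\<kappa> v)) (map c (x # w)) y q \<longleftrightarrow>
       (\<exists>u p y'. (e (\<kappa> v), c x, u, p) \<in> T \<and> y = u @ y' \<and> gsm_run M p (map c w) y' q)"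
      by (simp add: gsm_run_Cons_iff M_def)
    also have "\<dots> \<longleftrightarrow> (\<exists>y'. y = c' (out v x) # y' \<and>
        gsm_run M (e (\<kappa> (v @ [x]))) (map c w) y' q)"
      by (auto simp: step)
    also have "\<dots> \<longleftrightarrow> y = map c' (seq_map_from out v (x # w)) \<and> q = e (\<kappa> (v @ x # w))"
      using Cons.IH[of "v @ [x]"] Cons.prems by auto
    finally show ?case .
  qed
  have "gsm_map M (map c ` L) = map c' ` seq_map out ` L"
  proof -
    have "gsm_map M (map c ` L) = {y. \<exists>w\<in>L. \<exists>q\<in>final M. gsm_run M (e (\<kappa> [])) (map c w) y q}"
      by (auto simp: gsm_map_def M_def)
    also have "\<dots> = {y. \<exists>w\<in>L. y = map c' (seq_map out w)}"
      using run[of "[]"] by (auto simp: seq_map_def M_def)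
    finally show ?thesis by auto
  qed
  ultimately show ?thesis by blast
qed

section \<open>Offsets and staircases\<close>

text \<open>The distance between \<open>g\<close> and \<open>h\<close> depends only on this element. Bounded distance means an offset in a
finite set, a formulation that does not mention generators and is stable under products of sets.\<close>

definition offset :: "('g, 'm) monoid_scheme \<Rightarrow> 'g \<Rightarrow> 'g \<Rightarrow> 'g" where
  "offset G g h = inv\<^bsub>G\<^esub> g \<otimes>\<^bsub>G\<^esub> h"

context group
begin

lemma word_eval_Nil [simp]: "word_eval G [] = \<one>"
  by (simp add: word_eval_def)

lemma word_eval_Cons [simp]: "word_eval G (x # w) = x \<otimes> word_eval G w"
  by (simp add: word_eval_def)

lemma word_eval_closed [simp, intro]: "set w \<subseteq> carrier G \<Longrightarrow> word_eval G w \<in> carrier G"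
  by (induction w) auto

lemma word_eval_append:
  "\<lbrakk>set v \<subseteq> carrier G; set w \<subseteq> carrier G\<rbrakk> \<Longrightarrow> word_eval G (v @ w) = word_eval G v \<otimes> word_eval G w"
  by (induction v) (auto simp: m_assoc)

lemma offset_closed [simp, intro]: "\<lbrakk>g \<in> carrier G; h \<in> carrier G\<rbrakk> \<Longrightarrow> offset G g h \<in> carrier G"
  by (simp add: offset_def)

lemma offset_self [simp]: "g \<in> carrier G \<Longrightarrow> offset G g g = \<one>"
  by (simp add: offset_def)

lemma offset_one_left [simp]: "h \<in> carrier G \<Longrightarrow> offset G \<one> h = h"
  by (simp add: offset_def)

lemma offset_trans:
  "\<lbrakk>g \<in> carrier G; h \<in> carrier G; k \<in> carrier G\<rbrakk> \<Longrightarrow> offset G g h \<otimes> offset G h k = offset G g k"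
  by (simp add: offset_def m_assoc) (simp add: m_assoc[symmetric])

lemma inv_offset:
  "\<lbrakk>g \<in> carrier G; h \<in> carrier G\<rbrakk> \<Longrightarrow> inv (offset G g h) = offset G h g"
  by (simp add: offset_def inv_mult_group)

lemma mult_offset: "\<lbrakk>g \<in> carrier G; h \<in> carrier G\<rbrakk> \<Longrightarrow> g \<otimes> offset G g h = h"
  by (simp add: offset_def m_assoc[symmetric])

lemma offset_eq_iff:
  "\<lbrakk>g \<in> carrier G; h \<in> carrier G; k \<in> carrier G\<rbrakk> \<Longrightarrow> offset G g h = k \<longleftrightarrow> h = g \<otimes> k"
  using inv_solve_left'[of k g h] by (auto simp: offset_def)

lemma offset_mult_right:
  "\<lbrakk>g \<in> carrier G; h \<in> carrier G; k \<in> carrier G\<rbrakk> \<Longrightarrow> offset G g (h \<otimes> k) = offset G g h \<otimes> k"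
  by (simp add: offset_def m_assoc)

lemma offset_mult_left:
  "\<lbrakk>g \<in> carrier G; h \<in> carrier G; k \<in> carrier G\<rbrakk> \<Longrightarrow> offset G (g \<otimes> k) h = inv k \<otimes> offset G g h"
  by (simp add: offset_def m_assoc inv_mult_group)

end

lemma finite_set_mult: "\<lbrakk>finite A; finite B\<rbrakk> \<Longrightarrow> finite (A <#>\<^bsub>G\<^esub> B)"
  by (simp add: set_mult_def)

lemma set_multI: "\<lbrakk>a \<in> A; b \<in> B\<rbrakk> \<Longrightarrow> a \<otimes>\<^bsub>G\<^esub> b \<in> A <#>\<^bsub>G\<^esub> B"
  by (auto simp: set_mult_def)

definition close_pair ::
  "('g, 'm) monoid_scheme \<Rightarrow> 'g set \<Rightarrow> enat \<Rightarrow> 'g list \<Rightarrow> 'g list \<Rightarrow> bool" where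
  "close_pair G F D v w \<longleftrightarrow> offset G (word_eval G v) (word_eval G w) \<in> F \<and>
     enat (length v) \<le> enat (length w) + D \<and> enat (length w) \<le> enat (length v) + D"

text \<open>A discrete form of fellow travelling: the two words are read letter by letter, one letter of either word
at a time, and all pairs of prefixes on the way are close. The bound \<open>D\<close> on the difference of the lengths
is infinite for asynchronous fellow travelling.\<close>

inductive staircase ::
  "('g, 'm) monoid_scheme \<Rightarrow> 'g set \<Rightarrow> enat \<Rightarrow> 'g list \<Rightarrow> 'g list \<Rightarrow> bool"
  for G F D where
  start: "close_pair G F D [] [] \<Longrightarrow> staircase G F D [] []"
| left: "\<lbrakk>staircase G F D v w; close_pair G F D (v @ [x]) w\<rbrakk> \<Longrightarrow> staircase G F D (v @ [x]) w"
| right: "\<lbrakk>staircase G F D v w; close_pair G F D v (w @ [x])\<rbrakk> \<Longrightarrow> staircase G F D v (w @ [x])"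

lemma staircase_close: "staircase G F D v w \<Longrightarrow> close_pair G F D v w"
  by (induction rule: staircase.induct) auto

text \<open>The order in which the letters are read may be reused for any other pair of words of the same
lengths whose prefixes are close whenever those of the given pair are. The groups may differ.\<close>

lemma staircase_map:
  assumes "staircase G F D v w" "length v' = length v" "length w' = length w"
    and "\<And>i j. \<lbrakk>i \<le> length v; j \<le> length w; close_pair G F D (take i v) (take j w)\<rbrakk>
      \<Longrightarrow> close_pair G' F' D' (take i v') (take j w')"
  shows "staircase G' F' D' v' w'"
  using assms
proof (induction arbitrary: v' w' rule: staircase.induct)
  case start
  then show ?case using start.prems(3)[of 0 0] by (auto intro: staircase.start)
next
  case (left v w x)
  obtain u y where v': "v' = u @ [y]" "length u = length v"
    using left.prems(1) by (cases v' rule: rev_cases) auto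
  have "staircase G' F' D' u w'"
  proof (rule left.IH)
    fix i j assume "i \<le> length v" "j \<le> length w" "close_pair G F D (take i v) (take j w)"
    then show "close_pair G' F' D' (take i u) (take j w')"
      using left.prems(3)[of i j] v' by simp
  qed (use v' left.prems in auto)
  moreover have "close_pair G' F' D' (u @ [y]) w'"
    using left.prems(3)[of "length (v @ [x])" "length w"] left.hyps left.prems v' by simp
  ultimately show ?case unfolding v'(1) by (rule staircase.left)
next
  case (right v w x)
  obtain u y where w': "w' = u @ [y]" "length u = length w"
    using right.prems(2) by (cases w' rule: rev_cases) auto
  have "staircase G' F' D' v' u"
  proof (rule right.IH)
    fix i j assume "i \<le> length v" "j \<le> length w" "close_pair G F D (take i v) (take j w)"
    then show "close_pair G' F' D' (take i v') (take j u)"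
      using right.prems(3)[of i j] w' by simp
  qed (use w' right.prems in auto)
  moreover have "close_pair G' F' D' v' (u @ [y])"
    using right.prems(3)[of "length v" "length (w @ [x])"] right.hyps right.prems w' by simp
  ultimately show ?case unfolding w'(1) by (rule staircase.right)
qed

lemma staircase_mono:
  assumes "staircase G F D v w" "F \<subseteq> F'" "D \<le> D'"
  shows "staircase G F' D' v w"
proof (rule staircase_map[OF assms(1)])
  have "a \<le> b + D \<Longrightarrow> a \<le> b + D'" for a b :: enat
    using assms(3) by (meson add_left_mono order_trans)
  then show "close_pair G F D (take i v) (take j w) \<Longrightarrow> close_pair G F' D' (take i v) (take j w)" for i j
    using assms(2) by (auto simp: close_pair_def)
qed auto

lemma staircase_take:
  assumes "staircase G F D v w" "i \<le> length v"
  shows "\<exists>j\<le>length w. close_pair G F D (take i v) (take j w)"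
  using assms
proof (induction rule: staircase.induct)
  case start
  then show ?case by auto
next
  case (left v w x)
  show ?case
  proof (cases "i \<le> length v")
    case True
    then show ?thesis using left.IH by auto
  next
    case False
    then show ?thesis using left by (auto intro!: exI[of _ "length w"])
  qed
next
  case (right v w x)
  then obtain j where "j \<le> length w" "close_pair G F D (take i v) (take j w)" by auto
  then show ?case by (intro exI[of _ j]) auto
qed

text \<open>After the end of a staircase both words are continued in lock step, the left one moving first.\<close>

lemma staircase_append:
  assumes "staircase G F D v w"
    and "\<And>i. close_pair G F D (v @ take i a) (w @ take i b)"
    and "\<And>i. i < length a \<Longrightarrow> close_pair G F D (v @ take (Suc i) a) (w @ take i b)"
  shows "staircase G F D (v @ a) (w @ b)"
proof -
  have "staircase G F D (v @ take i a) (w @ take i b)" for i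
  proof (induction i)
    case 0
    show ?case using assms(1) by simp
  next
    case (Suc i)
    have "staircase G F D (v @ take (Suc i) a) (w @ take i b)"
    proof (cases "i < length a")
      case True
      have "staircase G F D ((v @ take i a) @ [a ! i]) (w @ take i b)"
        by (rule staircase.left[OF Suc]) (use assms(3)[OF True] True in \<open>simp add: take_Suc_conv_app_nth\<close>)
      then show ?thesis using True by (simp add: take_Suc_conv_app_nth)
    qed (use Suc in simp)
    then show ?case
    proof (cases "i < length b")
      case True
      assume st: "staircase G F D (v @ take (Suc i) a) (w @ take i b)"
      have "staircase G F D (v @ take (Suc i) a) ((w @ take i b) @ [b ! i])"
        by (rule staircase.right[OF st]) (use assms(2)[of "Suc i"] True in \<open>simp add: take_Suc_conv_app_nth\<close>)
      then show ?thesis using True by (simp add: take_Suc_conv_app_nth)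
    qed simp
  qed
  from this[of "max (length a) (length b)"] show ?thesis by simp
qed

text \<open>The identity letter does not move the left word but puts it one step ahead in length. This makes a
trivial left translation an instance of a left translation by a generator.\<close>

lemma (in group) staircase_Cons_one:
  assumes "staircase G F D v w" "set v \<subseteq> carrier G" "set w \<subseteq> carrier G"
  shows "staircase G F (D + 1) (\<one> # v) w"
proof -
  have mono: "a \<le> b + D \<Longrightarrow> a \<le> b + (D + 1)" for a b :: enat
    by (metis add.assoc add_increasing2 zero_le)
  have close: "close_pair G F (D + 1) (\<one> # v) w"
    if "close_pair G F D v w" "set v \<subseteq> carrier G" for v w
  proof -
    have "enat (Suc n) \<le> m + (D + 1)" if "enat n \<le> m + D" for n m
      using add_right_mono[OF that, of 1] by (simp add: add.assoc one_enat_def)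
    moreover have "m \<le> enat (Suc n) + (D + 1)" if "m \<le> enat n + D" for n m
    proof -
      have "enat n + D \<le> enat (Suc n) + (D + 1)" by (intro add_mono) (auto simp: add_increasing2)
      then show ?thesis using that by (rule order_trans[rotated])
    qed
    ultimately show ?thesis using that by (auto simp: close_pair_def)
  qed
  show ?thesis using assms
  proof (induction rule: staircase.induct)
    case start
    then have "staircase G F (D + 1) [] []"
      by (intro staircase.start) (auto simp: close_pair_def)
    then have "staircase G F (D + 1) ([] @ [\<one>]) []"
      by (rule staircase.left) (use start close in auto)
    then show ?case by simp
  next
    case (left v w x)
    have "staircase G F (D + 1) ((\<one> # v) @ [x]) w"
      by (rule staircase.left) (use left close[of "v @ [x]" w] in auto)
    then show ?case by simp
  next
    case (right v w x)
    show ?case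
      by (rule staircase.right) (use right close[of v "w @ [x]"] in auto)
  qed
qed

text \<open>Here \<open>b i\<close> is the last position of the right word reached while the left word stands at \<open>i\<close>, so
that in row \<open>i\<close> the right word runs from \<open>b (i - 1)\<close> to \<open>b i\<close>. Beyond the end of the left word \<open>b\<close>
continues as a constant, which makes it monotone on all natural numbers.\<close>

lemma staircase_rows:
  assumes "staircase G F D v w"
  obtains b :: "nat \<Rightarrow> nat" where "mono b" "\<And>i. length v \<le> i \<Longrightarrow> b i = length w"
    "\<And>i j. \<lbrakk>i \<le> length v; i = 0 \<or> b (i - 1) \<le> j; j \<le> b i\<rbrakk>
       \<Longrightarrow> offset G (word_eval G (take i v)) (word_eval G (take j w)) \<in> F"
proof -
  let ?P = "\<lambda>v w b. mono b \<and> (\<forall>i\<ge>length v. b i = length w) \<and>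
      (\<forall>i j. i \<le> length v \<longrightarrow> i = 0 \<or> b (i - 1) \<le> j \<longrightarrow> j \<le> b i \<longrightarrow>
         offset G (word_eval G (take i v)) (word_eval G (take j w)) \<in> F)"
  have "\<exists>b. ?P v w b"
    using assms
  proof (induction rule: staircase.induct)
    case start
    then show ?case by (intro exI[of _ "\<lambda>_. 0"]) (auto simp: close_pair_def mono_def)
  next
    case (left v w x)
    then obtain b where b: "?P v w b" by blast
    have "?P (v @ [x]) w b"
    proof (intro conjI allI impI)
      fix i j assume ij: "i \<le> length (v @ [x])" "i = 0 \<or> b (i - 1) \<le> j" "j \<le> b i"
      show "offset G (word_eval G (take i (v @ [x]))) (word_eval G (take j w)) \<in> F"
      proof (cases "i \<le> length v")
        case True
        then show ?thesis using b ij by auto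
      next
        case False
        then have "i = Suc (length v)" using ij by simp
        then have "j = length w" using b ij by auto
        then show ?thesis using \<open>i = _\<close> left.hyps by (simp add: close_pair_def)
      qed
    qed (use b in auto)
    then show ?case by blast
  next
    case (right v w x)
    then obtain b where b: "?P v w b" by blast
    define b' where "b' i = (if length v \<le> i then Suc (length w) else b i)" for i
    have bw: "b i \<le> length w" for i
      using b monoD[of b i "max i (length v)"] by auto
    have "?P v (w @ [x]) b'"
    proof (intro conjI allI impI)
      show "mono b'"
        using b bw by (auto simp: b'_def mono_def le_SucI)
      fix i j assume ij: "i \<le> length v" "i = 0 \<or> b' (i - 1) \<le> j" "j \<le> b' i"
      show "offset G (word_eval G (take i v)) (word_eval G (take j (w @ [x]))) \<in> F"
      proof (cases "j \<le> b i")
        case True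
        have "i = 0 \<or> b (i - 1) \<le> j"
          using ij by (cases i) (auto simp: b'_def split: if_splits)
        then show ?thesis using b ij True bw[of i] by auto
      next
        case False
        then have "i = length v" "j = Suc (length w)" using ij b by (auto simp: b'_def split: if_splits)
        then show ?thesis using right.hyps by (simp add: close_pair_def)
      qed
    qed (auto simp: b'_def)
    then show ?case by blast
  qed
  then show ?thesis using that by blast
qed

section \<open>Smooth monotone interpolation\<close>

definition half_parabola :: "real \<Rightarrow> real" where
  "half_parabola x = (if x \<le> 0 then 0 else x\<^sup>2)"

lemma half_parabola_differentiable: "half_parabola differentiable (at x)"
proof -
  consider "x < 0" | "x = 0" | "x > 0" by linarith
  then show ?thesis
  proof cases
    case 1
    have "((\<lambda>_. 0::real) has_derivative (\<lambda>_. 0)) (at x)" by simp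
    then have "(half_parabola has_derivative (\<lambda>_. 0)) (at x)"
      by (rule has_derivative_transform_within_open[where s = "{..<0}"])
        (use 1 in \<open>auto simp: half_parabola_def\<close>)
    then show ?thesis unfolding differentiable_def by blast
  next
    case 3
    have "((\<lambda>x::real. x\<^sup>2) has_derivative (\<lambda>d. 2 * x * d)) (at x)"
      by (auto intro!: derivative_eq_intros)
    then have "(half_parabola has_derivative (\<lambda>d. 2 * x * d)) (at x)"
      by (rule has_derivative_transform_within_open[where s = "{0<..}"])
        (use 3 in \<open>auto simp: half_parabola_def\<close>)
    then show ?thesis unfolding differentiable_def by blast
  next
    case 2
    have "((\<lambda>h. half_parabola h / h) \<longlongrightarrow> 0) (at 0)"
    proof (rule Lim_null_comparison)
      show "\<forall>\<^sub>F h in at 0. norm (half_parabola h / h) \<le> \<bar>h\<bar>"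
        by (auto simp: half_parabola_def power2_eq_square abs_mult intro!: always_eventually)
      show "((\<lambda>h::real. \<bar>h\<bar>) \<longlongrightarrow> 0) (at 0)"
        by (intro tendsto_eq_intros) auto
    qed
    then have "(half_parabola has_field_derivative 0) (at 0)"
      by (simp add: DERIV_def half_parabola_def)
    then show ?thesis using 2 real_differentiable_def by blast
  qed
qed

text \<open>The denominator never vanishes, since \<open>x\<close> and \<open>1 - x\<close> cannot both be non-positive. The function rises
from 0 to 1 on the unit interval and is differentiable everywhere.\<close>

definition smooth_step :: "real \<Rightarrow> real" where
  "smooth_step x = half_parabola x / (half_parabola x + half_parabola (1 - x))"

lemma half_parabola_nonneg: "0 \<le> half_parabola x"
  by (simp add: half_parabola_def)

lemma half_parabola_mono: "x \<le> y \<Longrightarrow> half_parabola x \<le> half_parabola y"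
  by (auto simp: half_parabola_def intro: power_mono)

lemma smooth_step_denominator: "0 < half_parabola x + half_parabola (1 - x)"
proof (cases "x \<le> 0")
  case True
  then have "0 < half_parabola (1 - x)" by (simp add: half_parabola_def)
  then show ?thesis using half_parabola_nonneg[of x] by linarith
next
  case False
  then have "0 < half_parabola x" by (simp add: half_parabola_def)
  then show ?thesis using half_parabola_nonneg[of "1 - x"] by linarith
qed

lemma smooth_step_outside: "x \<le> 0 \<Longrightarrow> smooth_step x = 0" "1 \<le> x \<Longrightarrow> smooth_step x = 1"
  by (auto simp: smooth_step_def half_parabola_def)

lemma smooth_step_mono:
  assumes "x \<le> y"
  shows "smooth_step x \<le> smooth_step y"
proof -
  have "half_parabola x * half_parabola (1 - y) \<le> half_parabola y * half_parabola (1 - x)"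
    using assms by (intro mult_mono half_parabola_mono half_parabola_nonneg) auto
  then have "half_parabola x * (half_parabola y + half_parabola (1 - y))
      \<le> half_parabola y * (half_parabola x + half_parabola (1 - x))"
    by (simp add: algebra_simps)
  then show ?thesis
    unfolding smooth_step_def
    using smooth_step_denominator[of x] smooth_step_denominator[of y]
    by (simp add: pos_divide_le_eq pos_le_divide_eq)
qed

lemma smooth_step_differentiable: "smooth_step differentiable (at x)"
proof -
  have "(\<lambda>x. half_parabola (1 - x)) differentiable (at x)"
    using differentiable_compose[of half_parabola "\<lambda>x. 1 - x" x UNIV] half_parabola_differentiable
    by simp
  then have "(\<lambda>x. half_parabola x / (half_parabola x + half_parabola (1 - x))) differentiable (at x)"
    using half_parabola_differentiable smooth_step_denominator[of x]
    by (intro differentiable_divide differentiable_add) auto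
  then show ?thesis by (simp add: smooth_step_def[abs_def])
qed

text \<open>A sum of smooth steps of heights \<open>c (i + 1) - c i\<close> interpolates \<open>c\<close>, but it is constant where \<open>c\<close> is.
Adding \<open>t / m\<close> makes it strictly increasing on the whole line, and rescaling by \<open>n / (n + 1)\<close> restores
the value \<open>n\<close> at \<open>m\<close>. Both changes move values by at most 1.\<close>

lemma smooth_interpolation:
  fixes c :: "nat \<Rightarrow> nat"
  assumes c: "mono c" "c 0 = 0" "c m = n" and "0 < m" "0 < n"
  obtains h :: "real \<Rightarrow> real" where "strict_mono h" "\<And>t. h differentiable (at t)"
    "h 0 = 0" "h (real m) = real n"
    "\<And>i t. \<lbrakk>i < m; real i \<le> t; t \<le> real i + 1\<rbrakk> \<Longrightarrow> real (c i) - 1 \<le> h t \<and> h t \<le> real (c (Suc i)) + 1"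
proof -
  define \<delta> where "\<delta> k = real (c (Suc k)) - real (c k)" for k
  define f where "f t = (\<Sum>k<m. \<delta> k * smooth_step (t - real k))" for t
  define h where "h t = (f t + t / real m) * (real n / (real n + 1))" for t
  have \<delta>: "0 \<le> \<delta> k" for k
    using monoD[OF c(1), of k "Suc k"] by (simp add: \<delta>_def)
  have f_mono: "f t \<le> f u" if "t \<le> u" for t u
    unfolding f_def using that by (intro sum_mono mult_left_mono smooth_step_mono \<delta>) auto
  have f_nat: "f (real i) = real (c i)" if "i \<le> m" for i
  proof -
    have "f (real i) = (\<Sum>k<m. if k < i then \<delta> k else 0)"
      unfolding f_def by (intro sum.cong) (auto simp: smooth_step_outside)
    also have "\<dots> = (\<Sum>k<i. \<delta> k)"
      using that by (intro sum.mono_neutral_cong_right) auto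
    also have "\<dots> = real (c i)"
      unfolding \<delta>_def by (subst sum_lessThan_telescope) (simp add: c)
    finally show ?thesis .
  qed
  have frac_pos: "0 < real n / (real n + 1)" using \<open>0 < n\<close> by simp
  have smono: "strict_mono h"
  proof (rule strict_monoI)
    fix t u :: real assume "t < u"
    then have "f t + t / real m < f u + u / real m"
      using f_mono[of t u] \<open>0 < m\<close> divide_strict_right_mono[of t u "real m"] by simp
    then show "h t < h u" unfolding h_def using frac_pos by (rule mult_strict_right_mono)
  qed
  moreover have "h differentiable (at t)" for t
  proof -
    have "(\<lambda>t. smooth_step (t - real k)) differentiable (at t)" for k
      using differentiable_compose[of smooth_step "\<lambda>t. t - real k" t UNIV] smooth_step_differentiable
      by simp
    then have "f differentiable (at t)"
      unfolding f_def[abs_def] by (intro differentiable_sum differentiable_mult) auto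
    then show ?thesis
      unfolding h_def[abs_def] using \<open>0 < m\<close>
      by (intro differentiable_mult differentiable_add differentiable_divide) auto
  qed
  moreover have "h 0 = 0"
    using f_nat[of 0] c by (simp add: h_def)
  moreover have "h (real m) = real n"
    using f_nat[of m] c \<open>0 < m\<close> by (simp add: h_def)
  moreover have "real (c i) - 1 \<le> h t \<and> h t \<le> real (c (Suc i)) + 1"
    if "i < m" "real i \<le> t" "t \<le> real i + 1" for i t
  proof -
    have lo: "real (c i) \<le> f t" using f_mono[of "real i" t] f_nat[of i] that by simp
    have hi: "f t \<le> real (c (Suc i))" using f_mono[of t "real (Suc i)"] f_nat[of "Suc i"] that by simp
    have "real (Suc i) \<le> real m" using that by linarith
    then have q: "0 \<le> t / real m" "t / real m \<le> 1" using that by auto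
    have "c i \<le> n" using monoD[OF c(1), of i m] c that by simp
    then have "real (c i) - 1 \<le> real (c i) * (real n / (real n + 1))"
      by (simp add: field_simps)
    also have "\<dots> \<le> h t"
      unfolding h_def using lo q frac_pos by (intro mult_right_mono) auto
    finally have 1: "real (c i) - 1 \<le> h t" .
    have "h t \<le> (f t + t / real m) * 1"
      unfolding h_def using lo q by (intro mult_left_mono) auto
    then show ?thesis using 1 hi q by simp
  qed
  ultimately show ?thesis using that by blast
qed

section \<open>Fellow travelling and staircases\<close>

definition word_ball :: "('g, 'm) monoid_scheme \<Rightarrow> 'g set \<Rightarrow> nat \<Rightarrow> 'g set" where
  "word_ball G X n = word_eval G ` {w \<in> lists X. length w \<le> n}"

text \<open>Instead of \<open>generate\<close>, the locale states that words represent all elements; this is how the existence of a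
language enters the metric arguments.\<close>

locale marked_group = group +
  fixes X
  assumes finite_X: "finite X" and X_sub: "X \<subseteq> carrier G"
    and X_inv: "x \<in> X \<Longrightarrow> inv x \<in> X"
    and words_exist: "g \<in> carrier G \<Longrightarrow> \<exists>w\<in>lists X. word_eval G w = g"

lemma (in group) marked_group_language_for: "language_for G X L \<Longrightarrow> marked_group G X"
  unfolding language_for_def generating_set_def
  by unfold_locales blast+

context marked_group
begin

lemma lists_carrier: "w \<in> lists X \<Longrightarrow> set w \<subseteq> carrier G"
  using X_sub by auto

lemma take_lists: "w \<in> lists X \<Longrightarrow> take i w \<in> lists X"
  by (auto dest: in_set_takeD)

lemma drop_lists: "w \<in> lists X \<Longrightarrow> drop i w \<in> lists X"
  by (auto dest: in_set_dropD)

lemma eval_in [simp, intro]: "w \<in> lists X \<Longrightarrow> word_eval G w \<in> carrier G"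
  by (rule word_eval_closed[OF lists_carrier])

lemma eval_take_in [simp, intro]: "w \<in> lists X \<Longrightarrow> word_eval G (take i w) \<in> carrier G"
  using eval_in[OF take_lists] .

lemma eval_app: "\<lbrakk>v \<in> lists X; w \<in> lists X\<rbrakk> \<Longrightarrow> word_eval G (v @ w) = word_eval G v \<otimes> word_eval G w"
  using word_eval_append[OF lists_carrier lists_carrier] .

lemma finite_word_ball: "finite (word_ball G X n)"
proof -
  have "{w \<in> lists X. length w \<le> n} = {w. set w \<subseteq> X \<and> length w \<le> n}" by auto
  then show ?thesis
    unfolding word_ball_def using finite_lists_length_le[OF finite_X] by simp
qed

lemma word_ball_carrier: "g \<in> word_ball G X n \<Longrightarrow> g \<in> carrier G"
  by (auto simp: word_ball_def)

lemma word_ball_mono: "m \<le> n \<Longrightarrow> g \<in> word_ball G X m \<Longrightarrow> g \<in> word_ball G X n"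
  by (force simp: word_ball_def)

lemma word_ball_mult:
  "\<lbrakk>g \<in> word_ball G X m; h \<in> word_ball G X n\<rbrakk> \<Longrightarrow> g \<otimes> h \<in> word_ball G X (m + n)"
proof -
  assume "g \<in> word_ball G X m" "h \<in> word_ball G X n"
  then obtain u v where "u \<in> lists X" "v \<in> lists X" "length u \<le> m" "length v \<le> n"
    "g = word_eval G u" "h = word_eval G v"
    by (auto simp: word_ball_def)
  then show ?thesis
    unfolding word_ball_def by (intro image_eqI[of _ _ "u @ v"]) (simp_all add: eval_app)
qed

lemma word_ball_letter: "x \<in> X \<Longrightarrow> x \<in> word_ball G X 1"
  unfolding word_ball_def using X_sub by (intro image_eqI[of _ _ "[x]"]) auto

lemma word_ball_one: "\<one> \<in> word_ball G X n"
  unfolding word_ball_def by (intro image_eqI[of _ _ "[]"]) auto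

lemma word_ball_eval: "w \<in> lists X \<Longrightarrow> length w \<le> n \<Longrightarrow> word_eval G w \<in> word_ball G X n"
  by (auto simp: word_ball_def)

lemma word_ball_inv: "g \<in> word_ball G X n \<Longrightarrow> inv g \<in> word_ball G X n"
proof -
  have *: "inv (word_eval G w) = word_eval G (rev (map (\<lambda>x. inv x) w)) \<and> rev (map (\<lambda>x. inv x) w) \<in> lists X"
    if "w \<in> lists X" for w
    using that
  proof (induction w)
    case (Cons x w)
    let ?r = "rev (map (\<lambda>x. inv x) w)"
    have w: "w \<in> lists X" "?r \<in> lists X" "inv (word_eval G w) = word_eval G ?r" using Cons by auto
    have x: "x \<in> carrier G" "[inv x] \<in> lists X" using Cons.hyps X_sub X_inv by auto
    have "inv (word_eval G (x # w)) = word_eval G ?r \<otimes> inv x"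
      using x w by (simp add: inv_mult_group)
    moreover have "word_eval G (?r @ [inv x]) = word_eval G ?r \<otimes> inv x"
      using eval_app[OF w(2) x(2)] x by simp
    ultimately show ?case using w x by simp
  qed simp
  assume "g \<in> word_ball G X n"
  then obtain w where "w \<in> lists X" "length w \<le> n" "g = word_eval G w"
    by (auto simp: word_ball_def)
  then show ?thesis
    using *[of w] word_ball_eval[of "rev (map (\<lambda>x. inv x) w)" n] by simp
qed

text \<open>Conversely, a finite set of offsets gives a bound on distances.\<close>

lemma finite_subset_word_ball:
  assumes "finite F" "F \<subseteq> carrier G"
  obtains n where "F \<subseteq> word_ball G X n"
proof -
  have "\<forall>g\<in>F. \<exists>n. g \<in> word_ball G X n"
    using assms(2) words_exist word_ball_eval by (metis order_refl subsetD)
  then obtain N where N: "\<And>g. g \<in> F \<Longrightarrow> g \<in> word_ball G X (N g)" by metis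
  have "g \<in> word_ball G X (\<Sum>g\<in>F. N g)" if "g \<in> F" for g
    by (rule word_ball_mono[OF _ N[OF that]]) (simp add: assms(1) that member_le_sum)
  then show ?thesis using that by blast
qed

lemma offset_ball_trans:
  "\<lbrakk>g \<in> carrier G; h \<in> carrier G; k \<in> carrier G; offset G g h \<in> word_ball G X m; offset G h k \<in> word_ball G X n\<rbrakk>
     \<Longrightarrow> offset G g k \<in> word_ball G X (m + n)"
  using word_ball_mult[of "offset G g h" m "offset G h k" n] by (simp add: offset_trans)

lemma offset_ball_sym:
  "\<lbrakk>g \<in> carrier G; h \<in> carrier G; offset G g h \<in> word_ball G X n\<rbrakk> \<Longrightarrow> offset G h g \<in> word_ball G X n"
  using word_ball_inv[of "offset G g h" n] by (simp add: inv_offset)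

lemma offset_take_ball:
  assumes "w \<in> lists X" "i \<le> j + n" "j \<le> i + n"
  shows "offset G (word_eval G (take i w)) (word_eval G (take j w)) \<in> word_ball G X n"
proof -
  have *: "offset G (word_eval G (take i w)) (word_eval G (take j w)) \<in> word_ball G X n"
    if "i \<le> j" "j \<le> i + n" for i j
  proof -
    have "take j w = take i w @ drop i (take j w)"
      using that by (metis append_take_drop_id min.absorb1 take_take)
    moreover have "drop i (take j w) \<in> lists X"
      using assms(1) drop_lists take_lists by blast
    ultimately have "word_eval G (take j w) = word_eval G (take i w) \<otimes> word_eval G (drop i (take j w))"
      using eval_app assms(1) take_lists by metis
    then have "offset G (word_eval G (take i w)) (word_eval G (take j w)) = word_eval G (drop i (take j w))"
      using assms(1) \<open>drop i (take j w) \<in> lists X\<close> by (simp add: offset_eq_iff)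
    moreover have "length (drop i (take j w)) \<le> n" using that by simp
    ultimately show ?thesis using word_ball_eval \<open>drop i (take j w) \<in> lists X\<close> by simp
  qed
  show ?thesis
  proof (cases "i \<le> j")
    case False
    show ?thesis by (rule offset_ball_sym) (use False *[of j i] assms in auto)
  qed (use * assms in auto)
qed

text \<open>This converts all metric statements into statements about offsets.\<close>

lemma vertex_dist_le_iff:
  assumes "g \<in> carrier G" "h \<in> carrier G"
  shows "vertex_dist G X g h \<le> n \<longleftrightarrow> offset G g h \<in> word_ball G X n"
proof -
  have eq: "g \<otimes> word_eval G v = h \<longleftrightarrow> offset G g h = word_eval G v" if "v \<in> lists X" for v
    using assms that by (auto simp: offset_eq_iff)
  let ?P = "\<lambda>n. \<exists>v\<in>lists X. g \<otimes> word_eval G v = h \<and> length v = n"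
  have "\<exists>n. ?P n" using words_exist[of "offset G g h"] assms eq by force
  then have "?P (vertex_dist G X g h)" unfolding vertex_dist_def by (rule LeastI_ex)
  then have "offset G g h \<in> word_ball G X n" if "vertex_dist G X g h \<le> n"
    using that eq by (auto simp: word_ball_def)
  moreover have "vertex_dist G X g h \<le> n" if "offset G g h \<in> word_ball G X n"
  proof -
    obtain v where "v \<in> lists X" "length v \<le> n" "offset G g h = word_eval G v"
      using \<open>offset G g h \<in> word_ball G X n\<close> by (auto simp: word_ball_def)
    then have "?P (length v)" using eq by auto
    then have "vertex_dist G X g h \<le> length v" unfolding vertex_dist_def by (rule Least_le)
    then show ?thesis using \<open>length v \<le> n\<close> by simp
  qed
  ultimately show ?thesis by blast
qed

text \<open>The vertex at which the edge that contains the point at time \<open>t\<close> begins. Replacing points by these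
vertices changes distances by at most 1 at either end, which accounts for the constant 2 below.\<close>

definition base :: "'a list \<Rightarrow> real \<Rightarrow> 'a" where
  "base w t = word_eval G (take (nat \<lfloor>t\<rfloor>) w)"

lemma base_in [simp]: "w \<in> lists X \<Longrightarrow> base w t \<in> carrier G"
  by (simp add: base_def)

lemma exits_word_path:
  assumes "w \<in> lists X" "0 \<le> t"
  shows "finite (exits G (word_path G w t))"
    and "\<exists>c. (base w t, c) \<in> exits G (word_path G w t) \<and> 0 \<le> c \<and> c \<le> 1"
    and "(g, c) \<in> exits G (word_path G w t) \<Longrightarrow>
           g \<in> carrier G \<and> 0 \<le> c \<and> offset G (base w t) g \<in> word_ball G X 1"
proof -
  show "finite (exits G (word_path G w t))"
    by (simp add: word_path_def)
  have fr: "0 \<le> frac t" "frac t \<le> 1" by (auto simp: less_imp_le[OF frac_lt_1])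
  show "\<exists>c. (base w t, c) \<in> exits G (word_path G w t) \<and> 0 \<le> c \<and> c \<le> 1"
  proof (cases "t < real (length w)")
    case True
    then show ?thesis using fr by (auto simp: word_path_def base_def)
  next
    case False
    then have "length w \<le> nat \<lfloor>t\<rfloor>" by (simp add: le_nat_iff le_floor_iff)
    then show ?thesis using False by (auto simp: word_path_def base_def)
  qed
  assume gc: "(g, c) \<in> exits G (word_path G w t)"
  show "g \<in> carrier G \<and> 0 \<le> c \<and> offset G (base w t) g \<in> word_ball G X 1"
  proof (cases "t < real (length w)")
    case True
    let ?k = "nat \<lfloor>t\<rfloor>"
    have "real ?k < real (length w)" using True assms(2) of_nat_floor[OF assms(2)] by linarith
    then have k: "?k < length w" by simp
    then have x: "w ! ?k \<in> X" "w ! ?k \<in> carrier G" using assms(1) X_sub by (auto simp: in_lists_conv_set)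
    have "(g = base w t \<and> c = frac t) \<or> (g = base w t \<otimes> w ! ?k \<and> c = 1 - frac t)"
      using gc True by (auto simp: word_path_def base_def)
    moreover have "offset G (base w t) (base w t \<otimes> w ! ?k) = w ! ?k"
      using x assms(1) by (simp add: offset_eq_iff)
    ultimately show ?thesis
      using base_in[OF assms(1), of t] x fr word_ball_one word_ball_letter[OF x(1)] by auto
  next
    case False
    then have "length w \<le> nat \<lfloor>t\<rfloor>" by (simp add: le_nat_iff le_floor_iff)
    then have "g = base w t" "c = 0" using gc False by (auto simp: word_path_def base_def)
    then show ?thesis using base_in[OF assms(1), of t] word_ball_one by simp
  qed
qed

lemma within_edge_word_path:
  assumes "r \<in> within_edge (word_path G v t) (word_path G w u)"
  shows "0 \<le> r \<and> base v t = base w u"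
  using assms
  by (cases "t < real (length v)"; cases "u < real (length w)") (auto simp: word_path_def base_def split: if_splits)

lemma cayley_dist_base:
  assumes "v \<in> lists X" "w \<in> lists X" "0 \<le> t" "0 \<le> u"
  shows "cayley_dist G X (word_path G v t) (word_path G w u) \<le> real (vertex_dist G X (base v t) (base w u)) + 2"
    and "real (vertex_dist G X (base v t) (base w u)) \<le> cayley_dist G X (word_path G v t) (word_path G w u) + 2"
proof -
  let ?p = "word_path G v t" and ?q = "word_path G w u"
  let ?f = "\<lambda>((g, c), (g', c')). c + real (vertex_dist G X g g') + c'"
  let ?S = "?f ` (exits G ?p \<times> exits G ?q) \<union> within_edge ?p ?q"
  have "finite (within_edge ?p ?q)"
    by (cases "?p"; cases "?q") auto
  then have fin: "finite ?S"
    using exits_word_path(1) assms by simp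
  obtain c where c: "(base v t, c) \<in> exits G ?p" "0 \<le> c" "c \<le> 1"
    using exits_word_path(2)[OF assms(1,3)] by blast
  obtain c' where c': "(base w u, c') \<in> exits G ?q" "0 \<le> c'" "c' \<le> 1"
    using exits_word_path(2)[OF assms(2,4)] by blast
  have mem: "c + real (vertex_dist G X (base v t) (base w u)) + c' \<in> ?S"
    using c c' by (auto intro!: image_eqI[where x = "((base v t, c), (base w u, c'))"])
  then have "Min ?S \<le> c + real (vertex_dist G X (base v t) (base w u)) + c'"
    using fin by (rule Min_le[rotated])
  then show "cayley_dist G X ?p ?q \<le> real (vertex_dist G X (base v t) (base w u)) + 2"
    unfolding cayley_dist_def using c c' by linarith
  have "real (vertex_dist G X (base v t) (base w u)) \<le> r + 2" if r: "r \<in> ?S" for r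
    using r
  proof
    assume "r \<in> within_edge ?p ?q"
    then have "0 \<le> r" "base v t = base w u" using within_edge_word_path by auto
    moreover have "vertex_dist G X (base v t) (base v t) \<le> 0"
      using assms(1) word_ball_one by (subst vertex_dist_le_iff) auto
    ultimately show ?thesis by simp
  next
    assume "r \<in> ?f ` (exits G ?p \<times> exits G ?q)"
    then obtain g c g' c' where r: "(g, c) \<in> exits G ?p" "(g', c') \<in> exits G ?q"
      "r = c + real (vertex_dist G X g g') + c'" by auto
    note g = exits_word_path(3)[OF assms(1,3) r(1)] and g' = exits_word_path(3)[OF assms(2,4) r(2)]
    have 0: "offset G g g' \<in> word_ball G X (vertex_dist G X g g')"
      using vertex_dist_le_iff[of g g' "vertex_dist G X g g'"] g g' by simp
    have 1: "offset G (base v t) g' \<in> word_ball G X (1 + vertex_dist G X g g')"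
      by (rule offset_ball_trans[OF _ _ _ _ 0]) (use g g' base_in[OF assms(1)] in auto)
    have 2: "offset G g' (base w u) \<in> word_ball G X 1"
      by (rule offset_ball_sym) (use g' base_in[OF assms(2)] in auto)
    have "offset G (base v t) (base w u) \<in> word_ball G X (1 + vertex_dist G X g g' + 1)"
      by (rule offset_ball_trans[OF _ _ _ 1 2]) (use g' base_in[OF assms(1)] base_in[OF assms(2)] in auto)
    then have "vertex_dist G X (base v t) (base w u) \<le> vertex_dist G X g g' + 2"
      using assms by (subst vertex_dist_le_iff) auto
    then show ?thesis using r(3) g g' by linarith
  qed
  moreover have "Min ?S \<in> ?S" using fin mem by (intro Min_in) auto
  ultimately show "real (vertex_dist G X (base v t) (base w u)) \<le> cayley_dist G X ?p ?q + 2"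
    unfolding cayley_dist_def by blast
qed

lemma cayley_dist_imp_offset:
  assumes "v \<in> lists X" "w \<in> lists X" "0 \<le> t" "0 \<le> u"
    and "cayley_dist G X (word_path G v t) (word_path G w u) \<le> K"
  shows "offset G (base v t) (base w u) \<in> word_ball G X (nat \<lceil>K\<rceil> + 2)"
proof -
  have "real (vertex_dist G X (base v t) (base w u)) \<le> K + 2"
    using cayley_dist_base(2)[OF assms(1-4)] assms(5) by linarith
  then have "vertex_dist G X (base v t) (base w u) \<le> nat \<lceil>K\<rceil> + 2" by linarith
  then show ?thesis using assms by (subst (asm) vertex_dist_le_iff) auto
qed

lemma offset_imp_cayley_dist:
  assumes "v \<in> lists X" "w \<in> lists X" "0 \<le> t" "0 \<le> u"
    and "offset G (base v t) (base w u) \<in> word_ball G X n"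
  shows "cayley_dist G X (word_path G v t) (word_path G w u) \<le> real (n + 2)"
proof -
  have "vertex_dist G X (base v t) (base w u) \<le> n"
    using assms by (subst vertex_dist_le_iff) auto
  then show ?thesis using cayley_dist_base(1)[OF assms(1-4)] by linarith
qed

lemma close_pair_infinity:
  "close_pair G F \<infinity> v w \<longleftrightarrow> offset G (word_eval G v) (word_eval G w) \<in> F"
  by (simp add: close_pair_def)

text \<open>Two constants 2 and 1 are added: 2 for rounding to vertices and 1 for the intermediate pair in which only
the left word has moved.\<close>

lemma sync_imp_staircase:
  assumes "v \<in> lists X" "w \<in> lists X" and ft: "sync_fellow_travel G X K v w"
  shows "staircase G (word_ball G X (nat \<lceil>K\<rceil> + 3)) \<infinity> v w"
proof -
  let ?F = "word_ball G X (nat \<lceil>K\<rceil> + 3)"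
  have near: "offset G (word_eval G (take i v)) (word_eval G (take i w)) \<in> word_ball G X (nat \<lceil>K\<rceil> + 2)" for i
  proof -
    have "cayley_dist G X (word_path G v (real i)) (word_path G w (real i)) \<le> K"
      using ft by (simp add: sync_fellow_travel_def)
    then show ?thesis
      using cayley_dist_imp_offset[OF assms(1,2), of "real i" "real i" K] by (simp add: base_def)
  qed
  have "staircase G ?F \<infinity> ([] @ v) ([] @ w)"
  proof (rule staircase_append)
    show "staircase G ?F \<infinity> [] []"
      by (rule staircase.start) (simp add: close_pair_infinity word_ball_one)
    show "close_pair G ?F \<infinity> ([] @ take i v) ([] @ take i w)" for i
      unfolding close_pair_infinity append_Nil by (rule word_ball_mono[OF _ near[of i]]) linarith
    show "close_pair G ?F \<infinity> ([] @ take (Suc i) v) ([] @ take i w)" for i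
    proof -
      have 1: "offset G (word_eval G (take (Suc i) v)) (word_eval G (take i v)) \<in> word_ball G X 1"
        by (rule offset_take_ball[OF assms(1)]) simp_all
      have "offset G (word_eval G (take (Suc i) v)) (word_eval G (take i w)) \<in> word_ball G X (1 + (nat \<lceil>K\<rceil> + 2))"
        by (rule offset_ball_trans[OF _ _ _ 1 near]) (rule eval_take_in assms)+
      then show ?thesis by (simp add: close_pair_infinity eval_nat_numeral)
    qed
  qed
  then show ?thesis by simp
qed

text \<open>While the left word stands at \<open>i\<close>, the right word is read up to the rounded value of the
reparametrisation at \<open>i\<close>. It maps end points to end points, being
a strictly increasing map of one interval onto the other.\<close>

lemma async_imp_staircase:
  assumes "v \<in> lists X" "w \<in> lists X" and ft: "async_fellow_travel G X K v w"
  shows "staircase G (word_ball G X (nat \<lceil>K\<rceil> + 3)) \<infinity> v w"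
proof -
  let ?F = "word_ball G X (nat \<lceil>K\<rceil> + 3)"
  let ?m = "length v" and ?n = "length w"
  obtain h where h: "strict_mono h" "h ` {0..real ?m} = {0..real ?n}"
    "\<And>t. t > 0 \<Longrightarrow> cayley_dist G X (word_path G v t) (word_path G w (h t)) \<le> K"
    using ft unfolding async_fellow_travel_def async_fellow_travel_via_def by blast
  have less: "h t \<le> h u \<longleftrightarrow> t \<le> u" for t u by (simp add: strict_mono_less_eq[OF h(1)])
  have "0 \<in> h ` {0..real ?m}" "real ?n \<in> h ` {0..real ?m}" unfolding h(2) by auto
  then obtain z y where z: "0 \<le> z" "h z = 0" and y: "y \<le> real ?m" "h y = real ?n" by auto
  have "h 0 \<in> {0..real ?n}" "h (real ?m) \<in> {0..real ?n}" unfolding h(2)[symmetric] by auto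
  then have h0: "h 0 = 0" and hm: "h (real ?m) = real ?n"
    using z less[of 0 z] y less[of y "real ?m"] by auto
  define b where "b i = nat \<lfloor>h (real i)\<rfloor>" for i
  have hpos: "0 \<le> h t" if "0 \<le> t" for t using less[of 0 t] h0 that by simp
  have near: "offset G (base v t) (base w (h t)) \<in> word_ball G X (nat \<lceil>K\<rceil> + 2)" if "0 \<le> t" for t
  proof (cases "t = 0")
    case True
    then show ?thesis by (simp add: h0 base_def word_ball_one)
  next
    case False
    then show ?thesis using cayley_dist_imp_offset[OF assms(1,2)] h(3)[of t] hpos that by simp
  qed
  have row: "close_pair G ?F \<infinity> (take (Suc i) v) (take j w)"
    if "i < ?m" "b i \<le> j" "j \<le> b (Suc i)" for i j
  proof -
    \<comment> \<open>Each position of the right word between the two rounded values is reached at some time in between.\<close>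
    have "\<exists>t. real i \<le> t \<and> t \<le> real (Suc i) \<and> nat \<lfloor>h t\<rfloor> = j"
    proof (cases "j = b i")
      case True
      then show ?thesis by (intro exI[of _ "real i"]) (simp add: b_def)
    next
      case False
      then have "b i < j" using that by simp
      then have 1: "h (real i) < real j" unfolding b_def using hpos[of "real i"] by linarith
      have 2: "real j \<le> h (real (Suc i))"
        using that(3) hpos[of "real (Suc i)"] unfolding b_def by linarith
      have "h (real (Suc i)) \<le> real ?n" using that(1) less[of "real (Suc i)" "real ?m"] hm by simp
      then have "real j \<in> h ` {0..real ?m}" using h(2) 2 by auto
      then obtain t where t: "h t = real j" by auto
      then have "real i \<le> t" "t \<le> real (Suc i)" using less[of t "real i"] less[of t "real (Suc i)"] 1 2 by auto
      then show ?thesis using t by auto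
    qed
    then obtain t where t: "real i \<le> t" "t \<le> real (Suc i)" "nat \<lfloor>h t\<rfloor> = j" by blast
    then have 2: "offset G (base v t) (word_eval G (take j w)) \<in> word_ball G X (nat \<lceil>K\<rceil> + 2)"
      using near[of t] by (simp add: base_def)
    have 1: "offset G (word_eval G (take (Suc i) v)) (base v t) \<in> word_ball G X 1"
      unfolding base_def by (rule offset_take_ball[OF assms(1)]) (use t in linarith)+
    have "offset G (word_eval G (take (Suc i) v)) (word_eval G (take j w)) \<in> word_ball G X (1 + (nat \<lceil>K\<rceil> + 2))"
      by (rule offset_ball_trans[OF _ _ _ 1 2]) (rule eval_take_in base_in assms)+
    then show ?thesis by (simp add: close_pair_infinity eval_nat_numeral)
  qed
  have b_mono: "b i \<le> b (Suc i)" for i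
    unfolding b_def using less[of "real i" "real (Suc i)"] by (intro nat_mono floor_mono) simp
  have b_le: "b i \<le> ?n" if "i \<le> ?m" for i
    using less[of "real i" "real ?m"] hm that unfolding b_def by (simp add: nat_le_iff floor_le_iff)
  have "staircase G ?F \<infinity> (take i v) (take (b i) w)" if "i \<le> ?m" for i
    using that
  proof (induction i)
    case 0
    then show ?case by (auto simp: b_def h0 close_pair_infinity word_ball_one intro: staircase.start)
  next
    case (Suc i)
    then have st: "staircase G ?F \<infinity> (take i v) (take (b i) w)" and i: "i < ?m" by auto
    have "staircase G ?F \<infinity> (take (Suc i) v) (take (b i + k) w)" if "b i + k \<le> b (Suc i)" for k
      using that
    proof (induction k)
      case 0
      have "staircase G ?F \<infinity> (take i v @ [v ! i]) (take (b i) w)"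
        by (rule staircase.left[OF st]) (use row[OF i, of "b i"] 0 i in \<open>simp add: take_Suc_conv_app_nth\<close>)
      then show ?case using i by (simp add: take_Suc_conv_app_nth)
    next
      case (Suc k)
      then have st: "staircase G ?F \<infinity> (take (Suc i) v) (take (b i + k) w)" by simp
      have lt: "b i + k < ?n" using Suc.prems b_le[of "Suc i"] i by simp
      have "staircase G ?F \<infinity> (take (Suc i) v) (take (b i + k) w @ [w ! (b i + k)])"
        by (rule staircase.right[OF st])
          (use row[OF i, of "Suc (b i + k)"] Suc.prems lt in \<open>simp add: take_Suc_conv_app_nth\<close>)
      then show ?case using lt by (simp add: take_Suc_conv_app_nth)
    qed
    from this[of "b (Suc i) - b i"] show ?case using b_mono[of i] by simp
  qed
  from this[of ?m] show ?thesis by (simp add: b_def hm)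
qed

text \<open>The left prefix of length \<open>i\<close> is paired with a right prefix whose length differs from \<open>i\<close> by at most
\<open>d\<close>, and the latter prefix is \<open>d\<close>-close to the right prefix of length \<open>i\<close>.\<close>

lemma staircase_sync_offset:
  assumes "v \<in> lists X" "w \<in> lists X" and st: "staircase G F (enat d) v w" and F: "F \<subseteq> word_ball G X k"
  shows "offset G (word_eval G (take i v)) (word_eval G (take i w)) \<in> word_ball G X (k + d)"
proof -
  obtain j where j: "close_pair G F (enat d) (take i v) (take j w)"
    "i \<le> length v \<Longrightarrow> i \<le> j + d \<and> j \<le> i + d" "length v < i \<Longrightarrow> j = length w \<and> length w \<le> length v + d"
  proof (cases "i \<le> length v")
    case True
    then obtain j where "j \<le> length w" "close_pair G F (enat d) (take i v) (take j w)"
      using staircase_take[OF st] by blast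
    then show ?thesis using that[of j] True by (auto simp: close_pair_def)
  next
    case False
    then show ?thesis using staircase_close[OF st] that[of "length w"] by (auto simp: close_pair_def)
  qed
  have 2: "offset G (word_eval G (take j w)) (word_eval G (take i w)) \<in> word_ball G X d"
  proof (cases "length v < i \<and> length w \<le> i")
    case True
    then show ?thesis using j(3) assms(2) word_ball_one by simp
  next
    case False
    then show ?thesis using j(2,3) by (intro offset_take_ball[OF assms(2)]) linarith+
  qed
  have 1: "offset G (word_eval G (take i v)) (word_eval G (take j w)) \<in> word_ball G X k"
    using j(1) F by (auto simp: close_pair_def)
  show ?thesis
    by (rule offset_ball_trans[OF _ _ _ 1 2]) (rule eval_take_in assms)+
qed

lemma staircase_imp_sync:
  assumes "v \<in> lists X" "w \<in> lists X" and st: "staircase G F (enat d) v w" and F: "F \<subseteq> word_ball G X k"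
  shows "sync_fellow_travel G X (real (k + d + 2)) v w"
  unfolding sync_fellow_travel_def
  using offset_imp_cayley_dist[OF assms(1,2), of t t "k + d" for t] staircase_sync_offset[OF assms]
  by (simp add: base_def)

end

lemma image_interval_mono:
  fixes h :: "real \<Rightarrow> real"
  assumes "strict_mono h" "\<And>t. h differentiable (at t)" "0 \<le> a" "h 0 = 0" "h a = b"
  shows "h ` {0..a} = {0..b}"
proof
  have less: "h t \<le> h u \<longleftrightarrow> t \<le> u" for t u by (simp add: strict_mono_less_eq[OF assms(1)])
  show "h ` {0..a} \<subseteq> {0..b}"
    using less[of 0] less[of _ a] assms(4,5) by auto
  have cont: "continuous_on {0..a} h"
    using assms(2) by (simp add: continuous_at_imp_continuous_on differentiable_imp_continuous_within)
  show "{0..b} \<subseteq> h ` {0..a}"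
  proof
    fix y assume "y \<in> {0..b}"
    then obtain t where "0 \<le> t" "t \<le> a" "h t = y"
      using IVT'[of h 0 y a] assms(3-5) cont by auto
    then show "y \<in> h ` {0..a}" by auto
  qed
qed

context marked_group
begin

text \<open>If the lengths differ by at most \<open>d\<close>, then the linear reparametrisation stays within \<open>d\<close> of the identity,
and for non-empty words its slope lies between \<open>1 / (d + 1)\<close> and \<open>d + 1\<close>.\<close>

lemma staircase_imp_bounded_async:
  assumes "v \<in> lists X" "w \<in> lists X" and st: "staircase G F (enat d) v w" and F: "F \<subseteq> word_ball G X k"
    and ne: "v \<noteq> []" "w \<noteq> []"
  shows "bounded_async_fellow_travel G X (real (k + 2 * d + 3)) (real (d + 1)) v w"
proof -
  define m where "m = real (length v)"
  define n where "n = real (length w)"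
  have mn: "1 \<le> m" "1 \<le> n" using ne by (simp_all add: m_def n_def Suc_le_eq)
  have len: "n \<le> m + real d" "m \<le> n + real d"
    using staircase_close[OF st] by (auto simp: close_pair_def m_def n_def)
  define h where "h t = n / m * t" for t
  have der: "(h has_real_derivative n / m) (at t)" for t
    unfolding h_def[abs_def] by (rule DERIV_cmult_Id)
  have diff: "h differentiable (at t)" for t
    using der real_differentiable_def by blast
  have mono: "strict_mono h"
  proof (rule strict_monoI)
    fix x y :: real assume "x < y"
    then show "h x < h y" unfolding h_def by (rule mult_strict_left_mono) (use mn in simp)
  qed
  have h0: "h 0 = 0" "h m = n" using mn by (auto simp: h_def)
  have "cayley_dist G X (word_path G v t) (word_path G w (h t)) \<le> real ((k + 2 * d + 1) + 2)" if "0 < t" for t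
  proof (rule offset_imp_cayley_dist[OF assms(1,2)])
    let ?i = "nat \<lfloor>t\<rfloor>" and ?j = "nat \<lfloor>h t\<rfloor>"
    show t0: "0 \<le> t" "0 \<le> h t" using that mn by (auto simp: h_def)
    have 1: "offset G (word_eval G (take ?i v)) (word_eval G (take ?i w)) \<in> word_ball G X (k + d)"
      using staircase_sync_offset[OF assms(1-4)] .
    have 2: "offset G (word_eval G (take ?i w)) (word_eval G (take ?j w)) \<in> word_ball G X (d + 1)"
      if "t \<le> m"
    proof (rule offset_take_ball[OF assms(2)])
      have "h t - t = (n - m) * (t / m)" using mn by (simp add: h_def field_simps)
      moreover have "\<bar>(n - m) * (t / m)\<bar> \<le> real d * 1"
        unfolding abs_mult using len that t0 mn by (intro mult_mono) auto
      ultimately have "\<bar>h t - t\<bar> \<le> real d" by simp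
      then show "?i \<le> ?j + (d + 1)" "?j \<le> ?i + (d + 1)" using t0 by linarith+
    qed
    have 3: "offset G (word_eval G (take ?i v)) (word_eval G (take ?j w)) \<in> word_ball G X k" if "m < t"
    proof -
      have "n < h t" using strict_monoD[OF mono that] h0 by simp
      then have "length v \<le> ?i" "length w \<le> ?j" using that by (auto simp: m_def n_def le_nat_iff le_floor_iff)
      then show ?thesis using staircase_close[OF st] F by (auto simp: close_pair_def)
    qed
    show "offset G (base v t) (base w (h t)) \<in> word_ball G X (k + 2 * d + 1)"
    proof (cases "t \<le> m")
      case True
      have "offset G (base v t) (base w (h t)) \<in> word_ball G X ((k + d) + (d + 1))"
        unfolding base_def
        by (rule offset_ball_trans[OF _ _ _ 1 2[OF True]]) (rule eval_take_in assms)+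
      then show ?thesis by (rule word_ball_mono[rotated]) simp
    next
      case False
      then show ?thesis unfolding base_def by (intro word_ball_mono[OF _ 3]) simp_all
    qed
  qed
  moreover have "h ` {0..m} = {0..n}"
    by (rule image_interval_mono) (use mono diff h0 mn in auto)
  ultimately have "async_fellow_travel_via G X (real (k + 2 * d + 3)) v w h"
    unfolding async_fellow_travel_via_def using mono diff by (simp add: m_def n_def algebra_simps)
  moreover have "1 / real (d + 1) \<le> deriv h t \<and> deriv h t \<le> real (d + 1)" for t
  proof -
    have "real d \<le> real d * m" "real d \<le> real d * n" using mn by (simp_all add: mult_le_cancel_left1)
    then have "n \<le> real (d + 1) * m" "m \<le> real (d + 1) * n" using len by (simp_all add: algebra_simps)
    then have "n / m \<le> real (d + 1)" "m / n \<le> real (d + 1)" using mn by (simp_all add: pos_divide_le_eq)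
    moreover have "1 / real (d + 1) \<le> n / m"
      using calculation(2) mn by (simp add: field_simps)
    ultimately show ?thesis using DERIV_imp_deriv[OF der[of t]] by simp
  qed
  ultimately show ?thesis unfolding bounded_async_fellow_travel_def by blast
qed

text \<open>The reparametrisation interpolates the last positions of the rows of the staircase. Between two
consecutive integers \<open>i\<close> and \<open>i + 1\<close> it then takes values in row \<open>i + 1\<close>, up to an error of 1. For \<open>i = 0\<close>
it starts at 0 instead of at the end of row 0, so both rows 0 and 1 are involved.\<close>

lemma staircase_imp_async:
  assumes "v \<in> lists X" "w \<in> lists X" and st: "staircase G F D v w" and F: "F \<subseteq> word_ball G X k"
    and ne: "v \<noteq> []" "w \<noteq> []"
  shows "async_fellow_travel G X (real (k + 4)) v w"
proof -
  let ?m = "length v" and ?n = "length w"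
  obtain b where b: "mono b" "\<And>i. ?m \<le> i \<Longrightarrow> b i = ?n"
    "\<And>i j. \<lbrakk>i \<le> ?m; i = 0 \<or> b (i - 1) \<le> j; j \<le> b i\<rbrakk>
       \<Longrightarrow> offset G (word_eval G (take i v)) (word_eval G (take j w)) \<in> F"
    using staircase_rows[OF st] by blast
  define c where "c i = (if i = 0 then 0 else b i)" for i
  have c: "mono c" "c 0 = 0" "c ?m = ?n" "0 < ?m" "0 < ?n"
    using b(1,2) ne by (auto simp: c_def mono_def)
  obtain h where h: "strict_mono h" "\<And>t. h differentiable (at t)" "h 0 = 0" "h (real ?m) = real ?n"
    "\<And>i t. \<lbrakk>i < ?m; real i \<le> t; t \<le> real i + 1\<rbrakk> \<Longrightarrow> real (c i) - 1 \<le> h t \<and> h t \<le> real (c (Suc i)) + 1"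
    using smooth_interpolation[OF c] by blast
  have "cayley_dist G X (word_path G v t) (word_path G w (h t)) \<le> real ((k + 2) + 2)" if "0 < t" for t
  proof (rule offset_imp_cayley_dist[OF assms(1,2)])
    let ?i = "nat \<lfloor>t\<rfloor>" and ?j = "nat \<lfloor>h t\<rfloor>"
    show "0 \<le> t" using that by simp
    show h_pos: "0 \<le> h t" using strict_mono_less_eq[OF h(1), of 0 t] that h(3) by simp
    show "offset G (base v t) (base w (h t)) \<in> word_ball G X (k + 2)"
    proof (cases "t \<le> real ?m")
      case True
      define i where "i = min ?i (?m - 1)"
      have i: "i < ?m" "real i \<le> t" "t \<le> real i + 1"
        using True that \<open>0 < ?m\<close> unfolding i_def by linarith+
      have hi: "real (c i) - 1 \<le> h t" "h t \<le> real (c (Suc i)) + 1" using h(5)[OF i] by auto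
      define j where "j = max (c i) (min (c (Suc i)) ?j)"
      have cc: "c i \<le> c (Suc i)" using c(1) by (simp add: monoD)
      have jj: "?j \<le> j + 1" "j \<le> ?j + 1" using hi h_pos cc unfolding j_def by linarith+
      have j: "c i \<le> j" "j \<le> c (Suc i)" using cc by (auto simp: j_def)
      obtain r where r: "r = i \<or> r = Suc i" "offset G (word_eval G (take r v)) (word_eval G (take j w)) \<in> F"
      proof (cases "i = 0 \<and> j \<le> b 0")
        case True
        then show ?thesis using that[of 0] b(3)[of 0 j] by simp
      next
        case False
        then have "b i \<le> j" "j \<le> b (Suc i)" using j by (auto simp: c_def split: if_splits)
        then show ?thesis using that[of "Suc i"] b(3)[of "Suc i" j] i by simp
      qed
      have 1: "offset G (base v t) (word_eval G (take r v)) \<in> word_ball G X 1"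
        unfolding base_def by (rule offset_take_ball[OF assms(1)]) (use r i in linarith)+
      have 2: "offset G (word_eval G (take j w)) (base w (h t)) \<in> word_ball G X 1"
        unfolding base_def by (rule offset_take_ball[OF assms(2)]) (use jj in auto)
      have 3: "offset G (base v t) (word_eval G (take j w)) \<in> word_ball G X (1 + k)"
        by (rule offset_ball_trans[OF _ _ _ 1 subsetD[OF F r(2)]]) (rule eval_take_in base_in assms)+
      have "offset G (base v t) (base w (h t)) \<in> word_ball G X (1 + k + 1)"
        by (rule offset_ball_trans[OF _ _ _ 3 2]) (rule eval_take_in base_in assms)+
      then show ?thesis by (simp add: add.commute)
    next
      case False
      then have "real ?n < h t" using strict_monoD[OF h(1), of "real ?m" t] h(4) False by simp
      then have "?m \<le> ?i" "?n \<le> ?j" using False by (auto simp: le_nat_iff le_floor_iff)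
      then have "offset G (base v t) (base w (h t)) \<in> word_ball G X k"
        using staircase_close[OF st] F by (auto simp: close_pair_def base_def)
      then show ?thesis by (rule word_ball_mono[rotated]) simp
    qed
  qed
  moreover have "h ` {0..real ?m} = {0..real ?n}"
    by (rule image_interval_mono) (use h in auto)
  ultimately have "async_fellow_travel_via G X (real (k + 4)) v w h"
    unfolding async_fellow_travel_via_def using h by (simp add: algebra_simps)
  then show ?thesis unfolding async_fellow_travel_def by blast
qed

end

section \<open>Tracking a fellow traveller with a finite automaton\<close>

context marked_group
begin

text \<open>An automaton reading \<open>v\<close> guesses a staircase to a word \<open>w\<close> of \<open>R\<close>. All it has to remember of \<open>w\<close> is the
left quotient of \<open>R\<close> and the offset, that is, an element of the finite set that contains \<open>T v\<close>. The
condition that the final offset is \<open>x\<close> makes the guess sound even if \<open>v\<close> is not in \<open>L\<close>; for \<open>v\<close> in \<open>L\<close>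
the combing property guarantees that the guess can succeed.\<close>

lemma finite_quots_right_mult_letter:
  assumes F: "finite F" "F \<subseteq> carrier G" and x: "x \<in> carrier G"
    and L: "L \<subseteq> lists X" "finite_quots L" and R: "R \<subseteq> L" "finite_quots R"
    and track: "\<And>v w. \<lbrakk>v \<in> L; w \<in> L; word_eval G w = word_eval G v \<otimes> x\<rbrakk> \<Longrightarrow> staircase G F \<infinity> v w"
  shows "finite_quots {v \<in> L. \<exists>w\<in>R. word_eval G w = word_eval G v \<otimes> x}"
proof -
  define N where "N = {v \<in> lists X. \<exists>w\<in>R. staircase G F \<infinity> v w \<and> word_eval G w = word_eval G v \<otimes> x}"
  define T where "T v = {(quot w R, offset G (word_eval G v) (word_eval G w)) | w.
      w \<in> lists X \<and> staircase G F \<infinity> v w}" for v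
  have T_step: "T (v @ [y]) \<subseteq> T (v' @ [y])"
    if vv: "v \<in> lists X" "v' \<in> lists X" and y: "y \<in> X" and sub: "T v \<subseteq> T v'" for v v' y
  proof -
    have yG: "y \<in> carrier G" "[y] \<in> lists X" using y X_sub by auto
    have off: "offset G (word_eval G (u @ [y])) (word_eval G w) = inv y \<otimes> offset G (word_eval G u) (word_eval G w)"
      if "u \<in> lists X" "w \<in> lists X" for u w
      using that yG by (simp add: eval_app offset_mult_left)
    have "\<exists>w'\<in>lists X. staircase G F \<infinity> (v' @ [y]) w' \<and> quot w' R = quot w R \<and>
        offset G (word_eval G (v' @ [y])) (word_eval G w') = offset G (word_eval G (v @ [y])) (word_eval G w)"
      if "staircase G F \<infinity> u w" "u = v @ [y]" "w \<in> lists X" for u w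
      using that
    proof (induction rule: staircase.induct)
      case start
      then show ?case by simp
    next
      case (left v0 w z)
      then have [simp]: "v0 = v" "z = y" by auto
      have "(quot w R, offset G (word_eval G v) (word_eval G w)) \<in> T v"
        unfolding T_def using left.hyps(1) left.prems(2) by auto
      then have "(quot w R, offset G (word_eval G v) (word_eval G w)) \<in> T v'"
        using sub by blast
      then obtain w' where w': "w' \<in> lists X" "staircase G F \<infinity> v' w'" "quot w R = quot w' R"
        "offset G (word_eval G v) (word_eval G w) = offset G (word_eval G v') (word_eval G w')"
        unfolding T_def by blast
      have eq: "offset G (word_eval G (v' @ [y])) (word_eval G w') = offset G (word_eval G (v @ [y])) (word_eval G w)"
        using off[OF vv(1) left.prems(2)] off[OF vv(2) w'(1)] w'(4) by simp
      then have "staircase G F \<infinity> (v' @ [y]) w'"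
        using left.hyps by (intro staircase.left[OF w'(2)]) (simp add: close_pair_infinity)
      then show ?case using w' eq by auto
    next
      case (right u w z)
      then have z: "z \<in> X" "z \<in> carrier G" "[z] \<in> lists X" "w \<in> lists X" using X_sub by auto
      obtain w' where w': "w' \<in> lists X" "staircase G F \<infinity> (v' @ [y]) w'" "quot w' R = quot w R"
        "offset G (word_eval G (v' @ [y])) (word_eval G w') = offset G (word_eval G (v @ [y])) (word_eval G w)"
        using right.IH right.prems(1) z(4) by blast
      have offz: "offset G (word_eval G u) (word_eval G (a @ [z])) = offset G (word_eval G u) (word_eval G a) \<otimes> z"
        if "u \<in> lists X" "a \<in> lists X" for u a
        using that z by (simp add: eval_app offset_mult_right)
      have vy: "v @ [y] \<in> lists X" "v' @ [y] \<in> lists X" using vv yG by auto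
      have eq: "offset G (word_eval G (v' @ [y])) (word_eval G (w' @ [z])) =
          offset G (word_eval G (v @ [y])) (word_eval G (w @ [z]))"
        using offz[OF vy(1) z(4)] offz[OF vy(2) w'(1)] w'(4) by simp
      then have "staircase G F \<infinity> (v' @ [y]) (w' @ [z])"
        using right.hyps right.prems(1)
        by (intro staircase.right[OF w'(2)]) (simp add: close_pair_infinity)
      moreover have "quot (w' @ [z]) R = quot (w @ [z]) R"
        using w'(3) by (simp add: quot_append)
      moreover have "w' @ [z] \<in> lists X" using w' z by simp
      ultimately show ?case using eq by blast
    qed
    then have step: "\<exists>w'\<in>lists X. staircase G F \<infinity> (v' @ [y]) w' \<and> quot w' R = quot w R \<and>
        offset G (word_eval G (v' @ [y])) (word_eval G w') = offset G (word_eval G (v @ [y])) (word_eval G w)"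
      if "staircase G F \<infinity> (v @ [y]) w" "w \<in> lists X" for w
      using that by blast
    show ?thesis
    proof
      fix p assume "p \<in> T (v @ [y])"
      then obtain w where w: "w \<in> lists X" "staircase G F \<infinity> (v @ [y]) w"
        "p = (quot w R, offset G (word_eval G (v @ [y])) (word_eval G w))"
        unfolding T_def by blast
      obtain w' where "w' \<in> lists X" "staircase G F \<infinity> (v' @ [y]) w'" "quot w' R = quot w R"
        "offset G (word_eval G (v' @ [y])) (word_eval G w') = offset G (word_eval G (v @ [y])) (word_eval G w)"
        using step[OF w(2,1)] by blast
      then show "p \<in> T (v' @ [y])" unfolding T_def w(3) by (intro CollectI exI[of _ w']) simp
    qed
  qed
  have T_steps: "T (v @ z) \<subseteq> T (v' @ z)"
    if "v \<in> lists X" "v' \<in> lists X" "z \<in> lists X" "T v \<subseteq> T v'" for v v' z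
    using that(3)
  proof (induction z rule: rev_induct)
    case Nil
    then show ?case using that by simp
  next
    case (snoc y z)
    then have "T ((v @ z) @ [y]) \<subseteq> T ((v' @ z) @ [y])"
      using that by (intro T_step) auto
    then show ?case by simp
  qed
  have N_iff: "v \<in> N \<longleftrightarrow> (\<exists>q. [] \<in> q \<and> (q, x) \<in> T v)" if "v \<in> lists X" for v
  proof -
    have "word_eval G w = word_eval G v \<otimes> x \<longleftrightarrow> offset G (word_eval G v) (word_eval G w) = x"
      if "w \<in> lists X" for w
      using \<open>v \<in> lists X\<close> that x by (simp add: offset_eq_iff)
    moreover have "w \<in> lists X" if "w \<in> R" for w using that R(1) L(1) by blast
    ultimately have "v \<in> N \<longleftrightarrow> (\<exists>w. w \<in> R \<and> w \<in> lists X \<and> staircase G F \<infinity> v w \<and>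
        offset G (word_eval G v) (word_eval G w) = x)"
      using \<open>v \<in> lists X\<close> unfolding N_def by blast
    also have "\<dots> \<longleftrightarrow> (\<exists>q. [] \<in> q \<and> (q, x) \<in> T v)"
    proof -
      have "w \<in> R \<longleftrightarrow> [] \<in> quot w R" for w by simp
      then show ?thesis unfolding T_def by blast
    qed
    finally show ?thesis .
  qed
  have "finite_quots N"
  proof (rule finite_quotsI[where \<kappa> = "\<lambda>v. (v \<in> lists X, T v)"])
    have "T v \<subseteq> range (\<lambda>w. quot w R) \<times> F" for v
      unfolding T_def by (auto dest!: staircase_close simp: close_pair_infinity)
    then have "range (\<lambda>v. (v \<in> lists X, T v)) \<subseteq> UNIV \<times> Pow (range (\<lambda>w. quot w R) \<times> F)" by blast
    then show "finite (range (\<lambda>v. (v \<in> lists X, T v)))"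
      by (rule finite_subset) (use R(2) F(1) in \<open>simp add: finite_quots_def\<close>)
  next
    fix v v' z assume eq: "(v \<in> lists X, T v) = (v' \<in> lists X, T v')" and "v @ z \<in> N"
    then have "v @ z \<in> lists X" by (simp add: N_def)
    then have lists: "v \<in> lists X" "z \<in> lists X" "v' \<in> lists X" using eq by auto
    then have "T (v @ z) \<subseteq> T (v' @ z)" using T_steps eq by simp
    then show "v' @ z \<in> N"
      using \<open>v @ z \<in> N\<close> N_iff[of "v @ z"] N_iff[of "v' @ z"] lists by auto
  qed
  moreover have "{v \<in> L. \<exists>w\<in>R. word_eval G w = word_eval G v \<otimes> x} = L \<inter> N"
    using track R(1) L(1) by (auto simp: N_def)
  ultimately show ?thesis using finite_quots_Int[OF L(2)] by simp
qed

text \<open>A general element is a product of generators, and the elements in between are again represented in \<open>L\<close>.\<close>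

lemma finite_quots_right_mult:
  assumes F: "finite F" "F \<subseteq> carrier G" and combing: "combing_wrt G X (staircase G F \<infinity>) L"
    and L: "finite_quots L" and R: "R \<subseteq> L" "finite_quots R" and g: "g \<in> carrier G"
  shows "finite_quots {v \<in> L. \<exists>w\<in>R. word_eval G w = word_eval G v \<otimes> g}"
proof -
  have lang: "L \<subseteq> lists X" "\<And>h. h \<in> carrier G \<Longrightarrow> \<exists>w\<in>L. word_eval G w = h"
    using combing by (auto simp: combing_wrt_def language_for_def)
  have letter: "finite_quots {v \<in> L. \<exists>w\<in>S. word_eval G w = word_eval G v \<otimes> x}"
    if "x \<in> X \<union> {\<one>}" "S \<subseteq> L" "finite_quots S" for x S
  proof (rule finite_quots_right_mult_letter[OF F _ lang(1) L that(2,3)])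
    show "x \<in> carrier G" using that X_sub by auto
    show "staircase G F \<infinity> v w" if "v \<in> L" "w \<in> L" "word_eval G w = word_eval G v \<otimes> x" for v w
      using combing that \<open>x \<in> X \<union> {\<one>}\<close> unfolding combing_wrt_def by blast
  qed
  have "finite_quots {v \<in> L. \<exists>w\<in>R. word_eval G w = word_eval G v \<otimes> word_eval G u}" if "u \<in> lists X" for u
    using that
  proof (induction u rule: list.induct)
    case Nil
    then show ?case using letter[of \<one> R] R by simp
  next
    case (Cons x u)
    let ?S = "{v \<in> L. \<exists>w\<in>R. word_eval G w = word_eval G v \<otimes> word_eval G u}"
    have x: "x \<in> X" "x \<in> carrier G" and u: "u \<in> lists X" using Cons.prems X_sub by auto
    have "{v \<in> L. \<exists>w\<in>R. word_eval G w = word_eval G v \<otimes> word_eval G (x # u)}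
        = {v \<in> L. \<exists>w\<in>?S. word_eval G w = word_eval G v \<otimes> x}"
    proof -
      have "(\<exists>w\<in>R. word_eval G w = word_eval G v \<otimes> (x \<otimes> word_eval G u)) \<longleftrightarrow>
         (\<exists>w\<in>?S. word_eval G w = word_eval G v \<otimes> x)" if "v \<in> L" for v
      proof -
        have v: "word_eval G v \<in> carrier G" using that lang(1) by blast
        have ux: "word_eval G u \<in> carrier G" using u by blast
        obtain w1 where w1: "w1 \<in> L" "word_eval G w1 = word_eval G v \<otimes> x"
          using lang(2)[of "word_eval G v \<otimes> x"] v x by auto
        have assoc: "word_eval G v \<otimes> (x \<otimes> word_eval G u) = (word_eval G v \<otimes> x) \<otimes> word_eval G u"
          using v ux x by (simp add: m_assoc)
        show ?thesis
        proof
          assume "\<exists>w\<in>R. word_eval G w = word_eval G v \<otimes> (x \<otimes> word_eval G u)"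
          then have "w1 \<in> ?S" unfolding assoc w1(2)[symmetric] using w1(1) by simp
          with w1(2) show "\<exists>w\<in>?S. word_eval G w = word_eval G v \<otimes> x" by (rule bexI)
        qed (auto simp: assoc)
      qed
      then show ?thesis unfolding word_eval_Cons by blast
    qed
    moreover have "finite_quots {v \<in> L. \<exists>w\<in>?S. word_eval G w = word_eval G v \<otimes> x}"
      by (rule letter) (use x Cons.IH u in auto)
    ultimately show ?case by simp
  qed
  then show ?thesis using words_exist[OF g] by blast
qed

text \<open>A prefix \<open>v\<close> is completed to a word \<open>v @ u\<close> of \<open>L\<close> by one of finitely many words \<open>u\<close>, one for each
non-empty left quotient of \<open>L\<close>. The element represented by \<open>v\<close> is that of \<open>v @ u\<close> times the inverse of
the element represented by \<open>u\<close>, so the previous lemma applies.\<close>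

lemma finite_quots_prefixes:
  assumes F: "finite F" "F \<subseteq> carrier G" and combing: "combing_wrt G X (staircase G F \<infinity>) L"
    and L: "finite_quots L" and R: "finite_quots {v \<in> L. P (word_eval G v)}"
  shows "finite_quots {v \<in> prefixes_of L. P (word_eval G v)}"
proof -
  have lang: "L \<subseteq> lists X" "\<And>h. h \<in> carrier G \<Longrightarrow> \<exists>w\<in>L. word_eval G w = h"
    using combing by (auto simp: combing_wrt_def language_for_def)
  define U where "U = (\<lambda>q. SOME u. u \<in> q) ` (range (\<lambda>v. quot v L))"
  have finU: "finite U" unfolding U_def using L by (simp add: finite_quots_def)
  have U: "\<exists>u\<in>U. v @ u \<in> L" if "v \<in> prefixes_of L" for v
  proof -
    have "\<exists>u. u \<in> quot v L" using that by (simp add: prefixes_of_def)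
    then have "(SOME u. u \<in> quot v L) \<in> quot v L" by (rule someI_ex)
    then have "v @ (SOME u. u \<in> quot v L) \<in> L" unfolding in_quot_iff .
    moreover have "(SOME u. u \<in> quot v L) \<in> U" unfolding U_def by (intro imageI rangeI)
    ultimately show ?thesis by (rule bexI)
  qed
  let ?R = "{v \<in> L. P (word_eval G v)}"
  let ?Q = "\<lambda>u. {v \<in> L. \<exists>w\<in>?R. word_eval G w = word_eval G v \<otimes> inv (word_eval G u)}"
  have eq: "{v \<in> prefixes_of L. P (word_eval G v)} = (\<Union>u\<in>U \<inter> lists X. {v. v @ u \<in> ?Q u})"
  proof -
    have key: "v @ u \<in> ?Q u \<longleftrightarrow> P (word_eval G v)" if "v @ u \<in> L" for v u
    proof -
      have "v @ u \<in> lists X" using that lang(1) by blast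
      then have vu: "v \<in> lists X" "u \<in> lists X" by auto
      then have "word_eval G (v @ u) \<otimes> inv (word_eval G u) = word_eval G v"
        by (simp add: eval_app m_assoc)
      moreover obtain w where "w \<in> L" "word_eval G w = word_eval G v"
        using lang(2)[OF eval_in[OF vu(1)]] by blast
      ultimately show ?thesis using that by auto
    qed
    have "v \<in> prefixes_of L \<and> P (word_eval G v) \<longleftrightarrow> (\<exists>u\<in>U \<inter> lists X. v @ u \<in> ?Q u)" for v
    proof
      assume v: "v \<in> prefixes_of L \<and> P (word_eval G v)"
      then obtain u where u: "u \<in> U" "v @ u \<in> L" using U by blast
      then have "u \<in> lists X" using lang(1) by auto
      then show "\<exists>u\<in>U \<inter> lists X. v @ u \<in> ?Q u" using u key[OF u(2)] v by blast
    next
      assume "\<exists>u\<in>U \<inter> lists X. v @ u \<in> ?Q u"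
      then obtain u where u: "v @ u \<in> ?Q u" by blast
      then have "v @ u \<in> L" by simp
      then show "v \<in> prefixes_of L \<and> P (word_eval G v)" using u key by (auto simp: prefixes_of_def)
    qed
    then show ?thesis by blast
  qed
  have "finite_quots (?Q u)" if "u \<in> lists X" for u
    by (rule finite_quots_right_mult[OF F combing L _ R]) (use that in auto)
  then show ?thesis
    unfolding eq using finU by (intro finite_quots_UN finite_quots_right_quotient) auto
qed

end

section \<open>Near geodesic languages\<close>

context marked_group
begin

text \<open>A short cut to a prefix would shorten the whole word, so prefixes are near geodesic as well.\<close>

lemma near_geodesic_prefix:
  assumes "near_geodesic G X L" "L \<subseteq> lists X"
  obtains E :: nat where "\<And>w i k. \<lbrakk>w \<in> L; i \<le> length w; word_eval G (take i w) \<in> word_ball G X k\<rbrakk> \<Longrightarrow> i \<le> k + E"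
proof -
  obtain \<epsilon> where \<epsilon>: "\<And>w. w \<in> L \<Longrightarrow> real (length w) - real (geodesic_length G X w) < \<epsilon>"
    using assms(1) unfolding near_geodesic_def by blast
  have "i \<le> k + nat \<lceil>\<epsilon>\<rceil>" if w: "w \<in> L" "i \<le> length w" "word_eval G (take i w) \<in> word_ball G X k" for w i k
  proof -
    have wX: "w \<in> lists X" using w(1) assms(2) by blast
    obtain u where u: "u \<in> lists X" "length u \<le> k" "word_eval G (take i w) = word_eval G u"
      using w(3) by (auto simp: word_ball_def)
    have "word_eval G (u @ drop i w) = word_eval G (take i w @ drop i w)"
      using u wX take_lists[OF wX] drop_lists[OF wX] by (simp add: eval_app del: append_take_drop_id)
    then have "\<exists>v\<in>lists X. word_eval G v = word_eval G w \<and> length v = length (u @ drop i w)"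
      using u(1) drop_lists[OF wX, of i] by (intro bexI[of _ "u @ drop i w"]) auto
    then have "geodesic_length G X w \<le> length (u @ drop i w)"
      unfolding geodesic_length_def by (rule Least_le)
    then have "geodesic_length G X w + i \<le> k + length w" using u(2) w(2) by simp
    then show ?thesis using \<epsilon>[OF w(1)] by linarith
  qed
  then show ?thesis using that by blast
qed

text \<open>The length of a near geodesic prefix is, up to a constant, the distance of its end point from the
identity, and the distances of two nearby points nearly agree.\<close>

lemma staircase_band:
  assumes st: "staircase G F \<infinity> v w" and F: "F \<subseteq> word_ball G X k" and vw: "v \<in> lists X" "w \<in> lists X"
    and v: "\<And>i n. \<lbrakk>i \<le> length v; word_eval G (take i v) \<in> word_ball G X n\<rbrakk> \<Longrightarrow> i \<le> n + E"
    and w: "\<And>i n. \<lbrakk>i \<le> length w; word_eval G (take i w) \<in> word_ball G X n\<rbrakk> \<Longrightarrow> i \<le> n + E"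
  shows "staircase G F (enat (k + E)) v w"
proof (rule staircase_map[OF st])
  fix i j assume ij: "i \<le> length v" "j \<le> length w" "close_pair G F \<infinity> (take i v) (take j w)"
  let ?g = "word_eval G (take i v)" and ?h = "word_eval G (take j w)"
  have gh: "?g \<in> carrier G" "?h \<in> carrier G" using vw by auto
  have "?g \<in> word_ball G X i" "?h \<in> word_ball G X j"
    using take_lists vw by (auto intro!: word_ball_eval)
  moreover have off: "offset G ?g ?h \<in> word_ball G X k" using ij F by (auto simp: close_pair_infinity)
  ultimately have "?g \<otimes> offset G ?g ?h \<in> word_ball G X (i + k)"
    "?h \<otimes> offset G ?h ?g \<in> word_ball G X (j + k)"
    using gh by (auto intro!: word_ball_mult offset_ball_sym[OF _ _ off])
  then have "?h \<in> word_ball G X (i + k)" "?g \<in> word_ball G X (j + k)"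
    using gh by (simp_all add: mult_offset)
  then have "i \<le> j + k + E" "j \<le> i + k + E" using v w ij by blast+
  then show "close_pair G F (enat (k + E)) (take i v) (take j w)"
    using ij by (simp add: close_pair_def)
qed auto

lemma near_geodesic_combing_band:
  assumes ng: "near_geodesic G X L" and F: "finite F" "F \<subseteq> carrier G" and lang: "L \<subseteq> lists X"
  obtains d where "\<And>v w. \<lbrakk>v \<in> L; w \<in> L; staircase G F \<infinity> v w\<rbrakk> \<Longrightarrow> staircase G F (enat d) v w"
    "\<And>x v w. \<lbrakk>x \<in> X; v \<in> L; w \<in> L; staircase G F \<infinity> (x # v) w\<rbrakk> \<Longrightarrow> staircase G F (enat d) (x # v) w"
proof -
  obtain k where k: "F \<subseteq> word_ball G X k" using finite_subset_word_ball[OF F] .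
  obtain E where E: "\<And>w i k. \<lbrakk>w \<in> L; i \<le> length w; word_eval G (take i w) \<in> word_ball G X k\<rbrakk> \<Longrightarrow> i \<le> k + E"
    using near_geodesic_prefix[OF ng lang] by blast
  have 1: "staircase G F (enat (k + (E + 2))) v w" if "v \<in> L" "w \<in> L" "staircase G F \<infinity> v w" for v w
  proof (rule staircase_band[OF that(3) k])
    show "v \<in> lists X" "w \<in> lists X" using that lang by auto
    show "i \<le> n + (E + 2)" if "i \<le> length v" "word_eval G (take i v) \<in> word_ball G X n" for i n
      using E[OF \<open>v \<in> L\<close> that] by simp
    show "i \<le> n + (E + 2)" if "i \<le> length w" "word_eval G (take i w) \<in> word_ball G X n" for i n
      using E[OF \<open>w \<in> L\<close> that] by simp
  qed
  \<comment> \<open>The extra 2 in \<open>E + 2\<close>: a letter in front adds 1 to the length and can decrease the distance by 1.\<close>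
  have 2: "staircase G F (enat (k + (E + 2))) (x # v) w"
    if x: "x \<in> X" and vw: "v \<in> L" "w \<in> L" "staircase G F \<infinity> (x # v) w" for x v w
  proof (rule staircase_band[OF vw(3) k])
    have vX: "v \<in> lists X" using vw lang by auto
    show "x # v \<in> lists X" "w \<in> lists X" using vX x vw lang by auto
    show "i \<le> n + (E + 2)" if i: "i \<le> length (x # v)" "word_eval G (take i (x # v)) \<in> word_ball G X n" for i n
    proof (cases i)
      case (Suc j)
      have xG: "x \<in> carrier G" "inv x \<in> word_ball G X 1"
        using x X_sub word_ball_inv[OF word_ball_letter[OF x]] by auto
      have "inv x \<otimes> (x \<otimes> word_eval G (take j v)) \<in> word_ball G X (1 + n)"
        using word_ball_mult[OF xG(2)] i Suc by simp
      then have "word_eval G (take j v) \<in> word_ball G X (1 + n)"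
        using xG eval_take_in[OF vX, of j] by (simp add: m_assoc[symmetric])
      then show ?thesis using E[OF vw(1), of j "1 + n"] i Suc by simp
    qed simp
    show "i \<le> n + (E + 2)" if "i \<le> length w" "word_eval G (take i w) \<in> word_ball G X n" for i n
      using E[OF \<open>w \<in> L\<close> that] by simp
  qed
  show ?thesis by (rule that[OF 1 2])
qed

end

section \<open>Combings and staircases\<close>

lemma combing_wrt_mono:
  assumes "combing_wrt G X ft L" "\<And>v w. \<lbrakk>v \<in> L; w \<in> L; ft v w\<rbrakk> \<Longrightarrow> ft' v w"
  shows "combing_wrt G X ft' L"
  using assms unfolding combing_wrt_def by blast

lemma bicombing_wrt_mono:
  assumes "bicombing_wrt G X ft L" "\<And>v w. \<lbrakk>v \<in> L; w \<in> L; ft v w\<rbrakk> \<Longrightarrow> ft' v w"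
    and "\<And>x v w. \<lbrakk>x \<in> X; v \<in> L; w \<in> L; ft (x # v) w\<rbrakk> \<Longrightarrow> ft' (x # v) w"
  shows "bicombing_wrt G X ft' L"
  using assms unfolding bicombing_wrt_def combing_wrt_def by blast

lemma combing_wrt_language: "combing_wrt G X ft L \<Longrightarrow> language_for G X L"
  by (simp add: combing_wrt_def)

lemma language_lists: "language_for G X L \<Longrightarrow> L \<subseteq> lists X"
  by (simp add: language_for_def)

lemma bounded_imp_async: "bounded_async_fellow_travel G X K M v w \<Longrightarrow> async_fellow_travel G X K v w"
  unfolding bounded_async_fellow_travel_def async_fellow_travel_def by blast

context marked_group
begin

lemma fellow_travel_imp_staircase:
  assumes "sync_fellow_travel G X K v w \<or> async_fellow_travel G X K v w" "v \<in> lists X" "w \<in> lists X"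
  shows "staircase G (word_ball G X (nat \<lceil>K\<rceil> + 3)) \<infinity> v w"
  using assms sync_imp_staircase async_imp_staircase by blast

lemma combing_imp_staircase:
  assumes "combing G X L"
  obtains F where "finite F" "F \<subseteq> carrier G" "combing_wrt G X (staircase G F \<infinity>) L"
proof -
  let ?ft = "\<lambda>K v w. sync_fellow_travel G X K v w \<or> async_fellow_travel G X K v w"
  obtain K where "combing_wrt G X (sync_fellow_travel G X K) L \<or> combing_wrt G X (async_fellow_travel G X K) L \<or>
      (\<exists>M. combing_wrt G X (bounded_async_fellow_travel G X K M) L)"
    using assms unfolding combing_def bicombing_def sync_combing_def async_combing_def bounded_async_combing_def
      sync_bicombing_def async_bicombing_def bounded_async_bicombing_def bicombing_wrt_def by blast
  then have ft: "combing_wrt G X (?ft K) L"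
    by (elim disjE exE; elim combing_wrt_mono; blast dest: bounded_imp_async)
  have L: "L \<subseteq> lists X" using language_lists[OF combing_wrt_language[OF ft]] .
  have "combing_wrt G X (staircase G (word_ball G X (nat \<lceil>K\<rceil> + 3)) \<infinity>) L"
    by (rule combing_wrt_mono[OF ft]) (use L fellow_travel_imp_staircase in blast)
  then show ?thesis by (rule that[rotated -1]) (auto simp: finite_word_ball dest: word_ball_carrier)
qed

lemma bicombing_imp_staircase:
  assumes "bicombing G X L"
  obtains F where "finite F" "F \<subseteq> carrier G" "bicombing_wrt G X (staircase G F \<infinity>) L"
proof -
  let ?ft = "\<lambda>K v w. sync_fellow_travel G X K v w \<or> async_fellow_travel G X K v w"
  obtain K where "bicombing_wrt G X (sync_fellow_travel G X K) L \<or> bicombing_wrt G X (async_fellow_travel G X K) L \<or>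
      (\<exists>M. bicombing_wrt G X (bounded_async_fellow_travel G X K M) L)"
    using assms unfolding bicombing_def sync_bicombing_def async_bicombing_def bounded_async_bicombing_def by blast
  then have ft: "bicombing_wrt G X (?ft K) L"
    by (elim disjE exE; elim bicombing_wrt_mono; blast dest: bounded_imp_async)
  have L: "L \<subseteq> lists X" using ft by (simp add: bicombing_wrt_def combing_wrt_def language_for_def)
  have "bicombing_wrt G X (staircase G (word_ball G X (nat \<lceil>K\<rceil> + 3)) \<infinity>) L"
  proof (rule bicombing_wrt_mono[OF ft])
    fix v w assume "v \<in> L" "w \<in> L" "?ft K v w"
    then show "staircase G (word_ball G X (nat \<lceil>K\<rceil> + 3)) \<infinity> v w"
      using L fellow_travel_imp_staircase by blast
  next
    fix x v w assume x: "x \<in> X" and "v \<in> L" "w \<in> L" and ft': "?ft K (x # v) w"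
    then have "x # v \<in> lists X" "w \<in> lists X" using L by auto
    then show "staircase G (word_ball G X (nat \<lceil>K\<rceil> + 3)) \<infinity> (x # v) w"
      using fellow_travel_imp_staircase[OF ft'] by blast
  qed
  then show ?thesis by (rule that[rotated -1]) (auto simp: finite_word_ball dest: word_ball_carrier)
qed

text \<open>This is the step that makes the type of the combing irrelevant for near geodesic languages.\<close>

lemma near_geodesic_staircase:
  assumes ng: "near_geodesic G X L" and F: "finite F" "F \<subseteq> carrier G"
    and comb: "combing_wrt G X (staircase G F \<infinity>) L"
  obtains d where "combing_wrt G X (staircase G F (enat d)) L"
    "bicombing_wrt G X (staircase G F \<infinity>) L \<Longrightarrow> bicombing_wrt G X (staircase G F (enat d)) L"
proof -
  obtain d where d: "\<And>v w. \<lbrakk>v \<in> L; w \<in> L; staircase G F \<infinity> v w\<rbrakk> \<Longrightarrow> staircase G F (enat d) v w"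
    "\<And>x v w. \<lbrakk>x \<in> X; v \<in> L; w \<in> L; staircase G F \<infinity> (x # v) w\<rbrakk> \<Longrightarrow> staircase G F (enat d) (x # v) w"
    by (rule near_geodesic_combing_band[OF ng F language_lists[OF combing_wrt_language[OF comb]]]) blast
  show ?thesis
  proof (rule that)
    show "combing_wrt G X (staircase G F (enat d)) L"
      by (rule combing_wrt_mono[OF comb]) (rule d(1))
    show "bicombing_wrt G X (staircase G F (enat d)) L" if "bicombing_wrt G X (staircase G F \<infinity>) L"
      using that by (rule bicombing_wrt_mono) (rule d(1), assumption+, rule d(2), assumption+)
  qed
qed

lemma staircase_combing_async:
  assumes F: "finite F" "F \<subseteq> carrier G" and ne: "[] \<notin> L"
  shows "combing_wrt G X (staircase G F D) L \<Longrightarrow> async_combing G X L"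
    and "bicombing_wrt G X (staircase G F D) L \<Longrightarrow> async_bicombing G X L"
proof -
  obtain k where k: "F \<subseteq> word_ball G X k" using finite_subset_word_ball[OF F] .
  have st: "async_fellow_travel G X (real (k + 4)) v w"
    if "staircase G F D v w" "v \<in> lists X" "w \<in> lists X" "v \<noteq> []" "w \<noteq> []" for v w
    using staircase_imp_async[OF that(2,3,1) k that(4,5)] .
  show "async_combing G X L" if c: "combing_wrt G X (staircase G F D) L"
  proof -
    have L: "L \<subseteq> lists X" using language_lists[OF combing_wrt_language[OF c]] .
    show ?thesis unfolding async_combing_def
      by (rule exI[of _ "real (k + 4)"], rule combing_wrt_mono[OF c], rule st) (use L ne in auto)
  qed
  show "async_bicombing G X L" if c: "bicombing_wrt G X (staircase G F D) L"
  proof -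
    have L: "L \<subseteq> lists X" using c by (simp add: bicombing_wrt_def combing_wrt_def language_for_def)
    show ?thesis unfolding async_bicombing_def
      by (rule exI[of _ "real (k + 4)"], rule bicombing_wrt_mono[OF c]; rule st) (use L ne in auto)
  qed
qed

lemma staircase_combing_sync:
  assumes F: "finite F" "F \<subseteq> carrier G" and ne: "[] \<notin> L"
  shows "combing_wrt G X (staircase G F (enat d)) L \<Longrightarrow> sync_combing G X L \<and> bounded_async_combing G X L"
    and "bicombing_wrt G X (staircase G F (enat d)) L \<Longrightarrow> sync_bicombing G X L \<and> bounded_async_bicombing G X L"
proof -
  obtain k where k: "F \<subseteq> word_ball G X k" using finite_subset_word_ball[OF F] .
  have st: "sync_fellow_travel G X (real (k + d + 2)) v w"
    "bounded_async_fellow_travel G X (real (k + 2 * d + 3)) (real (d + 1)) v w"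
    if "staircase G F (enat d) v w" "v \<in> lists X" "w \<in> lists X" "v \<noteq> []" "w \<noteq> []" for v w
    using staircase_imp_sync[OF that(2,3,1) k] staircase_imp_bounded_async[OF that(2,3,1) k that(4,5)] .
  show "sync_combing G X L \<and> bounded_async_combing G X L" if c: "combing_wrt G X (staircase G F (enat d)) L"
  proof -
    have L: "L \<subseteq> lists X" using language_lists[OF combing_wrt_language[OF c]] .
    have "combing_wrt G X (sync_fellow_travel G X (real (k + d + 2))) L"
      "combing_wrt G X (bounded_async_fellow_travel G X (real (k + 2 * d + 3)) (real (d + 1))) L"
      by (rule combing_wrt_mono[OF c], rule st; use L ne in auto)+
    then show ?thesis unfolding sync_combing_def bounded_async_combing_def by blast
  qed
  show "sync_bicombing G X L \<and> bounded_async_bicombing G X L" if c: "bicombing_wrt G X (staircase G F (enat d)) L"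
  proof -
    have L: "L \<subseteq> lists X" using c by (simp add: bicombing_wrt_def combing_wrt_def language_for_def)
    have "bicombing_wrt G X (sync_fellow_travel G X (real (k + d + 2))) L"
      "bicombing_wrt G X (bounded_async_fellow_travel G X (real (k + 2 * d + 3)) (real (d + 1))) L"
      by (rule bicombing_wrt_mono[OF c]; rule st; use L ne in auto)+
    then show ?thesis unfolding sync_bicombing_def bounded_async_bicombing_def by blast
  qed
qed

end

section \<open>Normal forms in finitely generated abelian groups\<close>

definition sync_offsets :: "('g, 'm) monoid_scheme \<Rightarrow> 'g set \<Rightarrow> 'g list \<Rightarrow> 'g list \<Rightarrow> bool" where
  "sync_offsets G F v w \<longleftrightarrow> (\<forall>i. offset G (word_eval G (take i v)) (word_eval G (take i w)) \<in> F)"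

definition power_word :: "('g, 'm) monoid_scheme \<Rightarrow> 'g \<Rightarrow> int \<Rightarrow> 'g list" where
  "power_word G a n = replicate (nat \<bar>n\<bar>) (if 0 \<le> n then a else inv\<^bsub>G\<^esub> a)"

text \<open>Multiplication by \<open>d\<close> moves words of \<open>B\<close> only a bounded amount. With \<open>d\<close> the identity this covers distinct
words for the same element.\<close>

definition bounded_translates :: "('g, 'm) monoid_scheme \<Rightarrow> 'g list set \<Rightarrow> 'g \<Rightarrow> bool" where
  "bounded_translates G B d \<longleftrightarrow> (\<exists>F c. finite F \<and> F \<subseteq> carrier G \<and>
     (\<forall>b\<in>B. \<forall>b'\<in>B. word_eval G b' = word_eval G b \<otimes>\<^bsub>G\<^esub> d \<longrightarrow>
        sync_offsets G F b b' \<and> length b \<le> length b' + c \<and> length b' \<le> length b + c))"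

lemma bounded_translates_uniform:
  assumes "finite D" "\<And>d. d \<in> D \<Longrightarrow> bounded_translates G B d"
  obtains F c where "finite F" "F \<subseteq> carrier G"
    "\<And>b b' d. \<lbrakk>b \<in> B; b' \<in> B; d \<in> D; word_eval G b' = word_eval G b \<otimes>\<^bsub>G\<^esub> d\<rbrakk>
       \<Longrightarrow> sync_offsets G F b b' \<and> length b \<le> length b' + c \<and> length b' \<le> length b + c"
proof -
  have "\<forall>d\<in>D. \<exists>F c. finite F \<and> F \<subseteq> carrier G \<and>
     (\<forall>b\<in>B. \<forall>b'\<in>B. word_eval G b' = word_eval G b \<otimes>\<^bsub>G\<^esub> d \<longrightarrow>
        sync_offsets G F b b' \<and> length b \<le> length b' + c \<and> length b' \<le> length b + c)"
    using assms(2) unfolding bounded_translates_def by blast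
  then obtain F c where Fc: "\<And>d. d \<in> D \<Longrightarrow> finite (F d) \<and> F d \<subseteq> carrier G \<and>
     (\<forall>b\<in>B. \<forall>b'\<in>B. word_eval G b' = word_eval G b \<otimes>\<^bsub>G\<^esub> d \<longrightarrow>
        sync_offsets G (F d) b b' \<and> length b \<le> length b' + c d \<and> length b' \<le> length b + c d)"
    by metis
  have le: "c d \<le> (\<Sum>d\<in>D. c d)" if "d \<in> D" for d
    using assms(1) that by (simp add: member_le_sum)
  have "sync_offsets G (\<Union>d\<in>D. F d) b b' \<and> length b \<le> length b' + (\<Sum>d\<in>D. c d) \<and> length b' \<le> length b + (\<Sum>d\<in>D. c d)"
    if b: "b \<in> B" "b' \<in> B" "d \<in> D" "word_eval G b' = word_eval G b \<otimes>\<^bsub>G\<^esub> d" for b b' d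
  proof -
    have "sync_offsets G (F d) b b'" "length b \<le> length b' + c d" "length b' \<le> length b + c d"
      using Fc[OF b(3)] b by blast+
    then show ?thesis using le[OF b(3)] b(3) unfolding sync_offsets_def by auto
  qed
  moreover have "finite (\<Union>d\<in>D. F d)" "(\<Union>d\<in>D. F d) \<subseteq> carrier G" using Fc assms(1) by auto
  ultimately show ?thesis using that by blast
qed

context group
begin

lemma word_eval_replicate: "a \<in> carrier G \<Longrightarrow> word_eval G (replicate n a) = a [^] n"
  by (induction n) (simp_all add: nat_pow_Suc2[symmetric] del: nat_pow_Suc)

lemma set_power_word: "set (power_word G a n) \<subseteq> {a, inv a}"
  by (auto simp: power_word_def)

lemma length_power_word: "length (power_word G a n) = nat \<bar>n\<bar>"
  by (auto simp: power_word_def)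

lemma take_power_word: "take k (power_word G a n) = power_word G a (max (- int k) (min (int k) n))"
proof -
  define m where "m = max (- int k) (min (int k) n)"
  have "nat \<bar>m\<bar> = min (nat \<bar>n\<bar>) k" "nat \<bar>m\<bar> = 0 \<or> (0 \<le> m \<longleftrightarrow> 0 \<le> n)"
    unfolding m_def by linarith+
  then have "power_word G a m = replicate (min (nat \<bar>n\<bar>) k) (if 0 \<le> n then a else inv a)"
    by (auto simp: power_word_def)
  moreover have "take k (power_word G a n) = replicate (min (nat \<bar>n\<bar>) k) (if 0 \<le> n then a else inv a)"
    by (simp add: power_word_def min.commute)
  ultimately show ?thesis unfolding m_def[symmetric] by simp
qed

lemma word_eval_power_word: "a \<in> carrier G \<Longrightarrow> word_eval G (power_word G a n) = a [^] n"
proof -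
  assume a: "a \<in> carrier G"
  obtain k where "n = int k \<or> n = - int k \<and> 0 < k"
    using int_cases2[of n] by (metis neg_0_equal_iff_equal of_nat_0 gr0I)
  then show ?thesis
  proof
    assume "n = int k"
    then show ?thesis using a by (simp add: power_word_def word_eval_replicate int_pow_int)
  next
    assume "n = - int k \<and> 0 < k"
    then have n: "n = - int k" and "0 < k" by auto
    then have "power_word G a n = replicate k (inv a)" by (simp add: power_word_def)
    then show ?thesis using a word_eval_replicate[of "inv a" k] nat_pow_inv[OF a, of k] int_pow_neg_int[OF a, of k]
      by (simp add: n)
  qed
qed

end

context comm_group
begin

lemma generate_insert_subset:
  assumes "a \<in> carrier G" "S \<subseteq> carrier G"
  shows "generate G (insert a S) \<subseteq> {x \<otimes> a [^] n | x (n::int). x \<in> generate G S}"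
proof
  fix g assume "g \<in> generate G (insert a S)"
  then show "g \<in> {x \<otimes> a [^] n | x (n::int). x \<in> generate G S}"
  proof (induction rule: generate.induct)
    case one
    show ?case using generate.one[of G S] by (intro CollectI exI[of _ \<one>] exI[of _ 0]) auto
  next
    case (incl h)
    show ?case
    proof (cases "h = a")
      case True
      then show ?thesis using generate.one[of G S] assms by (intro CollectI exI[of _ \<one>] exI[of _ 1]) auto
    next
      case False
      then show ?thesis using generate.incl[of h S G] incl assms by (intro CollectI exI[of _ h] exI[of _ 0]) auto
    qed
  next
    case (inv h)
    show ?case
    proof (cases "h = a")
      case True
      then show ?thesis using generate.one[of G S] assms
        by (intro CollectI exI[of _ \<one>] exI[of _ "-1"]) (auto simp: int_pow_neg)
    next
      case False
      then show ?thesis using generate.inv[of h S G] inv assms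
        by (intro CollectI exI[of _ "inv h"] exI[of _ 0]) auto
    qed
  next
    case (eng g h)
    then obtain x y and m n :: int where "g = x \<otimes> a [^] m" "h = y \<otimes> a [^] n" "x \<in> generate G S" "y \<in> generate G S"
      by blast
    moreover have "x \<in> carrier G" "y \<in> carrier G" using calculation generate_in_carrier[OF assms(2)] by auto
    ultimately show ?case using assms generate.eng[of x G S y]
      by (intro CollectI exI[of _ "x \<otimes> y"] exI[of _ "m + n"]) (auto simp: int_pow_mult m_ac)
  qed
qed

text \<open>The empty word is excluded in view of asynchronous fellow travelling.\<close>

definition normal_forms :: "'a set \<Rightarrow> 'a list set \<Rightarrow> bool" where
  "normal_forms A B \<longleftrightarrow> finite_quots B \<and> (\<exists>Y. finite Y \<and> Y \<subseteq> A \<and> B \<subseteq> lists Y) \<and> [] \<notin> B \<and>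
     word_eval G ` B = A \<and> (\<forall>d\<in>A. bounded_translates G B d)"

text \<open>If some positive power \<open>a\<^sup>q\<close> lies in \<open>A\<close>, then exponents below \<open>q\<close> suffice and trivially only finitely many
differences occur. Otherwise all exponents are needed, and then only the zeroth power of \<open>a\<close> lies in \<open>A\<close>, so
that the exponents of two words whose quotient is known differ by a known amount.\<close>

lemma exponent_set:
  assumes a: "a \<in> carrier G" and A: "subgroup A G"
  obtains E :: "int set" where "finite_quots (power_word G a ` E)"
    "\<And>n. \<exists>m\<in>E. a [^] (n - m) \<in> A"
    "\<And>i. finite {n + i - n' | n n'. n \<in> E \<and> n' \<in> E \<and> a [^] (n + i - n') \<in> A}"
proof (cases "\<exists>q>0. a [^] (q::int) \<in> A")
  case True
  then obtain q :: int where q: "q > 0" "a [^] q \<in> A" by blast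
  show ?thesis
  proof (rule that[of "{0..<q}"])
    show "finite_quots (power_word G a ` {0..<q})" by (simp add: finite_quots_finite)
    show "\<exists>m\<in>{0..<q}. a [^] (n - m) \<in> A" for n
    proof (rule bexI[of _ "n mod q"])
      have "n - n mod q = q * (n div q)" by (simp add: minus_mod_eq_mult_div)
      then have "a [^] (n - n mod q) = (a [^] q) [^] (n div q)" using a by (simp add: int_pow_pow)
      then show "a [^] (n - n mod q) \<in> A" using q(2) subgroup_int_pow_closed[OF A] by simp
    qed (use q in simp)
    show "finite {n + i - n' | n n'. n \<in> {0..<q} \<and> n' \<in> {0..<q} \<and> a [^] (n + i - n') \<in> A}" for i
      by (rule finite_subset[of _ "{i - q..i + q}"]) auto
  qed
next
  case False
  have zero: "n = 0" if "a [^] n \<in> A" for n :: int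
  proof (rule ccontr)
    assume "n \<noteq> 0"
    then consider "n > 0" | "- n > 0" by linarith
    then show False
    proof cases
      case 2
      have "a [^] (- n) \<in> A" using that a subgroup.m_inv_closed[OF A that] by (simp add: int_pow_neg)
      then show False using 2 False by blast
    qed (use that False in blast)
  qed
  show ?thesis
  proof (rule that[of UNIV])
    have "power_word G a ` UNIV = lists {a} \<union> lists {inv a}"
    proof
      show "power_word G a ` UNIV \<subseteq> lists {a} \<union> lists {inv a}"
        by (auto simp: power_word_def)
      show "lists {a} \<union> lists {inv a} \<subseteq> power_word G a ` UNIV"
      proof
        fix w assume "w \<in> lists {a} \<union> lists {inv a}"
        then have "w = replicate (length w) a \<or> w = replicate (length w) (inv a)"
          by (auto intro!: replicate_eqI)
        then have "w = power_word G a (int (length w)) \<or> w = power_word G a (- int (length w))"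
          by (auto simp: power_word_def)
        then show "w \<in> power_word G a ` UNIV" by blast
      qed
    qed
    then show "finite_quots (power_word G a ` UNIV)"
      by (simp add: finite_quots_Un finite_quots_lists)
    show "\<exists>m\<in>UNIV. a [^] (n - m) \<in> A" for n :: int
      using subgroup.one_closed[OF A] by (intro bexI[of _ n]) auto
    show "finite {n + i - n' | n n'. n \<in> (UNIV :: int set) \<and> n' \<in> UNIV \<and> a [^] (n + i - n') \<in> A}" for i
    proof (rule finite_subset)
      show "{n + i - n' | n n'. n \<in> (UNIV :: int set) \<and> n' \<in> UNIV \<and> a [^] (n + i - n') \<in> A} \<subseteq> {0}"
      proof
        fix m assume "m \<in> {n + i - n' | n n'. n \<in> (UNIV :: int set) \<and> n' \<in> UNIV \<and> a [^] (n + i - n') \<in> A}"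
        then have "a [^] m \<in> A" by blast
        then show "m \<in> {0}" using zero by simp
      qed
    qed simp
  qed
qed

end

lemma finite_int_bounded:
  assumes "finite (M :: int set)"
  obtains N :: nat where "\<And>m. m \<in> M \<Longrightarrow> \<bar>m\<bar> \<le> int N"
proof (rule that[of "\<Sum>m\<in>M. nat \<bar>m\<bar>"])
  fix m assume "m \<in> M"
  then have "nat \<bar>m\<bar> \<le> (\<Sum>m\<in>M. nat \<bar>m\<bar>)" using member_le_sum[of m M "\<lambda>m. nat \<bar>m\<bar>"] assms by simp
  then show "\<bar>m\<bar> \<le> int (\<Sum>m\<in>M. nat \<bar>m\<bar>)" by linarith
qed

lemma clamp_lipschitz:
  fixes k l m n :: int
  shows "\<bar>max (- k) (min k m) - max (- l) (min l n)\<bar> \<le> \<bar>k - l\<bar> + \<bar>m - n\<bar>"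
proof -
  have min: "\<bar>min k m - min l n\<bar> \<le> max \<bar>k - l\<bar> \<bar>m - n\<bar>"
    by (auto simp: min_def max_def abs_if)
  have max: "\<bar>max a b - max c d\<bar> \<le> max \<bar>a - c\<bar> \<bar>b - d\<bar>" for a b c d :: int
    by (auto simp: max_def abs_if)
  have "\<bar>max (- k) (min k m) - max (- l) (min l n)\<bar> \<le> max \<bar>- k - - l\<bar> \<bar>min k m - min l n\<bar>"
    by (rule max)
  also have "\<dots> \<le> max \<bar>k - l\<bar> (max \<bar>k - l\<bar> \<bar>m - n\<bar>)"
    using min by (intro max.mono) auto
  also have "\<dots> \<le> \<bar>k - l\<bar> + \<bar>m - n\<bar>" by simp
  finally show ?thesis .
qed

context comm_group
begin

lemma offset_mult_mult:
  "\<lbrakk>g \<in> carrier G; g' \<in> carrier G; h \<in> carrier G; h' \<in> carrier G\<rbrakk>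
     \<Longrightarrow> offset G (g \<otimes> h) (g' \<otimes> h') = offset G g g' \<otimes> offset G h h'"
proof -
  assume cl: "g \<in> carrier G" "g' \<in> carrier G" "h \<in> carrier G" "h' \<in> carrier G"
  have "offset G (g \<otimes> h) (g' \<otimes> h') = inv h \<otimes> ((inv g \<otimes> g') \<otimes> h')"
    using cl by (simp add: offset_def inv_mult_group m_assoc)
  also have "\<dots> = (inv g \<otimes> g') \<otimes> (inv h \<otimes> h')"
    using cl by (intro m_lcomm) auto
  finally show ?thesis by (simp add: offset_def)
qed

text \<open>If \<open>b' a\<^bsup>n'\<^esup> = b a\<^bsup>n\<^esup> d0 a\<^bsup>i\<^esup>\<close>, then \<open>a\<^bsup>m\<^esup>\<close> with \<open>m = n + i - n'\<close> lies in \<open>A\<close>, so \<open>m\<close> is one of finitely many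
integers. Hence \<open>b' = b (d0 a\<^bsup>m\<^esup>)\<close> differ by finitely many elements of \<open>A\<close> and stay close by
assumption, and \<open>n' = n + i - m\<close> differs from \<open>n\<close> by a bounded amount.\<close>

lemma bounded_translates_append_power:
  assumes a: "a \<in> carrier G" and A: "subgroup A G" and B: "normal_forms A B"
    and E: "\<And>i. finite {n + i - n' | n n'. n \<in> E \<and> n' \<in> E \<and> a [^] (n + i - n') \<in> A}"
    and d0: "d0 \<in> A"
  shows "bounded_translates G {b @ p | b p. b \<in> B \<and> p \<in> power_word G a ` E} (d0 \<otimes> a [^] (i::int))"
proof -
  let ?M = "{n + i - n' | n n'. n \<in> E \<and> n' \<in> E \<and> a [^] (n + i - n') \<in> A}"
  let ?D = "(\<lambda>m. d0 \<otimes> a [^] m) ` ?M"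
  obtain N :: nat where N: "\<And>m. m \<in> ?M \<Longrightarrow> \<bar>m\<bar> \<le> int N" using finite_int_bounded[OF E[of i]] by blast
  have AG: "x \<in> carrier G" if "x \<in> A" for x using that subgroup.subset[OF A] by blast
  obtain Y where Y: "Y \<subseteq> A" "B \<subseteq> lists Y" using B unfolding normal_forms_def by blast
  have Bset: "set b \<subseteq> carrier G" if "b \<in> B" for b
  proof -
    have "b \<in> lists Y" using that Y(2) by blast
    then show ?thesis using Y(1) AG by auto
  qed
  have Bev: "word_eval G b \<in> A" if "b \<in> B" for b
    using B that unfolding normal_forms_def by blast
  have finD: "finite ?D" using E by (intro finite_imageI)
  have BT: "bounded_translates G B d" if "d \<in> ?D" for d
  proof -
    have "d \<in> A" using that subgroup.m_closed[OF A d0] by blast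
    then show ?thesis using B unfolding normal_forms_def by blast
  qed
  obtain F c where F: "finite F" "F \<subseteq> carrier G" and
    Fc: "\<And>b b' d. \<lbrakk>b \<in> B; b' \<in> B; d \<in> ?D; word_eval G b' = word_eval G b \<otimes> d\<rbrakk>
       \<Longrightarrow> sync_offsets G F b b' \<and> length b \<le> length b' + c \<and> length b' \<le> length b + c"
    by (rule bounded_translates_uniform[OF finD BT]) blast+
  \<comment> \<open>At equal times, the exponents read so far differ by at most the difference \<open>c\<close> of the starting times plus
the bound \<open>N + \<bar>i\<bar>\<close> on the difference of the full exponents.\<close>
  define r where "r = int c + int N + \<bar>i\<bar>"
  let ?F = "F <#> ((\<lambda>k. a [^] k) ` {- r..r})"
  have take_ev: "word_eval G (take l (b @ power_word G a n)) =
      word_eval G (take l b) \<otimes> a [^] max (- int (l - length b)) (min (int (l - length b)) n)"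
    if "b \<in> B" for b l n
  proof -
    have "set (take l b) \<subseteq> carrier G" using Bset[OF that] by (auto dest: in_set_takeD)
    moreover have "set (take (l - length b) (power_word G a n)) \<subseteq> carrier G"
      using set_power_word[of a n] a by (auto dest!: in_set_takeD)
    ultimately show ?thesis using a
      by (simp add: word_eval_append) (simp add: take_power_word word_eval_power_word)
  qed
  have "sync_offsets G ?F (b @ power_word G a n) (b' @ power_word G a n') \<and>
      length (b @ power_word G a n) \<le> length (b' @ power_word G a n') + nat r \<and>
      length (b' @ power_word G a n') \<le> length (b @ power_word G a n) + nat r"
    if b: "b \<in> B" "b' \<in> B" "n \<in> E" "n' \<in> E"
      and ev: "word_eval G (b' @ power_word G a n') = word_eval G (b @ power_word G a n) \<otimes> (d0 \<otimes> a [^] i)"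
    for b b' n n'
  proof -
    let ?b = "word_eval G b" and ?b' = "word_eval G b'"
    have cl: "?b \<in> carrier G" "?b' \<in> carrier G" "d0 \<in> carrier G" using AG Bev b d0 by auto
    have pw: "set (power_word G a k) \<subseteq> carrier G" for k using set_power_word[of a k] a by auto
    have ev': "?b' \<otimes> a [^] n' = ?b \<otimes> d0 \<otimes> a [^] (n + i)"
      using ev a cl b Bset pw by (simp add: word_eval_append word_eval_power_word int_pow_mult m_ac)
    have "?b' = ?b' \<otimes> a [^] n' \<otimes> a [^] (- n')"
      using cl a by (simp add: m_assoc int_pow_mult[symmetric])
    also have "\<dots> = ?b \<otimes> d0 \<otimes> a [^] (n + i - n')"
      unfolding ev' using cl a by (simp add: m_assoc int_pow_mult[symmetric])
    finally have b': "?b' = ?b \<otimes> (d0 \<otimes> a [^] (n + i - n'))" using cl a by (simp add: m_assoc)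
    then have "a [^] (n + i - n') = inv (?b \<otimes> d0) \<otimes> ?b'"
      using cl a by (simp add: inv_solve_left m_assoc)
    moreover have "\<dots> \<in> A"
      using subgroup.m_closed[OF A] subgroup.m_inv_closed[OF A] Bev b d0 by blast
    ultimately have "a [^] (n + i - n') \<in> A" by simp
    then have m: "n + i - n' \<in> ?M" using b(3,4) by blast
    have s: "sync_offsets G F b b'" "length b \<le> length b' + c" "length b' \<le> length b + c"
      using Fc[OF b(1,2) _ b'] m by auto
    have nn: "\<bar>n - n'\<bar> \<le> int N + \<bar>i\<bar>" using N[OF m] by linarith
    have "offset G (word_eval G (take l (b @ power_word G a n))) (word_eval G (take l (b' @ power_word G a n'))) \<in> ?F" for l
    proof -
      let ?e = "max (- int (l - length b)) (min (int (l - length b)) n)"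
      let ?e' = "max (- int (l - length b')) (min (int (l - length b')) n')"
      have "\<bar>?e' - ?e\<bar> \<le> \<bar>int (l - length b') - int (l - length b)\<bar> + \<bar>n' - n\<bar>"
        by (rule clamp_lipschitz)
      also have "\<dots> \<le> r" using s(2,3) nn unfolding r_def by linarith
      finally have "\<bar>?e' - ?e\<bar> \<le> r" .
      then have e: "?e' - ?e \<in> {- r..r}" by (simp add: abs_le_iff)
      have tb: "word_eval G (take l b) \<in> carrier G" "word_eval G (take l b') \<in> carrier G"
        using Bset b by (auto intro!: word_eval_closed dest: in_set_takeD)
      have "offset G (a [^] ?e) (a [^] ?e') = a [^] (?e' - ?e)"
        using a by (simp add: offset_eq_iff int_pow_mult[symmetric])
      then have "offset G (word_eval G (take l (b @ power_word G a n))) (word_eval G (take l (b' @ power_word G a n')))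
         = offset G (word_eval G (take l b)) (word_eval G (take l b')) \<otimes> a [^] (?e' - ?e)"
        unfolding take_ev[OF b(1)] take_ev[OF b(2)] using a tb by (simp add: offset_mult_mult)
      also have "\<dots> \<in> ?F" using s(1) e unfolding sync_offsets_def by (intro set_multI imageI) auto
      finally show ?thesis .
    qed
    moreover have "length (b @ power_word G a n) \<le> length (b' @ power_word G a n') + nat r"
      "length (b' @ power_word G a n') \<le> length (b @ power_word G a n) + nat r"
      using s(2,3) nn unfolding r_def length_append length_power_word by linarith+
    ultimately show ?thesis unfolding sync_offsets_def by blast
  qed
  then have main: "sync_offsets G ?F w w' \<and> length w \<le> length w' + nat r \<and> length w' \<le> length w + nat r"
    if "w \<in> {b @ p | b p. b \<in> B \<and> p \<in> power_word G a ` E}"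
      "w' \<in> {b @ p | b p. b \<in> B \<and> p \<in> power_word G a ` E}"
      "word_eval G w' = word_eval G w \<otimes> (d0 \<otimes> a [^] i)" for w w'
    using that by blast
  have "finite ?F" using F(1) by (intro finite_set_mult finite_imageI) simp_all
  moreover have "?F \<subseteq> carrier G" using F(2) a by (auto simp: set_mult_def)
  ultimately show ?thesis
    unfolding bounded_translates_def using main
    by (intro exI[of _ ?F] exI[of _ "nat r"] conjI[of "finite ?F"] conjI[of "?F \<subseteq> carrier G"] ballI impI)
qed

lemma normal_forms_insert:
  assumes a: "a \<in> carrier G" and S: "S \<subseteq> carrier G" and B: "normal_forms (generate G S) B"
  obtains B' where "normal_forms (generate G (insert a S)) B'"
proof -
  let ?A = "generate G S" and ?A' = "generate G (insert a S)"
  have A: "subgroup ?A G" "subgroup ?A' G" using a S by (auto intro!: generate_is_subgroup)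
  have AG: "x \<in> carrier G" if "x \<in> ?A" for x using that generate_in_carrier[OF S] by blast
  have sub: "?A \<subseteq> ?A'" by (rule mono_generate) auto
  have aA: "a \<in> ?A'" by (simp add: generate.incl)
  obtain E where E: "finite_quots (power_word G a ` E)" "\<And>n. \<exists>m\<in>E. a [^] (n - m) \<in> ?A"
    "\<And>i. finite {n + i - n' | n n'. n \<in> E \<and> n' \<in> E \<and> a [^] (n + i - n') \<in> ?A}"
    using exponent_set[OF a A(1)] by blast
  obtain Y where Y: "finite Y" "Y \<subseteq> ?A" "B \<subseteq> lists Y" using B unfolding normal_forms_def by blast
  have Bev: "word_eval G ` B = ?A" using B unfolding normal_forms_def by blast
  let ?B' = "{b @ p | b p. b \<in> B \<and> p \<in> power_word G a ` E}"
  have ev: "word_eval G (b @ power_word G a n) = word_eval G b \<otimes> a [^] n" if "b \<in> B" for b n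
  proof -
    have "b \<in> lists Y" using that Y(3) by blast
    then have "set b \<subseteq> carrier G" using Y(2) AG by auto
    moreover have "set (power_word G a n) \<subseteq> carrier G" using set_power_word[of a n] a by auto
    ultimately show ?thesis using a by (simp add: word_eval_append word_eval_power_word)
  qed
  have "normal_forms ?A' ?B'"
    unfolding normal_forms_def
  proof (intro conjI ballI)
    show "finite_quots ?B'"
      by (rule finite_quots_concat) (use B E in \<open>auto simp: normal_forms_def\<close>)
    show "\<exists>Y'. finite Y' \<and> Y' \<subseteq> ?A' \<and> ?B' \<subseteq> lists Y'"
    proof (intro exI[of _ "Y \<union> {a, inv a}"] conjI)
      show "Y \<union> {a, inv a} \<subseteq> ?A'"
        using Y sub aA subgroup.m_inv_closed[OF A(2)] by auto
      show "?B' \<subseteq> lists (Y \<union> {a, inv a})"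
        using Y(3) set_power_word by fastforce
    qed (use Y in simp)
    show "[] \<notin> ?B'" using B by (auto simp: normal_forms_def)
    show "word_eval G ` ?B' = ?A'"
    proof
      show "word_eval G ` ?B' \<subseteq> ?A'"
      proof clarify
        fix b n assume "b \<in> B" "n \<in> E"
        moreover have "word_eval G b \<in> ?A'" using Bev sub \<open>b \<in> B\<close> by blast
        ultimately show "word_eval G (b @ power_word G a n) \<in> ?A'"
          using ev subgroup.m_closed[OF A(2)] subgroup_int_pow_closed[OF A(2) aA] by simp
      qed
      show "?A' \<subseteq> word_eval G ` ?B'"
      proof
        fix g assume "g \<in> ?A'"
        then obtain x n where g: "x \<in> ?A" "g = x \<otimes> a [^] (n::int)"
          using generate_insert_subset[OF a S] by blast
        obtain m where m: "m \<in> E" "a [^] (n - m) \<in> ?A" using E(2) by blast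
        then have "x \<otimes> a [^] (n - m) \<in> word_eval G ` B"
          using Bev g subgroup.m_closed[OF A(1)] by simp
        then obtain b where b: "b \<in> B" "word_eval G b = x \<otimes> a [^] (n - m)" by auto
        have "g = word_eval G (b @ power_word G a m)"
          unfolding ev[OF b(1)] b(2) g(2) using AG[OF g(1)] a by (simp add: m_assoc int_pow_mult[symmetric])
        moreover have "b @ power_word G a m \<in> ?B'" using b m by blast
        ultimately show "g \<in> word_eval G ` ?B'" by blast
      qed
    qed
    fix d assume "d \<in> ?A'"
    then obtain d0 i where "d0 \<in> ?A" "d = d0 \<otimes> a [^] (i::int)"
      using generate_insert_subset[OF a S] by blast
    then show "bounded_translates G ?B' d"
      using bounded_translates_append_power[OF a A(1) B E(3)] by simp
  qed
  then show ?thesis using that by blast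
qed

lemma normal_forms_exist:
  assumes "finite S" "S \<subseteq> carrier G"
  shows "\<exists>B. normal_forms (generate G S) B"
  using assms
proof (induction S rule: finite_induct)
  case empty
  \<comment> \<open>The trivial group is represented by the one-letter word rather than by the empty word.\<close>
  have "take i [\<one>] = [] \<or> take i [\<one>] = [\<one>]" for i by (cases i) auto
  then have "word_eval G (take i [\<one>]) = \<one>" for i by (metis word_eval_Cons word_eval_Nil one_closed r_one)
  then have "sync_offsets G {\<one>} [\<one>] [\<one>]" by (simp add: sync_offsets_def)
  then have "bounded_translates G {[\<one>]} d" for d
    unfolding bounded_translates_def by (intro exI[of _ "{\<one>}"] exI[of _ 0]) auto
  then have "normal_forms (generate G {}) {[\<one>]}"
    unfolding normal_forms_def generate_empty
    by (auto simp: finite_quots_finite intro!: exI[of _ "{\<one>}"])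
  then show ?case by blast
next
  case (insert a S)
  then show ?case using normal_forms_insert[of a S] by blast
qed

end

section \<open>A language for the kernel\<close>

text \<open>The normal forms of \<open>A\<close>, seen inside \<open>G\<close>, with the closeness condition made uniform over finite sets of
translations.\<close>

definition kernel_language :: "('g, 'm) monoid_scheme \<Rightarrow> 'g set \<Rightarrow> 'g set \<Rightarrow> 'g list set \<Rightarrow> bool" where
  "kernel_language G A Y B \<longleftrightarrow> finite Y \<and> Y \<subseteq> A \<and> B \<subseteq> lists Y \<and> regular B \<and> [] \<notin> B \<and> word_eval G ` B = A \<and>
     (\<forall>D. finite D \<and> D \<subseteq> A \<longrightarrow> (\<exists>F c. finite F \<and> F \<subseteq> A \<and>
        (\<forall>b\<in>B. \<forall>b'\<in>B. \<forall>d\<in>D. word_eval G b' = word_eval G b \<otimes>\<^bsub>G\<^esub> d \<longrightarrow>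
           sync_offsets G F b b' \<and> length b \<le> length b' + c \<and> length b' \<le> length b + c)))"

lemma kernel_language_exists:
  assumes "group G" "fin_gen_abelian_subgroup G A"
  shows "\<exists>Y B. kernel_language G A Y B"
proof -
  interpret group G by fact
  have sub: "subgroup A G" and comm: "comm_group (G\<lparr>carrier := A\<rparr>)"
    using assms(2) unfolding fin_gen_abelian_subgroup_def by blast+
  obtain S where S: "finite S" "S \<subseteq> A" "generate G S = A"
    using assms(2) unfolding fin_gen_abelian_subgroup_def by blast
  interpret A: comm_group "G\<lparr>carrier := A\<rparr>" by fact
  have ev: "word_eval (G\<lparr>carrier := A\<rparr>) = word_eval G" by (rule ext) (simp add: word_eval_def)
  have "generate (G\<lparr>carrier := A\<rparr>) S = A" using generate_consistent[OF S(2) sub] S(3) by simp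
  then obtain B where nf: "A.normal_forms A B" using A.normal_forms_exist[OF S(1)] S(2) by auto
  obtain Y where Y: "finite Y" "Y \<subseteq> A" "B \<subseteq> lists Y"
    using nf unfolding A.normal_forms_def by (elim conjE exE)
  have B: "finite_quots B" "[] \<notin> B" "word_eval G ` B = A"
    using nf unfolding A.normal_forms_def ev by simp_all
  have BT: "bounded_translates (G\<lparr>carrier := A\<rparr>) B d" if "d \<in> A" for d
    using nf that unfolding A.normal_forms_def by simp
  have off: "offset (G\<lparr>carrier := A\<rparr>) g h = offset G g h" if "g \<in> A" for g h
    using m_inv_consistent[OF sub that] by (simp add: offset_def)
  have sync: "sync_offsets (G\<lparr>carrier := A\<rparr>) F b b' \<longleftrightarrow> sync_offsets G F b b'" if "b \<in> B" for b b' F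
  proof -
    have "b \<in> lists Y" using that Y(3) by blast
    then have "set (take i b) \<subseteq> A" for i using Y(2) by (auto dest: in_set_takeD)
    then have "word_eval G (take i b) \<in> A" for i using A.word_eval_closed[of "take i b"] by (simp add: ev)
    then show ?thesis by (simp add: sync_offsets_def ev off)
  qed
  have "\<exists>F c. finite F \<and> F \<subseteq> A \<and>
        (\<forall>b\<in>B. \<forall>b'\<in>B. \<forall>d\<in>D. word_eval G b' = word_eval G b \<otimes>\<^bsub>G\<^esub> d \<longrightarrow>
           sync_offsets G F b b' \<and> length b \<le> length b' + c \<and> length b' \<le> length b + c)"
    if D: "finite D" "D \<subseteq> A" for D
  proof -
    have BT': "bounded_translates (G\<lparr>carrier := A\<rparr>) B d" if "d \<in> D" for d using BT D(2) that by blast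
    obtain F c where "finite F" "F \<subseteq> carrier (G\<lparr>carrier := A\<rparr>)"
      and Fc: "\<And>b b' d. \<lbrakk>b \<in> B; b' \<in> B; d \<in> D; word_eval (G\<lparr>carrier := A\<rparr>) b' = word_eval (G\<lparr>carrier := A\<rparr>) b \<otimes>\<^bsub>G\<lparr>carrier := A\<rparr>\<^esub> d\<rbrakk>
       \<Longrightarrow> sync_offsets (G\<lparr>carrier := A\<rparr>) F b b' \<and> length b \<le> length b' + c \<and> length b' \<le> length b + c"
      by (rule bounded_translates_uniform[OF D(1) BT']) blast+
    then show ?thesis using sync by (intro exI[of _ F] exI[of _ c]) (simp add: ev)
  qed
  moreover have "regular B" using finite_quots_imp_regular[OF B(1) Y(1,3)] .
  ultimately have "kernel_language G A Y B" unfolding kernel_language_def using B Y by simp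
  then show ?thesis by blast
qed

section \<open>Central extensions\<close>

locale central_extension = G: group G + H: group H
  for G :: "('g, 'm) monoid_scheme" (structure) and H :: "('h, 'n) monoid_scheme" +
  fixes A :: "'g set" and s :: "'h \<Rightarrow> 'g" and \<sigma> :: "'h \<Rightarrow> 'h \<Rightarrow> 'g"
  assumes A_subgroup: "subgroup A G"
    and central: "\<lbrakk>g \<in> carrier G; a \<in> A\<rbrakk> \<Longrightarrow> a \<otimes> g = g \<otimes> a"
    and decompose: "g \<in> carrier G \<Longrightarrow> \<exists>h\<in>carrier H. \<exists>a\<in>A. g = s h \<otimes> a"
    and s_unique: "\<lbrakk>h \<in> carrier H; h' \<in> carrier H; a \<in> A; a' \<in> A; s h \<otimes> a = s h' \<otimes> a'\<rbrakk> \<Longrightarrow> h = h'"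
    and s_closed [simp]: "h \<in> carrier H \<Longrightarrow> s h \<in> carrier G"
    and s_one [simp]: "s \<one>\<^bsub>H\<^esub> = \<one>"
    and \<sigma>_in: "\<lbrakk>h \<in> carrier H; h' \<in> carrier H\<rbrakk> \<Longrightarrow> \<sigma> h h' \<in> A"
    and s_mult: "\<lbrakk>h \<in> carrier H; h' \<in> carrier H\<rbrakk> \<Longrightarrow> s h \<otimes> s h' = s (h \<otimes>\<^bsub>H\<^esub> h') \<otimes> \<sigma> h h'"

text \<open>The section together with \<open>A\<close> covers \<open>G\<close> because every coset is the coset of a value of the section. \<open>A\<close> is
central because it is abelian and commutes with these values.\<close>

lemma central_extensionI:
  assumes A: "fin_gen_abelian_subgroup G A" and ext: "extension_by_cocycle G A H \<phi> s \<sigma>"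
    and triv: "trivial_action G A H s"
  shows "central_extension G H A s \<sigma>"
proof -
  have grp: "group G" "group H" and nor: "A \<lhd> G" and \<phi>: "\<phi> \<in> iso (G Mod A) H"
    and s: "\<And>h. h \<in> carrier H \<Longrightarrow> s h \<in> carrier G" "\<And>h. h \<in> carrier H \<Longrightarrow> \<phi> (A #>\<^bsub>G\<^esub> s h) = h" "s \<one>\<^bsub>H\<^esub> = \<one>\<^bsub>G\<^esub>"
    and \<sigma>: "\<And>h h'. \<lbrakk>h \<in> carrier H; h' \<in> carrier H\<rbrakk> \<Longrightarrow> \<sigma> h h' \<in> A"
      "\<And>h h'. \<lbrakk>h \<in> carrier H; h' \<in> carrier H\<rbrakk> \<Longrightarrow> s h \<otimes>\<^bsub>G\<^esub> s h' = s (h \<otimes>\<^bsub>H\<^esub> h') \<otimes>\<^bsub>G\<^esub> \<sigma> h h'"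
    using ext unfolding extension_by_cocycle_def by blast+
  interpret G: group G by fact
  interpret H: group H by fact
  have sub: "subgroup A G" and comm: "comm_group (G\<lparr>carrier := A\<rparr>)"
    using A unfolding fin_gen_abelian_subgroup_def by blast+
  have AG: "a \<in> carrier G" if "a \<in> A" for a using subgroup.subset[OF sub] that by blast
  have comm': "a \<otimes>\<^bsub>G\<^esub> b = b \<otimes>\<^bsub>G\<^esub> a" if "a \<in> A" "b \<in> A" for a b
    using comm_groupE(4)[OF comm, of a b] that by simp
  have scomm: "s h \<otimes>\<^bsub>G\<^esub> a = a \<otimes>\<^bsub>G\<^esub> s h" if "h \<in> carrier H" "a \<in> A" for h a
  proof -
    have "s h \<otimes>\<^bsub>G\<^esub> a \<otimes>\<^bsub>G\<^esub> inv\<^bsub>G\<^esub> (s h) = a" using triv that unfolding trivial_action_def by blast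
    then have "s h \<otimes>\<^bsub>G\<^esub> a \<otimes>\<^bsub>G\<^esub> inv\<^bsub>G\<^esub> (s h) \<otimes>\<^bsub>G\<^esub> s h = a \<otimes>\<^bsub>G\<^esub> s h" by simp
    then show ?thesis using s(1)[OF that(1)] AG[OF that(2)] by (simp add: G.m_assoc)
  qed
  have coset: "A #>\<^bsub>G\<^esub> g \<in> carrier (G Mod A)" if "g \<in> carrier G" for g
    using that by (auto simp: FactGroup_def RCOSETS_def)
  have inj: "inj_on \<phi> (carrier (G Mod A))" and img: "\<phi> ` carrier (G Mod A) = carrier H"
    using \<phi> by (auto simp: iso_def bij_betw_def)
  have dec: "\<exists>h\<in>carrier H. \<exists>a\<in>A. g = s h \<otimes>\<^bsub>G\<^esub> a" if g: "g \<in> carrier G" for g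
  proof -
    define h where "h = \<phi> (A #>\<^bsub>G\<^esub> g)"
    have h: "h \<in> carrier H" unfolding h_def using coset[OF g] img by blast
    have "\<phi> (A #>\<^bsub>G\<^esub> s h) = \<phi> (A #>\<^bsub>G\<^esub> g)" using s(2)[OF h] by (simp add: h_def)
    then have "A #>\<^bsub>G\<^esub> s h = A #>\<^bsub>G\<^esub> g" using inj_onD[OF inj] coset g s(1)[OF h] by blast
    then have "g \<in> A #>\<^bsub>G\<^esub> s h" using G.rcos_self[OF g sub] by simp
    then obtain a where a: "a \<in> A" "g = a \<otimes>\<^bsub>G\<^esub> s h" by (auto simp: r_coset_def)
    then show ?thesis using scomm[OF h a(1)] h by metis
  qed
  show ?thesis
  proof (intro central_extension.intro central_extension_axioms.intro grp sub)
    fix g a assume g: "g \<in> carrier G" and a: "a \<in> A"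
    then obtain h b where hb: "h \<in> carrier H" "b \<in> A" "g = s h \<otimes>\<^bsub>G\<^esub> b" using dec by blast
    have "a \<otimes>\<^bsub>G\<^esub> g = a \<otimes>\<^bsub>G\<^esub> s h \<otimes>\<^bsub>G\<^esub> b" using hb a AG s by (simp add: G.m_assoc)
    also have "\<dots> = s h \<otimes>\<^bsub>G\<^esub> (a \<otimes>\<^bsub>G\<^esub> b)" using hb a AG s by (simp add: scomm[symmetric] G.m_assoc)
    also have "\<dots> = g \<otimes>\<^bsub>G\<^esub> a" using hb a AG s by (simp add: comm'[of a b] G.m_assoc)
    finally show "a \<otimes>\<^bsub>G\<^esub> g = g \<otimes>\<^bsub>G\<^esub> a" .
  next
    fix h h' a a' assume *: "h \<in> carrier H" "h' \<in> carrier H" "a \<in> A" "a' \<in> A" "s h \<otimes>\<^bsub>G\<^esub> a = s h' \<otimes>\<^bsub>G\<^esub> a'"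
    have "A #>\<^bsub>G\<^esub> (s k \<otimes>\<^bsub>G\<^esub> b) = A #>\<^bsub>G\<^esub> s k" if "k \<in> carrier H" "b \<in> A" for k b
      unfolding scomm[OF that]
      using G.coset_mult_assoc[OF subgroup.subset[OF sub] AG[OF that(2)] s(1)[OF that(1)]]
        G.coset_join2[OF AG[OF that(2)] sub that(2)] by simp
    then have "A #>\<^bsub>G\<^esub> s h = A #>\<^bsub>G\<^esub> s h'" using * by metis
    then show "h = h'" using s(2) * by metis
  qed (use dec s \<sigma> in auto)
qed

context central_extension
begin

lemma A_carrier: "a \<in> A \<Longrightarrow> a \<in> carrier G"
  using subgroup.subset[OF A_subgroup] by blast

lemma A_closed: "\<lbrakk>a \<in> A; b \<in> A\<rbrakk> \<Longrightarrow> a \<otimes> b \<in> A" "a \<in> A \<Longrightarrow> inv a \<in> A" "\<one> \<in> A"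
  using subgroup.m_closed[OF A_subgroup] subgroup.m_inv_closed[OF A_subgroup] subgroup.one_closed[OF A_subgroup]
  by auto

lemma s_left_cancel:
  assumes "h \<in> carrier H" "h' \<in> carrier H" "a \<in> A" "a' \<in> A" "s h \<otimes> a = s h' \<otimes> a'"
  shows "h = h' \<and> a = a'"
  using s_unique[OF assms] assms A_carrier by auto

lemma section_mult:
  assumes "h \<in> carrier H" "h' \<in> carrier H" "a \<in> A" "b \<in> A"
  shows "s h \<otimes> a \<otimes> (s h' \<otimes> b) = s (h \<otimes>\<^bsub>H\<^esub> h') \<otimes> (\<sigma> h h' \<otimes> a \<otimes> b)"
proof -
  have cl: "s h \<in> carrier G" "s h' \<in> carrier G" "a \<in> carrier G" "b \<in> carrier G" "\<sigma> h h' \<in> carrier G"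
    "s (h \<otimes>\<^bsub>H\<^esub> h') \<in> carrier G"
    using assms A_carrier \<sigma>_in by auto
  have "s h \<otimes> a \<otimes> (s h' \<otimes> b) = s h \<otimes> (a \<otimes> s h') \<otimes> b"
    using cl by (simp add: G.m_assoc)
  also have "\<dots> = s h \<otimes> s h' \<otimes> (a \<otimes> b)"
    using cl central[OF cl(2) assms(3)] by (simp add: G.m_assoc)
  also have "\<dots> = s (h \<otimes>\<^bsub>H\<^esub> h') \<otimes> (\<sigma> h h' \<otimes> a \<otimes> b)"
    using cl assms by (simp add: s_mult G.m_assoc)
  finally show ?thesis .
qed

lemma \<sigma>_one:
  assumes "h \<in> carrier H"
  shows "\<sigma> h \<one>\<^bsub>H\<^esub> = \<one>" "\<sigma> \<one>\<^bsub>H\<^esub> h = \<one>"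
proof -
  have "s h \<otimes> \<one> = s h \<otimes> \<sigma> h \<one>\<^bsub>H\<^esub>" "s h \<otimes> \<one> = s h \<otimes> \<sigma> \<one>\<^bsub>H\<^esub> h"
    using s_mult[of h "\<one>\<^bsub>H\<^esub>"] s_mult[of "\<one>\<^bsub>H\<^esub>" h] assms by auto
  then show "\<sigma> h \<one>\<^bsub>H\<^esub> = \<one>" "\<sigma> \<one>\<^bsub>H\<^esub> h = \<one>"
    using s_left_cancel[OF assms assms A_closed(3) \<sigma>_in[OF assms H.one_closed]]
      s_left_cancel[OF assms assms A_closed(3) \<sigma>_in[OF H.one_closed assms]] by auto
qed

text \<open>The correction by the inverse of the cocycle makes the lift of a word end at the value of the section.\<close>

definition lift_letter :: "'h list \<Rightarrow> 'h \<Rightarrow> 'g" where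
  "lift_letter v x = s x \<otimes> inv (\<sigma> (word_eval H v) x)"

definition lift :: "'h list \<Rightarrow> 'g list" where
  "lift = seq_map lift_letter"

lemma length_lift [simp]: "length (lift w) = length w"
  by (simp add: lift_def)

lemma take_lift: "take i (lift w) = lift (take i w)"
  by (simp add: lift_def take_seq_map)

lemma lift_letter_closed:
  "\<lbrakk>set v \<subseteq> carrier H; x \<in> carrier H\<rbrakk> \<Longrightarrow> lift_letter v x \<in> carrier G"
  using \<sigma>_in A_carrier by (simp add: lift_letter_def)

lemma lift_snoc: "lift (w @ [x]) = lift w @ [lift_letter w x]"
  by (simp add: lift_def seq_map_snoc)

lemma set_lift: "set w \<subseteq> carrier H \<Longrightarrow> set (lift w) \<subseteq> carrier G"
  by (induction w rule: rev_induct) (auto simp: lift_snoc lift_letter_closed, simp add: lift_def seq_map_def)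

lemma word_eval_lift: "set w \<subseteq> carrier H \<Longrightarrow> word_eval G (lift w) = s (word_eval H w)"
proof (induction w rule: rev_induct)
  case Nil
  then show ?case by (simp add: lift_def seq_map_def)
next
  case (snoc x w)
  then have w: "set w \<subseteq> carrier H" "x \<in> carrier H" "word_eval H w \<in> carrier H" by auto
  let ?\<sigma> = "\<sigma> (word_eval H w) x"
  have \<sigma>: "?\<sigma> \<in> A" "?\<sigma> \<in> carrier G" using \<sigma>_in w A_carrier by auto
  have "word_eval G (lift (w @ [x])) = s (word_eval H w) \<otimes> lift_letter w x"
    using snoc w set_lift lift_letter_closed by (simp add: lift_snoc G.word_eval_append)
  also have "\<dots> = s (word_eval H w) \<otimes> s x \<otimes> inv ?\<sigma>"
    unfolding lift_letter_def using w \<sigma> by (simp add: G.m_assoc)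
  also have "\<dots> = s (word_eval H w \<otimes>\<^bsub>H\<^esub> x)"
    using w \<sigma> by (simp add: s_mult G.m_assoc)
  finally show ?case using w by (simp add: H.word_eval_append)
qed

end

locale marked_central_extension = central_extension G H A s \<sigma> + marked_group H X
  for G :: "('g, 'm) monoid_scheme" (structure) and H :: "('h, 'n) monoid_scheme" and A s \<sigma> X +
  assumes \<sigma>_left_finite: "finite {\<sigma> x h | x h. x \<in> X \<and> h \<in> carrier H}"
    and \<sigma>_right_finite: "finite {\<sigma> h x | h x. h \<in> carrier H \<and> x \<in> X}"
begin

definition lift_letters :: "'g set" where
  "lift_letters = {s x \<otimes> inv (\<sigma> h x) | h x. h \<in> carrier H \<and> x \<in> X}"

lemma finite_lift_letters: "finite lift_letters"
proof -
  have "lift_letters \<subseteq> s ` X <#> (\<lambda>a. inv a) ` {\<sigma> h x | h x. h \<in> carrier H \<and> x \<in> X}"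
    unfolding lift_letters_def by (auto intro!: set_multI imageI)
  then show ?thesis
    by (rule finite_subset) (intro finite_set_mult finite_imageI finite_X \<sigma>_right_finite)
qed

lemma lift_in_lists: "w \<in> lists X \<Longrightarrow> lift w \<in> lists lift_letters"
proof (induction w rule: rev_induct)
  case (snoc x w)
  then have "w \<in> lists X" "x \<in> X" by auto
  moreover have "lift_letter w x \<in> lift_letters"
    unfolding lift_letter_def lift_letters_def using calculation by blast
  ultimately show ?case using snoc.IH by (simp add: lift_snoc)
qed (simp add: lift_def seq_map_def)

text \<open>Along an edge \<open>x\<close> of the Cayley graph of \<open>H\<close>, the offset of the images under the section is one of the
finitely many letters of lifts; a general \<open>g\<close> is a product of generators.\<close>

lemma section_offsets_finite:
  assumes "g \<in> carrier H"
  shows "finite {offset G (s h) (s (h \<otimes>\<^bsub>H\<^esub> g)) | h. h \<in> carrier H}"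
proof -
  have "finite {offset G (s h) (s (h \<otimes>\<^bsub>H\<^esub> word_eval H u)) | h. h \<in> carrier H}" if "u \<in> lists X" for u
    using that
  proof (induction u rule: rev_induct)
    case Nil
    have "{offset G (s h) (s (h \<otimes>\<^bsub>H\<^esub> word_eval H [])) | h. h \<in> carrier H} \<subseteq> {\<one>}" by auto
    then show ?case by (rule finite_subset) simp
  next
    case (snoc x u)
    then have x: "x \<in> X" "x \<in> carrier H" and u: "u \<in> lists X" "word_eval H u \<in> carrier H" using X_sub by auto
    have ux: "word_eval H (u @ [x]) = word_eval H u \<otimes>\<^bsub>H\<^esub> x" using x u by (simp add: eval_app)
    have "offset G (s h) (s (h \<otimes>\<^bsub>H\<^esub> word_eval H (u @ [x]))) \<in>
        {offset G (s h) (s (h \<otimes>\<^bsub>H\<^esub> word_eval H u)) | h. h \<in> carrier H} <#> lift_letters"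
      if h: "h \<in> carrier H" for h
    proof -
      let ?k = "h \<otimes>\<^bsub>H\<^esub> word_eval H u"
      have k: "?k \<in> carrier H" using h u by simp
      have \<sigma>: "\<sigma> ?k x \<in> carrier G" using \<sigma>_in[OF k x(2)] A_carrier by blast
      have "s (?k \<otimes>\<^bsub>H\<^esub> x) = s ?k \<otimes> (s x \<otimes> inv (\<sigma> ?k x))"
        using s_mult[OF k x(2)] \<sigma> k x by (simp add: G.m_assoc[symmetric]) (simp add: G.m_assoc)
      then have "offset G (s ?k) (s (?k \<otimes>\<^bsub>H\<^esub> x)) = s x \<otimes> inv (\<sigma> ?k x)"
        using \<sigma> k x by (simp add: G.offset_eq_iff)
      also have "\<dots> \<in> lift_letters" using k x unfolding lift_letters_def by blast
      finally have "offset G (s h) (s ?k) \<otimes> offset G (s ?k) (s (?k \<otimes>\<^bsub>H\<^esub> x)) \<in>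
         {offset G (s h) (s (h \<otimes>\<^bsub>H\<^esub> word_eval H u)) | h. h \<in> carrier H} <#> lift_letters"
        using h by (intro set_multI) blast+
      then show ?thesis using h k x u ux by (simp add: G.offset_trans H.m_assoc)
    qed
    then have "{offset G (s h) (s (h \<otimes>\<^bsub>H\<^esub> word_eval H (u @ [x]))) | h. h \<in> carrier H} \<subseteq>
        {offset G (s h) (s (h \<otimes>\<^bsub>H\<^esub> word_eval H u)) | h. h \<in> carrier H} <#> lift_letters" by blast
    then show ?case
      by (rule finite_subset) (intro finite_set_mult finite_lift_letters snoc.IH u)
  qed
  then show ?thesis using words_exist[OF assms] by blast
qed

lemma section_offsets_finite_set:
  assumes "finite F" "F \<subseteq> carrier H"
  obtains F' where "finite F'" "F' \<subseteq> carrier G"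
    "\<And>h k. \<lbrakk>h \<in> carrier H; k \<in> carrier H; offset H h k \<in> F\<rbrakk> \<Longrightarrow> offset G (s h) (s k) \<in> F'"
proof (rule that[of "\<Union>g\<in>F. {offset G (s h) (s (h \<otimes>\<^bsub>H\<^esub> g)) | h. h \<in> carrier H}"])
  show "finite (\<Union>g\<in>F. {offset G (s h) (s (h \<otimes>\<^bsub>H\<^esub> g)) | h. h \<in> carrier H})"
    using section_offsets_finite assms by auto
  show "(\<Union>g\<in>F. {offset G (s h) (s (h \<otimes>\<^bsub>H\<^esub> g)) | h. h \<in> carrier H}) \<subseteq> carrier G"
    using assms by auto
  fix h k assume hk: "h \<in> carrier H" "k \<in> carrier H" "offset H h k \<in> F"
  have "k = h \<otimes>\<^bsub>H\<^esub> offset H h k" using hk by (simp add: H.mult_offset)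
  then show "offset G (s h) (s k) \<in> (\<Union>g\<in>F. {offset G (s h) (s (h \<otimes>\<^bsub>H\<^esub> g)) | h. h \<in> carrier H})"
    using hk by (intro UN_I[of "offset H h k"]) (simp_all, metis)
qed

lemma staircase_lift:
  assumes "finite F" "F \<subseteq> carrier H"
  obtains F' where "finite F'" "F' \<subseteq> carrier G"
    "\<And>v w D. \<lbrakk>v \<in> lists X; w \<in> lists X; staircase H F D v w\<rbrakk> \<Longrightarrow> staircase G F' D (lift v) (lift w)"
proof -
  obtain F' where F': "finite F'" "F' \<subseteq> carrier G"
    "\<And>h k. \<lbrakk>h \<in> carrier H; k \<in> carrier H; offset H h k \<in> F\<rbrakk> \<Longrightarrow> offset G (s h) (s k) \<in> F'"
    using section_offsets_finite_set[OF assms] by metis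
  have "staircase G F' D (lift v) (lift w)"
    if vw: "v \<in> lists X" "w \<in> lists X" "staircase H F D v w" for v w D
  proof (rule staircase_map[OF vw(3)])
    fix i j assume "i \<le> length v" "j \<le> length w" "close_pair H F D (take i v) (take j w)"
    then show "close_pair G F' D (take i (lift v)) (take j (lift w))"
      using vw F'(3) lists_carrier[OF take_lists[OF vw(1)]] lists_carrier[OF take_lists[OF vw(2)]]
      by (simp add: close_pair_def take_lift word_eval_lift)
  qed simp_all
  then show ?thesis using that F' by blast
qed

text \<open>For each \<open>x\<close>, an element of \<open>Z\<close> is of the form \<open>s(x) a\<close> for at most one \<open>a\<close>.\<close>

lemma finite_kernel_parts:
  assumes "finite Z"
  shows "finite {a \<in> A. \<exists>x\<in>X \<union> {\<one>\<^bsub>H\<^esub>}. s x \<otimes> a \<in> Z}"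
proof -
  let ?X = "X \<union> {\<one>\<^bsub>H\<^esub>}"
  have "{a \<in> A. \<exists>x\<in>?X. s x \<otimes> a \<in> Z} \<subseteq> (\<lambda>x. inv (s x)) ` ?X <#> Z"
  proof
    fix a assume "a \<in> {a \<in> A. \<exists>x\<in>?X. s x \<otimes> a \<in> Z}"
    then obtain x where x: "a \<in> A" "x \<in> ?X" "s x \<otimes> a \<in> Z" by blast
    have "x \<in> carrier H" using x X_sub by auto
    then have "a = inv (s x) \<otimes> (s x \<otimes> a)"
      using x A_carrier by (simp add: G.m_assoc[symmetric])
    moreover have "inv (s x) \<otimes> (s x \<otimes> a) \<in> (\<lambda>x. inv (s x)) ` ?X <#> Z"
      using x by (intro set_multI imageI)
    ultimately show "a \<in> (\<lambda>x. inv (s x)) ` ?X <#> Z" by simp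
  qed
  then show ?thesis
    by (rule finite_subset) (intro finite_set_mult finite_imageI assms, simp add: finite_X)
qed

lemma finite_cocycle_values:
  "finite {\<sigma> h x | h x. h \<in> carrier H \<and> x \<in> X \<union> {\<one>\<^bsub>H\<^esub>}}"
  "finite {\<sigma> x h | x h. x \<in> X \<union> {\<one>\<^bsub>H\<^esub>} \<and> h \<in> carrier H}"
proof -
  have "{\<sigma> h x | h x. h \<in> carrier H \<and> x \<in> X \<union> {\<one>\<^bsub>H\<^esub>}} \<subseteq> {\<sigma> h x | h x. h \<in> carrier H \<and> x \<in> X} \<union> {\<one>}"
    using \<sigma>_one(1) by auto
  then show "finite {\<sigma> h x | h x. h \<in> carrier H \<and> x \<in> X \<union> {\<one>\<^bsub>H\<^esub>}}"
    by (rule finite_subset) (simp add: \<sigma>_right_finite)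
  have "{\<sigma> x h | x h. x \<in> X \<union> {\<one>\<^bsub>H\<^esub>} \<and> h \<in> carrier H} \<subseteq> {\<sigma> x h | x h. x \<in> X \<and> h \<in> carrier H} \<union> {\<one>}"
    using \<sigma>_one(2) by auto
  then show "finite {\<sigma> x h | x h. x \<in> X \<union> {\<one>\<^bsub>H\<^esub>} \<and> h \<in> carrier H}"
    by (rule finite_subset) (simp add: \<sigma>_left_finite)
qed

text \<open>The prefixes of the left word in \<open>G\<close> are \<open>s(x) a s(h) = s(xh) \<sigma>(x,h) a\<close> with \<open>xh\<close> a prefix of the left word in
\<open>H\<close>. The central factor \<open>\<sigma>(x,h) a\<close> takes finitely many values; this uses that \<open>\<sigma>(X,H)\<close> is finite.\<close>

lemma staircase_lift_Cons:
  assumes F: "finite F" "F \<subseteq> carrier H" and Y: "finite Y" "Y \<subseteq> carrier G"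
  obtains F' where "finite F'" "F' \<subseteq> carrier G"
    "\<And>x a v w D. \<lbrakk>x \<in> X \<union> {\<one>\<^bsub>H\<^esub>}; a \<in> A; s x \<otimes> a \<in> Y; v \<in> lists X; w \<in> lists X; staircase H F D (x # v) w\<rbrakk>
       \<Longrightarrow> staircase G F' D ((s x \<otimes> a) # lift v) (lift w)"
proof -
  obtain F1 where F1: "finite F1" "F1 \<subseteq> carrier G"
    "\<And>h k. \<lbrakk>h \<in> carrier H; k \<in> carrier H; offset H h k \<in> F\<rbrakk> \<Longrightarrow> offset G (s h) (s k) \<in> F1"
    using section_offsets_finite_set[OF F] by metis
  let ?X = "X \<union> {\<one>\<^bsub>H\<^esub>}"
  define D1 where "D1 = {\<sigma> x h | x h. x \<in> ?X \<and> h \<in> carrier H}"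
  define D2 where "D2 = {a \<in> A. \<exists>x\<in>?X. s x \<otimes> a \<in> Y}"
  have X: "x \<in> carrier H" if "x \<in> ?X" for x using that X_sub by auto
  have D1: "finite D1" unfolding D1_def by (rule finite_cocycle_values(2))
  have D1A: "D1 \<subseteq> A" using \<sigma>_in X by (auto simp: D1_def)
  have D2: "finite D2" unfolding D2_def by (rule finite_kernel_parts[OF Y(1)])
  have D2A: "D2 \<subseteq> A" by (auto simp: D2_def)
  let ?F2 = "(\<lambda>a. inv a) ` (D1 <#> D2) <#> F1"
  let ?F' = "F1 \<union> ?F2"
  have "finite ?F'" by (intro finite_UnI finite_set_mult finite_imageI D1 D2 F1(1))
  moreover have "?F' \<subseteq> carrier G"
  proof -
    have "d \<otimes> d' \<in> carrier G" if "d \<in> D1" "d' \<in> D2" for d d'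
      using that D1A D2A A_carrier by blast
    then show ?thesis using F1(2) by (auto simp: set_mult_def)
  qed
  moreover have "staircase G ?F' D ((s x \<otimes> a) # lift v) (lift w)"
    if x: "x \<in> ?X" "a \<in> A" "s x \<otimes> a \<in> Y" and v: "v \<in> lists X" and w: "w \<in> lists X"
      and st: "staircase H F D (x # v) w" for x a v w D
  proof (rule staircase_map[OF st])
    fix i j assume ij: "close_pair H F D (take i (x # v)) (take j w)"
    let ?k = "word_eval H (take j w)"
    have xH: "x \<in> carrier H" using X x by blast
    have k: "?k \<in> carrier H" and wk: "word_eval G (take j (lift w)) = s ?k"
      using w lists_carrier[OF take_lists[OF w]] by (auto simp: take_lift word_eval_lift)
    have "offset G (word_eval G (take i ((s x \<otimes> a) # lift v))) (s ?k) \<in> ?F'"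
    proof (cases i)
      case 0
      then show ?thesis using ij F1(3)[of "\<one>\<^bsub>H\<^esub>" ?k] k by (simp add: close_pair_def)
    next
      case (Suc l)
      let ?h = "word_eval H (take l v)"
      have h: "?h \<in> carrier H" and vh: "word_eval G (take l (lift v)) = s ?h"
        using v lists_carrier[OF take_lists[OF v]] by (auto simp: take_lift word_eval_lift)
      have xh: "x \<otimes>\<^bsub>H\<^esub> ?h \<in> carrier H" using xH h by simp
      have d: "\<sigma> x ?h \<otimes> a \<in> D1 <#> D2"
        using x h by (intro set_multI) (auto simp: D1_def D2_def)
      have dG: "\<sigma> x ?h \<otimes> a \<in> carrier G" "\<sigma> x ?h \<in> carrier G" "a \<in> carrier G"
        using \<sigma>_in xH h x A_carrier by auto
      have "s x \<otimes> a \<otimes> s ?h = s (x \<otimes>\<^bsub>H\<^esub> ?h) \<otimes> (\<sigma> x ?h \<otimes> a)"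
        using section_mult[OF xH h x(2) A_closed(3)] xH h dG by simp
      moreover have "offset G (s (x \<otimes>\<^bsub>H\<^esub> ?h)) (s ?k) \<in> F1"
        using ij Suc by (intro F1(3) xh k) (simp add: close_pair_def)
      ultimately have "offset G (s x \<otimes> a \<otimes> s ?h) (s ?k) \<in> ?F2"
        using d dG xh k by (auto simp: G.offset_mult_left intro!: set_multI)
      then show ?thesis using Suc vh by simp
    qed
    then show "close_pair G ?F' D (take i ((s x \<otimes> a) # lift v)) (take j (lift w))"
      using ij wk by (simp add: close_pair_def)
  qed simp_all
  ultimately show ?thesis using that by blast
qed

end

section \<open>The language of the extension\<close>

context central_extension
begin

lemma word_eval_A: "set u \<subseteq> A \<Longrightarrow> word_eval G u \<in> A"
  by (induction u) (auto intro: A_closed)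

lemma offset_central:
  assumes "g \<in> carrier G" "h \<in> carrier G" "p \<in> A" "q \<in> A"
  shows "offset G (g \<otimes> p) (h \<otimes> q) = offset G g h \<otimes> offset G p q"
proof -
  have cl: "p \<in> carrier G" "q \<in> carrier G" "inv p \<in> A" using assms A_carrier A_closed by auto
  have "offset G (g \<otimes> p) (h \<otimes> q) = (inv p \<otimes> (inv g \<otimes> h)) \<otimes> q"
    using cl assms by (simp add: offset_def G.inv_mult_group G.m_assoc)
  also have "inv p \<otimes> (inv g \<otimes> h) = (inv g \<otimes> h) \<otimes> inv p"
    using central[OF _ cl(3)] assms by simp
  also have "\<dots> \<otimes> q = offset G g h \<otimes> offset G p q"
    using cl assms by (simp add: offset_def G.m_assoc)
  finally show ?thesis .
qed

text \<open>Central factors contribute to offsets independently of the rest. In the bound \<open>c + 1\<close>, the 1 accounts for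
the pairs in which only the left word has moved.\<close>

lemma staircase_append_central:
  assumes F: "finite F" "F \<subseteq> carrier G" and FB: "finite FB" "FB \<subseteq> A" and Y: "finite Y" "Y \<subseteq> A"
  obtains F' where "finite F'" "F' \<subseteq> carrier G"
    "\<And>v w b b' c D. \<lbrakk>staircase G F D v w; set v \<subseteq> carrier G; set w \<subseteq> carrier G; b \<in> lists Y; b' \<in> lists Y;
        sync_offsets G FB b b'; length b \<le> length b' + c; length b' \<le> length b + c\<rbrakk>
      \<Longrightarrow> staircase G F' (D + enat (c + 1)) (v @ b) (w @ b')"
proof -
  let ?F' = "F \<union> (F <#> FB) \<union> (F <#> ((\<lambda>y. inv y) ` Y <#> FB))"
  have main: "staircase G ?F' (D + enat (c + 1)) (v @ b) (w @ b')"
    if st: "staircase G F D v w" and vw: "set v \<subseteq> carrier G" "set w \<subseteq> carrier G"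
      and b: "b \<in> lists Y" "b' \<in> lists Y" and sync: "sync_offsets G FB b b'"
      and len: "length b \<le> length b' + c" "length b' \<le> length b + c" for v w b b' c D
  proof (rule staircase_append)
    have D: "D \<le> D + enat (c + 1)" by simp
    show "staircase G ?F' (D + enat (c + 1)) v w"
      by (rule staircase_mono[OF st _ D]) blast
    have vwe: "word_eval G v \<in> carrier G" "word_eval G w \<in> carrier G" using vw by auto
    have off_vw: "offset G (word_eval G v) (word_eval G w) \<in> F"
      and len_vw: "enat (length v) \<le> enat (length w) + D" "enat (length w) \<le> enat (length v) + D"
      using staircase_close[OF st] by (auto simp: close_pair_def)
    have take_b: "set (take i u) \<subseteq> carrier G" "word_eval G (take i u) \<in> A" if "u \<in> lists Y" for i u
    proof -
      have "set (take i u) \<subseteq> A" using that Y by (auto dest: in_set_takeD)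
      then show "word_eval G (take i u) \<in> A" by (rule word_eval_A)
      show "set (take i u) \<subseteq> carrier G" using \<open>set (take i u) \<subseteq> A\<close> A_carrier by blast
    qed
    have len_app: "enat (length v + m) \<le> enat (length w + n) + (D + enat (c + 1))"
      "enat (length w + m) \<le> enat (length v + n) + (D + enat (c + 1))" if "m \<le> n + (c + 1)" for m n
    proof -
      have "enat m \<le> enat n + enat (c + 1)" using that by simp
      from add_mono[OF len_vw(1) this] add_mono[OF len_vw(2) this]
      show "enat (length v + m) \<le> enat (length w + n) + (D + enat (c + 1))"
        "enat (length w + m) \<le> enat (length v + n) + (D + enat (c + 1))"
        by (simp_all only: plus_enat_simps(1)[symmetric] ac_simps)
    qed
    have off: "offset G (word_eval G (v @ take i b)) (word_eval G (w @ take j b')) =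
        offset G (word_eval G v) (word_eval G w) \<otimes> offset G (word_eval G (take i b)) (word_eval G (take j b'))" for i j
      using take_b[OF b(1), of i] take_b[OF b(2), of j] vw vwe
      by (simp add: G.word_eval_append offset_central)
    show "close_pair G ?F' (D + enat (c + 1)) (v @ take i b) (w @ take i b')" for i
    proof -
      have "offset G (word_eval G (v @ take i b)) (word_eval G (w @ take i b')) \<in> F <#> FB"
        unfolding off using off_vw sync by (intro set_multI) (auto simp: sync_offsets_def)
      moreover have "length (take i b) \<le> length (take i b') + (c + 1)" "length (take i b') \<le> length (take i b) + (c + 1)"
        using len by auto
      ultimately show ?thesis using len_app by (simp add: close_pair_def)
    qed
    show "close_pair G ?F' (D + enat (c + 1)) (v @ take (Suc i) b) (w @ take i b')" if i: "i < length b" for i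
    proof -
      have "b ! i \<in> Y" using i b(1) by (auto simp: in_lists_conv_set)
      then have y: "b ! i \<in> Y" "b ! i \<in> carrier G" using Y(2) A_carrier by blast+
      have "word_eval G (take (Suc i) b) = word_eval G (take i b) \<otimes> (b ! i)"
        using i y take_b(1)[OF b(1), of i] by (simp add: take_Suc_conv_app_nth G.word_eval_append)
      then have "offset G (word_eval G (take (Suc i) b)) (word_eval G (take i b')) =
          inv (b ! i) \<otimes> offset G (word_eval G (take i b)) (word_eval G (take i b'))"
        using y take_b(1)[OF b(1), of i] take_b(1)[OF b(2), of i] by (simp add: G.offset_mult_left)
      also have "\<dots> \<in> (\<lambda>y. inv y) ` Y <#> FB"
        using y sync by (intro set_multI imageI) (auto simp: sync_offsets_def)
      finally have "offset G (word_eval G (v @ take (Suc i) b)) (word_eval G (w @ take i b')) \<in>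
          F <#> ((\<lambda>y. inv y) ` Y <#> FB)"
        unfolding off using off_vw by (intro set_multI)
      moreover have "length (take (Suc i) b) \<le> length (take i b') + (c + 1)"
        "length (take i b') \<le> length (take (Suc i) b) + (c + 1)"
        using len by auto
      ultimately show ?thesis using len_app by (simp add: close_pair_def)
    qed
  qed
  have fin: "finite ?F'" by (intro finite_UnI finite_set_mult finite_imageI F FB Y)
  have sub: "?F' \<subseteq> carrier G"
  proof -
    have "inv y \<otimes> f \<in> carrier G" if "y \<in> Y" "f \<in> FB" for y f
      using that Y FB A_carrier by blast
    moreover have "f \<in> carrier G" if "f \<in> FB" for f using that FB A_carrier by blast
    ultimately show ?thesis using F by (auto simp: set_mult_def)
  qed
  show ?thesis by (rule that[OF fin sub main])
qed

end

lemma (in group) word_eval_generate: "w \<in> lists Z \<Longrightarrow> word_eval G w \<in> generate G Z"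
proof (induction w)
  case (Cons x w)
  then show ?case using generate.eng[OF generate.incl[of x Z G], of "word_eval G w"] by auto
qed (auto intro: generate.one)

locale combed_central_extension = marked_central_extension G H A s \<sigma> X
  for G :: "('g, 'm) monoid_scheme" (structure) and H :: "('h, 'n) monoid_scheme" and A s \<sigma> X +
  fixes L :: "'h list set" and Y :: "'g set" and B :: "'g list set"
  assumes L_language: "language_for H X L"
    and kernel: "kernel_language G A Y B"
begin

lemma L_lists: "w \<in> L \<Longrightarrow> w \<in> lists X"
  using L_language by (auto simp: language_for_def)

lemma L_exists: "h \<in> carrier H \<Longrightarrow> \<exists>w\<in>L. word_eval H w = h"
  using L_language by (auto simp: language_for_def)

lemma Y: "finite Y" "Y \<subseteq> A" and B_lists: "b \<in> B \<Longrightarrow> b \<in> lists Y" and B_regular: "regular B"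
  and B_nonempty: "[] \<notin> B" and B_eval: "word_eval G ` B = A"
proof -
  have "finite Y \<and> Y \<subseteq> A \<and> B \<subseteq> lists Y \<and> regular B \<and> [] \<notin> B \<and> word_eval G ` B = A"
    using kernel unfolding kernel_language_def by (elim conjE) (intro conjI)
  then show "finite Y" "Y \<subseteq> A" "b \<in> B \<Longrightarrow> b \<in> lists Y" "regular B" "[] \<notin> B" "word_eval G ` B = A"
    by blast+
qed

definition extension_generators :: "'g set" where
  "extension_generators = (lift_letters \<union> Y) \<union> (\<lambda>y. inv y) ` (lift_letters \<union> Y)"

definition extension_language :: "'g list set" where
  "extension_language = {lift v @ b | v b. v \<in> L \<and> b \<in> B}"

lemma finite_extension_generators: "finite extension_generators"
  unfolding extension_generators_def using finite_lift_letters Y(1) by simp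

text \<open>An inverse generator is of this form as well: its image in \<open>H\<close> is the inverse of \<open>x\<close>, and \<open>X\<close> is closed under
inverses.\<close>

lemma generator_decompose:
  assumes "y \<in> extension_generators \<union> {\<one>}"
  shows "\<exists>x\<in>X \<union> {\<one>\<^bsub>H\<^esub>}. \<exists>a\<in>A. y = s x \<otimes> a"
proof -
  have pos: "\<exists>x\<in>X \<union> {\<one>\<^bsub>H\<^esub>}. \<exists>a\<in>A. y = s x \<otimes> a" if "y \<in> lift_letters \<union> A" for y
    using that
  proof
    assume "y \<in> lift_letters"
    then obtain h x where hx: "h \<in> carrier H" "x \<in> X" "y = s x \<otimes> inv (\<sigma> h x)"
      unfolding lift_letters_def by blast
    then have "inv (\<sigma> h x) \<in> A" using \<sigma>_in A_closed X_sub by blast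
    then show ?thesis using hx by blast
  next
    assume "y \<in> A"
    then show ?thesis using A_carrier by (intro bexI[of _ "\<one>\<^bsub>H\<^esub>"] bexI[of _ y]) auto
  qed
  have neg: "\<exists>x\<in>X \<union> {\<one>\<^bsub>H\<^esub>}. \<exists>a\<in>A. inv y = s x \<otimes> a" if y: "y \<in> lift_letters \<union> A" for y
  proof -
    obtain x a where x: "x \<in> X \<union> {\<one>\<^bsub>H\<^esub>}" "a \<in> A" "y = s x \<otimes> a" using pos[OF y] by blast
    have xH: "x \<in> carrier H" using x X_sub by auto
    have yG: "y \<in> carrier G" using x xH A_carrier by simp
    obtain h b where h: "h \<in> carrier H" "b \<in> A" "inv y = s h \<otimes> b" using decompose yG by blast
    have "s (x \<otimes>\<^bsub>H\<^esub> h) \<otimes> (\<sigma> x h \<otimes> a \<otimes> b) = y \<otimes> inv y"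
      using section_mult[OF xH h(1) x(2) h(2)] unfolding h(3)[symmetric] x(3)[symmetric] by (rule sym)
    also have "\<dots> = s \<one>\<^bsub>H\<^esub> \<otimes> \<one>" using yG by simp
    finally have "s (x \<otimes>\<^bsub>H\<^esub> h) \<otimes> (\<sigma> x h \<otimes> a \<otimes> b) = s \<one>\<^bsub>H\<^esub> \<otimes> \<one>" .
    moreover have "\<sigma> x h \<otimes> a \<otimes> b \<in> A" using \<sigma>_in[OF xH h(1)] x(2) h(2) A_closed(1) by blast
    ultimately have "x \<otimes>\<^bsub>H\<^esub> h = \<one>\<^bsub>H\<^esub>"
      using s_left_cancel[of "x \<otimes>\<^bsub>H\<^esub> h" "\<one>\<^bsub>H\<^esub>"] xH h(1) A_closed(3) by blast
    then have "h = inv\<^bsub>H\<^esub> x" using H.inv_solve_left[of h x "\<one>\<^bsub>H\<^esub>"] xH h(1) by simp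
    then have "h \<in> X \<union> {\<one>\<^bsub>H\<^esub>}" using x(1) X_inv by auto
    then show ?thesis using h by blast
  qed
  consider "y \<in> lift_letters \<union> A" | z where "z \<in> lift_letters \<union> A" "y = inv z"
    using assms Y(2) A_closed(3) unfolding extension_generators_def by blast
  then show ?thesis using pos neg by cases auto
qed

lemma extension_generators_carrier: "extension_generators \<subseteq> carrier G"
proof
  fix y assume "y \<in> extension_generators"
  then obtain x a where "x \<in> X \<union> {\<one>\<^bsub>H\<^esub>}" "a \<in> A" "y = s x \<otimes> a" using generator_decompose by blast
  moreover have "x \<in> carrier H" using calculation X_sub by auto
  ultimately show "y \<in> carrier G" using A_carrier by simp
qed

lemma extension_language_letters: "w \<in> extension_language \<Longrightarrow> w \<in> lists extension_generators"
proof -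
  assume "w \<in> extension_language"
  then obtain v b where vb: "w = lift v @ b" "v \<in> L" "b \<in> B" unfolding extension_language_def by blast
  have "lift v \<in> lists extension_generators" "b \<in> lists extension_generators"
    using lift_in_lists[OF L_lists[OF vb(2)]] B_lists[OF vb(3)] unfolding extension_generators_def by auto
  then show ?thesis using vb(1) by simp
qed

lemma lift_carrier: "v \<in> lists X \<Longrightarrow> set (lift v) \<subseteq> carrier G"
  using set_lift lists_carrier by blast

lemma B_carrier: "b \<in> B \<Longrightarrow> set b \<subseteq> carrier G" "b \<in> B \<Longrightarrow> word_eval G b \<in> A"
proof -
  assume b: "b \<in> B"
  then show "word_eval G b \<in> A" using B_eval by blast
  have "set b \<subseteq> A" using B_lists[OF b] Y(2) by auto
  then show "set b \<subseteq> carrier G" using A_carrier by blast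
qed

lemma extension_word_eval:
  assumes "v \<in> L" "b \<in> B"
  shows "word_eval G (lift v @ b) = s (word_eval H v) \<otimes> word_eval G b"
  using lift_carrier[OF L_lists[OF assms(1)]] B_carrier[OF assms(2)] lists_carrier[OF L_lists[OF assms(1)]]
  by (simp add: G.word_eval_append word_eval_lift)

lemma extension_language_for: "language_for G extension_generators extension_language"
  unfolding language_for_def generating_set_def
proof (intro conjI ballI)
  show "finite extension_generators" by (rule finite_extension_generators)
  show carr: "extension_generators \<subseteq> carrier G" by (rule extension_generators_carrier)
  show "inv x \<in> extension_generators" if "x \<in> extension_generators" for x
  proof -
    have "y \<in> carrier G" if "y \<in> lift_letters \<union> Y" for y
      using that carr unfolding extension_generators_def by blast
    then show ?thesis using that unfolding extension_generators_def by auto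
  qed
  show ex: "\<exists>w\<in>extension_language. word_eval G w = g" if g: "g \<in> carrier G" for g
  proof -
    obtain h a where h: "h \<in> carrier H" "a \<in> A" "g = s h \<otimes> a" using decompose[OF g] by blast
    obtain v where v: "v \<in> L" "word_eval H v = h" using L_exists[OF h(1)] by blast
    obtain b where b: "b \<in> B" "word_eval G b = a" using B_eval h(2) by blast
    have "word_eval G (lift v @ b) = g" using extension_word_eval[OF v(1) b(1)] v b h by simp
    then show ?thesis using v b unfolding extension_language_def by blast
  qed
  show "extension_language \<subseteq> lists extension_generators" using extension_language_letters by blast
  show "generate G extension_generators = carrier G"
  proof
    show "generate G extension_generators \<subseteq> carrier G" using G.generate_in_carrier[OF carr] by blast
    show "carrier G \<subseteq> generate G extension_generators"
    proof
      fix g assume "g \<in> carrier G"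
      then obtain w where "w \<in> extension_language" "word_eval G w = g" using ex by blast
      then show "g \<in> generate G extension_generators"
        using G.word_eval_generate[OF extension_language_letters] by blast
    qed
  qed
qed

lemma extension_language_nonempty: "[] \<notin> extension_language"
  unfolding extension_language_def using B_nonempty by auto

text \<open>The normal forms at the end of two neighbouring words differ by a cocycle value \<open>d\<close> and the kernel part \<open>a\<close>
of the generator, hence by an element of a finite set.\<close>

lemma staircase_append_kernel:
  assumes S: "finite S" "S \<subseteq> A" and Z: "finite Z" and F: "finite F" "F \<subseteq> carrier G"
  obtains F' c where "finite F'" "F' \<subseteq> carrier G"
    "\<And>b b' d a x v w D. \<lbrakk>b \<in> B; b' \<in> B; d \<in> S; a \<in> A; x \<in> X \<union> {\<one>\<^bsub>H\<^esub>}; s x \<otimes> a \<in> Z;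
         word_eval G b' = word_eval G b \<otimes> (d \<otimes> a); staircase G F D v w; set v \<subseteq> carrier G; set w \<subseteq> carrier G\<rbrakk>
      \<Longrightarrow> staircase G F' (D + enat c) (v @ b) (w @ b')"
proof -
  let ?D = "S <#> {a \<in> A. \<exists>x\<in>X \<union> {\<one>\<^bsub>H\<^esub>}. s x \<otimes> a \<in> Z}"
  have "finite ?D" by (intro finite_set_mult finite_kernel_parts S Z)
  moreover have "?D \<subseteq> A" using S(2) A_closed(1) by (auto simp: set_mult_def)
  ultimately obtain FB c where FB: "finite FB" "FB \<subseteq> A"
    "\<forall>b\<in>B. \<forall>b'\<in>B. \<forall>d\<in>?D. word_eval G b' = word_eval G b \<otimes> d \<longrightarrow>
       sync_offsets G FB b b' \<and> length b \<le> length b' + c \<and> length b' \<le> length b + c"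
    using kernel unfolding kernel_language_def by (elim conjE allE[of _ ?D]) blast
  obtain F' where F': "finite F'" "F' \<subseteq> carrier G"
    "\<And>v w b b' c D. \<lbrakk>staircase G F D v w; set v \<subseteq> carrier G; set w \<subseteq> carrier G; b \<in> lists Y; b' \<in> lists Y;
        sync_offsets G FB b b'; length b \<le> length b' + c; length b' \<le> length b + c\<rbrakk>
      \<Longrightarrow> staircase G F' (D + enat (c + 1)) (v @ b) (w @ b')"
    by (rule staircase_append_central[OF F FB(1,2) Y]) blast
  show ?thesis
  proof (rule that[OF F'(1,2)])
    fix b b' d a x v w D
    assume *: "b \<in> B" "b' \<in> B" "d \<in> S" "a \<in> A" "x \<in> X \<union> {\<one>\<^bsub>H\<^esub>}" "s x \<otimes> a \<in> Z"
      "word_eval G b' = word_eval G b \<otimes> (d \<otimes> a)"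
      and st: "staircase G F D v w" "set v \<subseteq> carrier G" "set w \<subseteq> carrier G"
    have "d \<otimes> a \<in> ?D" using * by (intro set_multI) blast+
    then have "sync_offsets G FB b b' \<and> length b \<le> length b' + c \<and> length b' \<le> length b + c"
      using FB(3) * by blast
    then show "staircase G F' (D + enat (c + 1)) (v @ b) (w @ b')"
      using B_lists *(1,2) by (intro F'(3)[OF st]) blast+
  qed
qed

text \<open>If the words \<open>lift v @ b\<close> and \<open>lift w @ b'\<close> differ by \<open>s(x) a\<close> on the right, then comparing the two
components of \<open>s(w) b' = s(v) b s(x) a = s(vx) (b \<sigma>(v,x) a)\<close> shows that \<open>w = vx\<close> in \<open>H\<close> and
\<open>b' = b (\<sigma>(v,x) a)\<close> in \<open>A\<close>.\<close>

lemma extension_right_translates: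
  assumes F: "finite F" "F \<subseteq> carrier H" and comb: "combing_wrt H X (staircase H F D) L"
  obtains F' c where "finite F'" "F' \<subseteq> carrier G"
    "combing_wrt G extension_generators (staircase G F' (D + enat c)) extension_language"
proof -
  let ?Z = "extension_generators \<union> {\<one>}"
  let ?S = "{\<sigma> h x | h x. h \<in> carrier H \<and> x \<in> X \<union> {\<one>\<^bsub>H\<^esub>}}"
  have XH: "x \<in> carrier H" if "x \<in> X \<union> {\<one>\<^bsub>H\<^esub>}" for x using that X_sub by auto
  have SA: "?S \<subseteq> A" using \<sigma>_in XH by auto
  have finZ: "finite ?Z" using finite_extension_generators by simp
  obtain F1 where F1: "finite F1" "F1 \<subseteq> carrier G"
    "\<And>v w D. \<lbrakk>v \<in> lists X; w \<in> lists X; staircase H F D v w\<rbrakk> \<Longrightarrow> staircase G F1 D (lift v) (lift w)"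
    by (rule staircase_lift[OF F]) blast
  obtain F' c where F': "finite F'" "F' \<subseteq> carrier G"
    "\<And>b b' d a x v w D. \<lbrakk>b \<in> B; b' \<in> B; d \<in> ?S; a \<in> A; x \<in> X \<union> {\<one>\<^bsub>H\<^esub>}; s x \<otimes> a \<in> ?Z;
         word_eval G b' = word_eval G b \<otimes> (d \<otimes> a); staircase G F1 D v w; set v \<subseteq> carrier G; set w \<subseteq> carrier G\<rbrakk>
      \<Longrightarrow> staircase G F' (D + enat c) (v @ b) (w @ b')"
    by (rule staircase_append_kernel[OF finite_cocycle_values(1) SA finZ F1(1,2)]) blast
  have "staircase G F' (D + enat c) v' w'"
    if v': "v' \<in> extension_language" and w': "w' \<in> extension_language" and y: "y \<in> ?Z"
      and eq: "word_eval G w' = word_eval G v' \<otimes> y" for v' w' y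
  proof -
    obtain v b where v: "v' = lift v @ b" "v \<in> L" "b \<in> B" using v' unfolding extension_language_def by blast
    obtain w b' where w: "w' = lift w @ b'" "w \<in> L" "b' \<in> B" using w' unfolding extension_language_def by blast
    obtain x a where x: "x \<in> X \<union> {\<one>\<^bsub>H\<^esub>}" "a \<in> A" "y = s x \<otimes> a" using generator_decompose[OF y] by blast
    let ?v = "word_eval H v" and ?w = "word_eval H w"
    have cl: "?v \<in> carrier H" "?w \<in> carrier H" "x \<in> carrier H" using L_lists v w XH x by auto
    have bb: "word_eval G b \<in> A" "word_eval G b' \<in> A" using B_carrier v w by auto
    have \<sigma>: "\<sigma> ?v x \<in> A" using \<sigma>_in cl by blast
    have "s ?w \<otimes> word_eval G b' = s ?v \<otimes> word_eval G b \<otimes> (s x \<otimes> a)"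
      using eq unfolding v(1) w(1) x(3) extension_word_eval[OF v(2,3)] extension_word_eval[OF w(2,3)] .
    also have "\<dots> = s (?v \<otimes>\<^bsub>H\<^esub> x) \<otimes> (\<sigma> ?v x \<otimes> word_eval G b \<otimes> a)"
      by (rule section_mult[OF cl(1,3) bb(1) x(2)])
    also have "\<sigma> ?v x \<otimes> word_eval G b \<otimes> a = word_eval G b \<otimes> (\<sigma> ?v x \<otimes> a)"
      using central[of "word_eval G b" "\<sigma> ?v x"] \<sigma> bb x A_carrier by (simp add: G.m_assoc)
    finally have "?w = ?v \<otimes>\<^bsub>H\<^esub> x \<and> word_eval G b' = word_eval G b \<otimes> (\<sigma> ?v x \<otimes> a)"
      using cl bb \<sigma> x A_closed by (intro s_left_cancel) auto
    then have wv: "?w = ?v \<otimes>\<^bsub>H\<^esub> x" and b': "word_eval G b' = word_eval G b \<otimes> (\<sigma> ?v x \<otimes> a)" by auto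
    have "staircase H F D v w" using comb v(2) w(2) x(1) wv unfolding combing_wrt_def by blast
    then have st: "staircase G F1 D (lift v) (lift w)" using F1(3) L_lists v w by blast
    show ?thesis unfolding v(1) w(1)
      by (rule F'(3)[OF v(3) w(3) _ x(2) x(1) _ b' st]) (use cl x y lift_carrier L_lists v w in blast)+
  qed
  then have "combing_wrt G extension_generators (staircase G F' (D + enat c)) extension_language"
    unfolding combing_wrt_def using extension_language_for by blast
  then show ?thesis using that F' by blast
qed

text \<open>As on the right, with \<open>w = xv\<close> and \<open>b' = b (\<sigma>(x,v) a)\<close>. If \<open>x\<close> is the identity and not a generator, the
bicombing condition says nothing, and the combing condition for words with the same value is used instead.\<close>

lemma extension_left_translates:
  assumes F: "finite F" "F \<subseteq> carrier H" and bicomb: "bicombing_wrt H X (staircase H F D) L"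
  obtains F' c where "finite F'" "F' \<subseteq> carrier G"
    "\<And>v w y. \<lbrakk>v \<in> extension_language; w \<in> extension_language; y \<in> extension_generators;
        word_eval G w = y \<otimes> word_eval G v\<rbrakk> \<Longrightarrow> staircase G F' (D + enat c) (y # v) w"
proof -
  let ?Z = "extension_generators \<union> {\<one>}"
  let ?S = "{\<sigma> x h | x h. x \<in> X \<union> {\<one>\<^bsub>H\<^esub>} \<and> h \<in> carrier H}"
  have XH: "x \<in> carrier H" if "x \<in> X \<union> {\<one>\<^bsub>H\<^esub>}" for x using that X_sub by auto
  have SA: "?S \<subseteq> A" using \<sigma>_in XH by auto
  have finZ: "finite ?Z" using finite_extension_generators by simp
  have ZG: "?Z \<subseteq> carrier G" using extension_generators_carrier by auto
  obtain F1 where F1: "finite F1" "F1 \<subseteq> carrier G"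
    "\<And>x a v w D. \<lbrakk>x \<in> X \<union> {\<one>\<^bsub>H\<^esub>}; a \<in> A; s x \<otimes> a \<in> ?Z; v \<in> lists X; w \<in> lists X; staircase H F D (x # v) w\<rbrakk>
       \<Longrightarrow> staircase G F1 D ((s x \<otimes> a) # lift v) (lift w)"
    by (rule staircase_lift_Cons[OF F finZ ZG]) blast
  obtain F' c where F': "finite F'" "F' \<subseteq> carrier G"
    "\<And>b b' d a x v w D. \<lbrakk>b \<in> B; b' \<in> B; d \<in> ?S; a \<in> A; x \<in> X \<union> {\<one>\<^bsub>H\<^esub>}; s x \<otimes> a \<in> ?Z;
         word_eval G b' = word_eval G b \<otimes> (d \<otimes> a); staircase G F1 D v w; set v \<subseteq> carrier G; set w \<subseteq> carrier G\<rbrakk>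
      \<Longrightarrow> staircase G F' (D + enat c) (v @ b) (w @ b')"
    by (rule staircase_append_kernel[OF finite_cocycle_values(2) SA finZ F1(1,2)]) blast
  have "staircase G F' (D + enat (c + 1)) (y # v') w'"
    if v': "v' \<in> extension_language" and w': "w' \<in> extension_language" and y: "y \<in> extension_generators"
      and eq: "word_eval G w' = y \<otimes> word_eval G v'" for v' w' y
  proof -
    obtain v b where v: "v' = lift v @ b" "v \<in> L" "b \<in> B" using v' unfolding extension_language_def by blast
    obtain w b' where w: "w' = lift w @ b'" "w \<in> L" "b' \<in> B" using w' unfolding extension_language_def by blast
    obtain x a where x: "x \<in> X \<union> {\<one>\<^bsub>H\<^esub>}" "a \<in> A" "y = s x \<otimes> a" using generator_decompose[of y] y by blast
    let ?v = "word_eval H v" and ?w = "word_eval H w"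
    have cl: "?v \<in> carrier H" "?w \<in> carrier H" "x \<in> carrier H" using L_lists v w XH x by auto
    have bb: "word_eval G b \<in> A" "word_eval G b' \<in> A" using B_carrier v w by auto
    have \<sigma>: "\<sigma> x ?v \<in> A" using \<sigma>_in cl by blast
    have "s ?w \<otimes> word_eval G b' = s x \<otimes> a \<otimes> (s ?v \<otimes> word_eval G b)"
      using eq unfolding v(1) w(1) x(3) extension_word_eval[OF v(2,3)] extension_word_eval[OF w(2,3)] .
    also have "\<dots> = s (x \<otimes>\<^bsub>H\<^esub> ?v) \<otimes> (\<sigma> x ?v \<otimes> a \<otimes> word_eval G b)"
      by (rule section_mult[OF cl(3,1) x(2) bb(1)])
    also have "\<sigma> x ?v \<otimes> a \<otimes> word_eval G b = word_eval G b \<otimes> (\<sigma> x ?v \<otimes> a)"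
      using central[of "word_eval G b" "\<sigma> x ?v \<otimes> a"] \<sigma> bb x A_carrier A_closed by simp
    finally have "?w = x \<otimes>\<^bsub>H\<^esub> ?v \<and> word_eval G b' = word_eval G b \<otimes> (\<sigma> x ?v \<otimes> a)"
      using cl bb \<sigma> x A_closed by (intro s_left_cancel) auto
    then have wv: "?w = x \<otimes>\<^bsub>H\<^esub> ?v" and b': "word_eval G b' = word_eval G b \<otimes> (\<sigma> x ?v \<otimes> a)" by auto
    have D1: "D \<le> D + 1" by simp
    have "staircase H F (D + 1) (x # v) w"
    proof (cases "x \<in> X")
      case True
      then have "staircase H F D (x # v) w" using bicomb v(2) w(2) wv unfolding bicombing_wrt_def by blast
      then show ?thesis by (rule staircase_mono[OF _ order_refl D1])
    next
      case False
      then have x1: "x = \<one>\<^bsub>H\<^esub>" using x(1) by blast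
      then have "?w = ?v \<otimes>\<^bsub>H\<^esub> \<one>\<^bsub>H\<^esub>" using wv cl by simp
      then have "staircase H F D v w" using bicomb v(2) w(2) unfolding bicombing_wrt_def combing_wrt_def by blast
      then show ?thesis unfolding x1
        using lists_carrier L_lists v(2) w(2) by (intro H.staircase_Cons_one) blast+
    qed
    then have st: "staircase G F1 (D + 1) (y # lift v) (lift w)"
      unfolding x(3) using x y L_lists v w by (intro F1(3)) blast+
    have yG: "set (y # lift v) \<subseteq> carrier G" using y extension_generators_carrier lift_carrier L_lists v by auto
    have D2: "(D + 1) + enat c = D + enat (c + 1)" by (simp add: add.assoc one_enat_def)
    have "staircase G F' ((D + 1) + enat c) ((y # lift v) @ b) (lift w @ b')"
      by (rule F'(3)[OF v(3) w(3) _ x(2) x(1) _ b' st yG]) (use cl x y lift_carrier L_lists v w in blast)+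
    then show ?thesis unfolding v(1) w(1) D2 by (simp only: append_Cons)
  qed
  then show ?thesis by (rule that[OF F'(1,2)])
qed

lemma extension_combing:
  assumes F: "finite F" "F \<subseteq> carrier H" and comb: "combing_wrt H X (staircase H F D) L"
  obtains F' c where "finite F'" "F' \<subseteq> carrier G"
    "combing_wrt G extension_generators (staircase G F' (D + enat c)) extension_language"
    "bicombing_wrt H X (staircase H F D) L \<Longrightarrow>
       bicombing_wrt G extension_generators (staircase G F' (D + enat c)) extension_language"
proof -
  obtain F1 c1 where 1: "finite F1" "F1 \<subseteq> carrier G"
    "combing_wrt G extension_generators (staircase G F1 (D + enat c1)) extension_language"
    by (rule extension_right_translates[OF F comb])
  show ?thesis
  proof (cases "bicombing_wrt H X (staircase H F D) L")
    case False
    then show ?thesis using that 1 by blast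
  next
    case True
    obtain F2 c2 where 2: "finite F2" "F2 \<subseteq> carrier G"
      "\<And>v w y. \<lbrakk>v \<in> extension_language; w \<in> extension_language; y \<in> extension_generators;
        word_eval G w = y \<otimes> word_eval G v\<rbrakk> \<Longrightarrow> staircase G F2 (D + enat c2) (y # v) w"
      by (rule extension_left_translates[OF F True]) blast
    have D: "D + enat c1 \<le> D + enat (c1 + c2)" "D + enat c2 \<le> D + enat (c1 + c2)"
      by (intro add_left_mono; simp)+
    have c: "combing_wrt G extension_generators (staircase G (F1 \<union> F2) (D + enat (c1 + c2))) extension_language"
      by (rule combing_wrt_mono[OF 1(3)]) (erule staircase_mono[OF _ Un_upper1 D(1)])
    moreover have "bicombing_wrt G extension_generators (staircase G (F1 \<union> F2) (D + enat (c1 + c2))) extension_language"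
      unfolding bicombing_wrt_def using c staircase_mono[OF 2(3) Un_upper2 D(2)] by blast
    moreover have "finite (F1 \<union> F2)" "F1 \<union> F2 \<subseteq> carrier G" using 1 2 by auto
    ultimately show ?thesis by (intro that)
  qed
qed

end

section \<open>The lift as a GSM mapping\<close>

context marked_central_extension
begin

text \<open>The cocycle takes finitely many values on \<open>L\<close> with a fixed generator, so \<open>L\<close> is a finite union of regular
sets. Without generators, \<open>L\<close> is finite.\<close>

lemma finite_quots_regular_cocycle:
  assumes L: "language_for H X L" and \<sigma>: "\<And>x a. \<lbrakk>x \<in> X; a \<in> A\<rbrakk> \<Longrightarrow> finite_quots {v \<in> L. \<sigma> (word_eval H v) x = a}"
  shows "finite_quots L"
proof (cases "X = {}")
  case True
  then have "L \<subseteq> {[]}" using L by (auto simp: language_for_def)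
  then show ?thesis by (intro finite_quots_finite) (rule finite_subset, auto)
next
  case False
  then obtain x where x: "x \<in> X" "x \<in> carrier H" using X_sub by blast
  define S where "S = {\<sigma> h x | h x. h \<in> carrier H \<and> x \<in> X}"
  have S: "finite S" "S \<subseteq> A" unfolding S_def using \<sigma>_right_finite \<sigma>_in X_sub by auto
  have "\<sigma> (word_eval H v) x \<in> S" if "v \<in> L" for v
  proof -
    have "v \<in> lists X" using that L unfolding language_for_def by blast
    then have "word_eval H v \<in> carrier H" by (rule eval_in)
    then show ?thesis using x(1) unfolding S_def by blast
  qed
  then have "L = (\<Union>a\<in>S. {v \<in> L. \<sigma> (word_eval H v) x = a})" by auto
  moreover have "finite_quots (\<Union>a\<in>S. {v \<in> L. \<sigma> (word_eval H v) x = a})"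
  proof (rule finite_quots_UN[OF S(1)])
    fix a assume "a \<in> S"
    then have "a \<in> A" using S(2) by (rule subsetD[rotated])
    then show "finite_quots {v \<in> L. \<sigma> (word_eval H v) x = a}" by (rule \<sigma>[OF x(1)])
  qed
  ultimately show ?thesis by simp
qed

text \<open>The memory of the machine consists of the left quotients, for each generator \<open>x\<close> and each cocycle value, of the
set of prefixes after which the letter \<open>x\<close> meets this value of the cocycle.\<close>

lemma lift_gsm:
  assumes F: "finite F" "F \<subseteq> carrier H" and comb: "combing_wrt H X (staircase H F \<infinity>) L"
    and \<sigma>: "\<And>x a. \<lbrakk>x \<in> X; a \<in> A\<rbrakk> \<Longrightarrow> finite_quots {v \<in> L. \<sigma> (word_eval H v) x = a}"
    and c: "inj_on c X"
  shows "\<exists>M. is_gsm M \<and> gsm_map M (map c ` L) = map c' ` lift ` L"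
proof -
  have lang: "language_for H X L" and L: "L \<subseteq> lists X"
    using comb by (auto simp: combing_wrt_def language_for_def)
  define S where "S = {\<sigma> h x | h x. h \<in> carrier H \<and> x \<in> X}"
  have S: "finite S" "S \<subseteq> A" unfolding S_def using \<sigma>_right_finite \<sigma>_in X_sub by auto
  define R where "R p = {v \<in> prefixes_of L. \<sigma> (word_eval H v) (fst p) = snd p}" for p
  have R: "finite_quots (R p)" if "p \<in> X \<times> S" for p
  proof -
    have L_quots: "finite_quots L" by (rule finite_quots_regular_cocycle[OF lang \<sigma>])
    have p: "fst p \<in> X" "snd p \<in> A" using that S(2) by auto
    show ?thesis unfolding R_def
      by (rule finite_quots_prefixes[OF F comb L_quots, where P = "\<lambda>h. \<sigma> h (fst p) = snd p"]) (rule \<sigma>[OF p])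
  qed
  define \<kappa> where "\<kappa> v = (\<lambda>p. (p, quot v (R p))) ` (X \<times> S)" for v
  have "range \<kappa> \<subseteq> Pow (\<Union>p\<in>X \<times> S. {p} \<times> range (\<lambda>v. quot v (R p)))"
    unfolding \<kappa>_def by auto
  moreover have "finite (\<Union>p\<in>X \<times> S. {p} \<times> range (\<lambda>v. quot v (R p)))"
    using R finite_X S(1) by (auto simp: finite_quots_def)
  ultimately have fin: "finite (range \<kappa>)" by (meson finite_Pow_iff finite_subset)
  have \<kappa>_eq: "quot v (R p) = quot v' (R p)" if "\<kappa> v = \<kappa> v'" "p \<in> X \<times> S" for v v' p
  proof -
    have "(p, quot v (R p)) \<in> \<kappa> v'" using that unfolding \<kappa>_def by blast
    then show ?thesis unfolding \<kappa>_def by auto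
  qed
  have pref: "v \<in> prefixes_of L \<and> v \<in> lists X \<and> x \<in> X" if vx: "v @ [x] \<in> prefixes_of L" for v x
  proof -
    obtain u where u: "(v @ [x]) @ u \<in> L" using vx unfolding prefixes_of_def by blast
    then have "(v @ [x]) @ u \<in> lists X" using L by blast
    then show ?thesis using u unfolding prefixes_of_def by auto
  qed
  have "\<exists>M. is_gsm M \<and> gsm_map M (map c ` L) = map c' ` seq_map lift_letter ` L"
  proof (rule seq_map_gsm[OF finite_X c L fin finite_lift_letters])
    fix v x assume "v @ [x] \<in> prefixes_of L"
    then have "word_eval H v \<in> carrier H" "x \<in> X" using pref by blast+
    then show "lift_letter v x \<in> lift_letters"
      unfolding lift_letter_def lift_letters_def by blast
  next
    fix v v' x assume v: "v @ [x] \<in> prefixes_of L" and v': "v' @ [x] \<in> prefixes_of L" and eq: "\<kappa> v = \<kappa> v'"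
    let ?p = "(x, \<sigma> (word_eval H v) x)"
    have "word_eval H v \<in> carrier H" using pref[OF v] by blast
    then have p: "?p \<in> X \<times> S" using pref[OF v] unfolding S_def by blast
    have "v \<in> R ?p" using pref[OF v] by (simp add: R_def)
    then have "[] \<in> quot v (R ?p)" by simp
    then have "v' \<in> R ?p" unfolding \<kappa>_eq[OF eq p] by simp
    then have "\<sigma> (word_eval H v') x = \<sigma> (word_eval H v) x" by (simp add: R_def)
    moreover have "\<kappa> (v @ [x]) = \<kappa> (v' @ [x])"
      unfolding \<kappa>_def by (rule image_cong[OF refl]) (simp add: quot_append \<kappa>_eq[OF eq])
    ultimately show "lift_letter v x = lift_letter v' x \<and> \<kappa> (v @ [x]) = \<kappa> (v' @ [x])"
      by (simp add: lift_letter_def)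
  qed
  then show ?thesis by (simp add: lift_def)
qed

end

section \<open>Combings of central extensions\<close>

theorem proposition6p3:
  fixes \<F> :: "nat list set set"
    and H :: "('h, 'n) monoid_scheme" and X :: "'h set" and L :: "'h list set"
    and G :: "('g, 'm) monoid_scheme" and A :: "'g set"
    and \<phi> :: "'g set \<Rightarrow> 'h" and s :: "'h \<Rightarrow> 'g" and \<sigma> :: "'h \<Rightarrow> 'h \<Rightarrow> 'g"
  assumes "language_family \<F>"
    and "closed_under_gsm \<F>"
    and "closed_under_concat_regular \<F>"
    and "group H"
    and "combing H X L"
    and "in_family \<F> X L"
    and "fin_gen_abelian_subgroup G A"
    and "extension_by_cocycle G A H \<phi> s \<sigma>"
    and "trivial_action G A H s"
    and "regular_cocycle H X L A \<sigma>"
  shows "\<exists>X'' L''.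
      in_family \<F> X'' L'' \<and> async_combing G X'' L'' \<and>
      (bicombing H X L \<longrightarrow> async_bicombing G X'' L'') \<and>
      (near_geodesic H X L \<longrightarrow>
         (sync_combing H X L \<longrightarrow> sync_combing G X'' L'') \<and>
         (sync_bicombing H X L \<longrightarrow> sync_bicombing G X'' L'') \<and>
         (bounded_async_combing H X L \<longrightarrow> bounded_async_combing G X'' L'') \<and>
         (bounded_async_bicombing H X L \<longrightarrow> bounded_async_bicombing G X'' L''))"
proof -
  have "language_for H X L"
    using assms(5) unfolding combing_def bicombing_def sync_combing_def async_combing_def bounded_async_combing_def
      sync_bicombing_def async_bicombing_def bounded_async_bicombing_def bicombing_wrt_def combing_wrt_def
    by blast
  then interpret H: marked_group H X using group.marked_group_language_for[OF assms(4)] by blast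
  have ext: "central_extension G H A s \<sigma>" using central_extensionI[OF assms(7-9)] .
  have "group G" using assms(8) unfolding extension_by_cocycle_def by blast
  obtain Y B where kernel: "kernel_language G A Y B"
    using kernel_language_exists[OF \<open>group G\<close> assms(7)] by blast
  have fin: "finite {\<sigma> x h | x h. x \<in> X \<and> h \<in> carrier H}" "finite {\<sigma> h x | h x. h \<in> carrier H \<and> x \<in> X}"
    and reg: "\<And>x a. \<lbrakk>x \<in> X; a \<in> A\<rbrakk> \<Longrightarrow> finite_quots {v \<in> L. \<sigma> (word_eval H v) x = a}"
    using assms(10) regular_imp_finite_quots(1) unfolding regular_cocycle_def by blast+
  interpret E: combed_central_extension G H A s \<sigma> X L Y B
    by (intro combed_central_extension.intro marked_central_extension.intro
        marked_central_extension_axioms.intro combed_central_extension_axioms.intro)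
      (fact ext H.marked_group_axioms fin \<open>language_for H X L\<close> kernel)+
  let ?X = "E.extension_generators" and ?L = "E.extension_language"
  interpret G: marked_group G ?X
    using group.marked_group_language_for[OF \<open>group G\<close> E.extension_language_for] .
  note ne = E.extension_language_nonempty

  have family: "in_family \<F> ?X ?L"
  proof -
    obtain c where c: "inj_on c X" "map c ` L \<in> \<F>" using assms(6) unfolding in_family_def by blast
    obtain c' :: "'g \<Rightarrow> nat" where c': "inj_on c' ?X"
      using finite_imp_inj_to_nat_seg[OF E.finite_extension_generators] by blast
    obtain F where "finite F" "F \<subseteq> carrier H" "combing_wrt H X (staircase H F \<infinity>) L"
      by (rule H.combing_imp_staircase[OF assms(5)])
    then obtain M where M: "is_gsm M" "gsm_map M (map c ` L) = map c' ` E.lift ` L"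
      using E.lift_gsm[OF _ _ _ reg c(1), of F c'] by blast
    have 1: "map c' ` E.lift ` L \<in> \<F>"
      using assms(2) c(2) M unfolding closed_under_gsm_def by metis
    have "regular (map c' ` B)" by (rule regular_map_image[OF E.B_regular])
    then have "{u @ v | u v. u \<in> map c' ` E.lift ` L \<and> v \<in> map c' ` B} \<in> \<F>"
      using assms(3) 1 unfolding closed_under_concat_regular_def by blast
    moreover have "{u @ v | u v. u \<in> map c' ` E.lift ` L \<and> v \<in> map c' ` B} = map c' ` ?L"
    proof
      show "{u @ v | u v. u \<in> map c' ` E.lift ` L \<and> v \<in> map c' ` B} \<subseteq> map c' ` ?L"
      proof clarify
        fix v b assume "v \<in> L" "b \<in> B"
        then have "E.lift v @ b \<in> ?L" unfolding E.extension_language_def by blast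
        then show "map c' (E.lift v) @ map c' b \<in> map c' ` ?L" by (metis image_eqI map_append)
      qed
      show "map c' ` ?L \<subseteq> {u @ v | u v. u \<in> map c' ` E.lift ` L \<and> v \<in> map c' ` B}"
        unfolding E.extension_language_def by fastforce
    qed
    ultimately have "map c' ` ?L \<in> \<F>" by simp
    then show ?thesis using c' E.extension_language_letters unfolding in_family_def by blast
  qed
  have async: "async_combing G ?X ?L"
  proof -
    obtain F where F: "finite F" "F \<subseteq> carrier H" "combing_wrt H X (staircase H F \<infinity>) L"
      by (rule H.combing_imp_staircase[OF assms(5)])
    obtain F' c where "finite F'" "F' \<subseteq> carrier G" "combing_wrt G ?X (staircase G F' (\<infinity> + enat c)) ?L"
      by (rule E.extension_combing[OF F])
    then show ?thesis by (rule G.staircase_combing_async(1)[OF _ _ ne])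
  qed
  have async_bi: "async_bicombing G ?X ?L" if bi: "bicombing H X L"
  proof -
    obtain F where F: "finite F" "F \<subseteq> carrier H" "bicombing_wrt H X (staircase H F \<infinity>) L"
      by (rule H.bicombing_imp_staircase[OF bi])
    have comb: "combing_wrt H X (staircase H F \<infinity>) L" using F(3) by (simp add: bicombing_wrt_def)
    obtain F' c where "finite F'" "F' \<subseteq> carrier G" "bicombing_wrt G ?X (staircase G F' (\<infinity> + enat c)) ?L"
      by (rule E.extension_combing[OF F(1,2) comb]) (use F(3) in blast)
    then show ?thesis by (rule G.staircase_combing_async(2)[OF _ _ ne])
  qed
  have sync: "sync_combing G ?X ?L \<and> bounded_async_combing G ?X ?L" if ng: "near_geodesic H X L"
  proof -
    obtain F where F: "finite F" "F \<subseteq> carrier H" "combing_wrt H X (staircase H F \<infinity>) L"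
      by (rule H.combing_imp_staircase[OF assms(5)])
    obtain d where d: "combing_wrt H X (staircase H F (enat d)) L"
      by (rule H.near_geodesic_staircase[OF ng F])
    obtain F' c where "finite F'" "F' \<subseteq> carrier G" "combing_wrt G ?X (staircase G F' (enat d + enat c)) ?L"
      by (rule E.extension_combing[OF F(1,2) d])
    then show ?thesis unfolding plus_enat_simps by (rule G.staircase_combing_sync(1)[OF _ _ ne])
  qed
  have sync_bi: "sync_bicombing G ?X ?L \<and> bounded_async_bicombing G ?X ?L"
    if ng: "near_geodesic H X L" and bi: "bicombing H X L"
  proof -
    obtain F where F: "finite F" "F \<subseteq> carrier H" "bicombing_wrt H X (staircase H F \<infinity>) L"
      by (rule H.bicombing_imp_staircase[OF bi])
    have comb: "combing_wrt H X (staircase H F \<infinity>) L" using F(3) by (simp add: bicombing_wrt_def)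
    obtain d where d: "combing_wrt H X (staircase H F (enat d)) L" "bicombing_wrt H X (staircase H F (enat d)) L"
      by (rule H.near_geodesic_staircase[OF ng F(1,2) comb]) (use F(3) in blast)
    obtain F' c where "finite F'" "F' \<subseteq> carrier G" "bicombing_wrt G ?X (staircase G F' (enat d + enat c)) ?L"
      by (rule E.extension_combing[OF F(1,2) d(1)]) (use d(2) in blast)
    then show ?thesis unfolding plus_enat_simps by (rule G.staircase_combing_sync(2)[OF _ _ ne])
  qed
  show ?thesis
    using family async async_bi sync sync_bi unfolding bicombing_def by blast
qed

end
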